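(* Let $1<p\leq 2\leq q<\infty$. There is a constant $C_{p,q}>0$ depending only on $p$ and $q$ such that for every left-invariant operator $A$ on $\mathrm{SU}(2)$ with symbol $\sigma_A$, $$\|A\|_{L^p(\mathrm{SU}(2))\to L^q(\mathrm{SU}(2))}\leq C_{p,q}\,\sup_{s>0}\ s\left(\sum_{\substack{l\in\frac12\mathbb{N}_0\\ \|\sigma_A(l)\|_{\mathrm{op}}>s}}(2l+1)^2\right)^{\frac1p-\frac1q}.$$
   Context: $\mathrm{SU}(2)$ carries the normalized Haar measure $du$, and $\frac12\mathbb{N}_0=\{0,\frac12,1,\frac32,\dots\}$. For $l\in\frac12\mathbb{N}_0$, let $V_l$ be the $(2l+1)$-dimensional space of homogeneous polynomials of degree $2l$ in two complex variables $z=(z_1,z_2)$ (a row vector), and let $t^l$ be the irreducible representation $(t^l(u)P)(z)=P(zu)$ of $\mathrm{SU}(2)$ on $V_l$, written in a basis of $V_l$ making it a unitary matrix representation $t^l:\mathrm{SU}(2)\to \mathrm{U}(2l+1)$. Every irreducible unitary representation of $\mathrm{SU}(2)$ is equivalent to exactly one $t^l$. The Fourier coefficient of $f$ is the matrix $\widehat f(l)=\int_{\mathrm{SU}(2)}f(u)\,t^l(u)^*\,du\in\mathbb{C}^{(2l+1)\times(2l+1)}$ (extended to distributions by duality). A left-invariant operator on $\mathrm{SU}(2)$ is a continuous linear operator $A:C^\infty(\mathrm{SU}(2))\to\mathcal{D}'(\mathrm{SU}(2))$ commuting with all left translations $\tau_gf(x)=f(g^{-1}x)$. Such an operator is a Fourier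 multiplier: there are matrices $\sigma_A(l)\in\mathbb{C}^{(2l+1)\times(2l+1)}$ (the symbol of $A$) with $\widehat{Af}(l)=\sigma_A(l)\widehat f(l)$ for all $f\in C^\infty(\mathrm{SU}(2))$ and $l\in\frac12\mathbb{N}_0$. $\|A\|_{L^p\to L^q}\in[0,\infty]$ is the $L^p\to L^q$ operator norm of $A$ ($\infty$ if $A$ has no bounded extension), and $\|M\|_{\mathrm{op}}$ is the operator norm of a matrix $M$ on $\ell^2$. *)

theory Defs
  imports "HOL-Analysis.Analysis" "Jordan_Normal_Form.Schur_Decomposition"
begin

section \<open>The group SU(2)\<close>

definition cadjoint :: "complex^2^2 \<Rightarrow> complex^2^2" where
  "cadjoint U = (\<chi> i j. cnj (vec_nth (vec_nth U j) i))"

definition SU2 :: "(complex^2^2) set" where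
  "SU2 = {U. U ** cadjoint U = Finite_Cartesian_Product.mat 1 \<and> Determinants.det U = 1}"

lemma cadjoint_mult: "cadjoint (U ** V) = cadjoint V ** cadjoint U"
  by (simp add: cadjoint_def Finite_Cartesian_Product.vec_eq_iff matrix_matrix_mult_def
      mult.commute)

lemma cadjoint_cadjoint: "cadjoint (cadjoint U) = U"
  by (simp add: cadjoint_def Finite_Cartesian_Product.vec_eq_iff)

lemma det_cadjoint: "Determinants.det (cadjoint U) = cnj (Determinants.det U)"
  by (simp add: cadjoint_def Determinants.det_transpose Determinants.det_2)

lemma SU2_one: "Finite_Cartesian_Product.mat 1 \<in> SU2"
proof -
  have "cadjoint (Finite_Cartesian_Product.mat 1) = Finite_Cartesian_Product.mat 1"
    by (simp add: cadjoint_def Finite_Cartesian_Product.vec_eq_iff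
        Finite_Cartesian_Product.mat_def)
  thus ?thesis by (simp add: SU2_def)
qed

lemma SU2_mult:
  assumes "U \<in> SU2" "V \<in> SU2" shows "U ** V \<in> SU2"
proof -
  have "(U ** V) ** cadjoint (U ** V) = U ** (V ** cadjoint V) ** cadjoint U"
    by (simp add: cadjoint_mult matrix_mul_assoc)
  thus ?thesis using assms by (simp add: SU2_def Determinants.det_mul)
qed

lemma SU2_cadjoint:
  assumes "U \<in> SU2" shows "cadjoint U \<in> SU2"
  using assms by (simp add: SU2_def cadjoint_cadjoint det_cadjoint matrix_left_right_inverse)

typedef su2 = SU2
  using SU2_one by blast

instantiation su2 :: monoid_mult
begin
definition one_su2 :: su2 where "1 = Abs_su2 (Finite_Cartesian_Product.mat 1)"
definition times_su2 :: "su2 \<Rightarrow> su2 \<Rightarrow> su2" where "u * v = Abs_su2 (Rep_su2 u ** Rep_su2 v)"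
instance
  by standard
    (auto simp: one_su2_def times_su2_def Abs_su2_inverse Rep_su2_inverse Rep_su2 SU2_one SU2_mult
      matrix_mul_assoc)
end

instantiation su2 :: inverse
begin
definition inverse_su2 :: "su2 \<Rightarrow> su2" where "inverse u = Abs_su2 (cadjoint (Rep_su2 u))"
definition divide_su2 :: "su2 \<Rightarrow> su2 \<Rightarrow> su2" where "u div v = u * inverse (v::su2)"
instance ..
end

lemma su2_right_inverse: "(u::su2) * inverse u = 1"
  using Rep_su2[of u]
  by (simp add: one_su2_def times_su2_def inverse_su2_def Abs_su2_inverse SU2_cadjoint)
    (simp add: SU2_def)

lemma su2_left_inverse: "inverse (u::su2) * u = 1"
proof -
  have "cadjoint (Rep_su2 u) ** Rep_su2 u = Finite_Cartesian_Product.mat 1"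
    using Rep_su2[of u] matrix_left_right_inverse[of "Rep_su2 u"] by (simp add: SU2_def)
  thus ?thesis
    by (simp add: one_su2_def times_su2_def inverse_su2_def Abs_su2_inverse SU2_cadjoint Rep_su2)
qed

instantiation su2 :: metric_space
begin
definition dist_su2 :: "su2 \<Rightarrow> su2 \<Rightarrow> real" where
  "dist u v = dist (Rep_su2 u) (Rep_su2 v)"
definition uniformity_su2 :: "(su2 \<times> su2) filter" where
  "uniformity = (INF e\<in>{0<..}. principal {(u, v). dist (u::su2) v < e})"
definition open_su2 :: "su2 set \<Rightarrow> bool" where
  "open (S :: su2 set) = (\<forall>u\<in>S. \<forall>\<^sub>F (u', v) in uniformity. u' = u \<longrightarrow> v \<in> S)"
instance
  by standard
    (auto simp: dist_su2_def uniformity_su2_def open_su2_def Rep_su2_inject dist_triangle2 split_beta')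
end

definition normalized_haar :: "su2 measure \<Rightarrow> bool" where
  "normalized_haar \<mu> \<longleftrightarrow> sets \<mu> = sets borel \<and> emeasure \<mu> UNIV = 1 \<and>
     (\<forall>g. distr \<mu> borel (\<lambda>u. g * u) = \<mu>)"

section \<open>Smooth functions and distributions on SU(2)\<close>

text \<open>The one-parameter subgroups \<open>t \<mapsto> exp (t X)\<close> for the basis
  \<open>[[0,i],[i,0]]\<close>, \<open>[[0,1],[-1,0]]\<close>, \<open>[[i,0],[0,-i]]\<close> of the Lie algebra su(2).\<close>

datatype su2_axis = AX | AY | AZ

fun exp_mat :: "su2_axis \<Rightarrow> real \<Rightarrow> complex^2^2" where
  "exp_mat AX t = vector [vector [of_real (cos t), \<i> * of_real (sin t)],
                          vector [\<i> * of_real (sin t), of_real (cos t)]]"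
| "exp_mat AY t = vector [vector [of_real (cos t), of_real (sin t)],
                          vector [- of_real (sin t), of_real (cos t)]]"
| "exp_mat AZ t = vector [vector [cis t, 0], vector [0, cis (- t)]]"

lemma cos_sin_complex: "complex_of_real (cos t) * of_real (cos t) + of_real (sin t) * of_real (sin t) = 1"
  by (metis of_real_1 of_real_add of_real_mult power2_eq_square sin_cos_squared_add2)

lemma exp_mat_SU2: "exp_mat a t \<in> SU2"
  using cos_sin_complex[of t]
  by (cases a) (auto simp: SU2_def cadjoint_def Finite_Cartesian_Product.vec_eq_iff forall_2
      matrix_matrix_mult_def sum_2 Finite_Cartesian_Product.mat_def Determinants.det_2
      cis_cnj cis_mult algebra_simps)

definition su2_exp :: "su2_axis \<Rightarrow> real \<Rightarrow> su2" where
  "su2_exp a t = Abs_su2 (exp_mat a t)"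

text \<open>Derivative along the left-invariant vector field generated by a basis element. The three fields
  form a global frame of the tangent bundle, so a function is \<open>C\<^sup>\<infinity>\<close> iff all its
  iterated derivatives along them exist and are continuous, and the suprema of these derivatives
  define the Frechet topology of \<open>C\<^sup>\<infinity>(SU(2))\<close>.\<close>

definition lderiv :: "su2_axis \<Rightarrow> (su2 \<Rightarrow> complex) \<Rightarrow> su2 \<Rightarrow> complex" where
  "lderiv a f u = vector_derivative (\<lambda>t. f (u * su2_exp a t)) (at 0)"

primrec lderivs :: "su2_axis list \<Rightarrow> (su2 \<Rightarrow> complex) \<Rightarrow> su2 \<Rightarrow> complex" where
  "lderivs [] f = f"
| "lderivs (a # w) f = lderiv a (lderivs w f)"

definition smooth :: "(su2 \<Rightarrow> complex) \<Rightarrow> bool" where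
  "smooth f \<longleftrightarrow> (\<forall>w. continuous_on UNIV (lderivs w f) \<and>
     (\<forall>a u. (\<lambda>t. lderivs w f (u * su2_exp a t)) differentiable at 0))"

definition smooth_seminorm :: "nat \<Rightarrow> (su2 \<Rightarrow> complex) \<Rightarrow> real" where
  "smooth_seminorm m f = (SUP (w, u) \<in> {w. length w \<le> m} \<times> UNIV. cmod (lderivs w f u))"

text \<open>A functional on \<open>C\<^sup>\<infinity>(SU(2))\<close> is a function of all \<open>f\<close>; its values outside the smooth
  functions are irrelevant.\<close>

definition linear_functional :: "((su2 \<Rightarrow> complex) \<Rightarrow> complex) \<Rightarrow> bool" where
  "linear_functional T \<longleftrightarrow> (\<forall>f g a b. smooth f \<longrightarrow> smooth g \<longrightarrow>
     T (\<lambda>u. a * f u + b * g u) = a * T f + b * T g)"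

definition continuous_functional :: "((su2 \<Rightarrow> complex) \<Rightarrow> complex) \<Rightarrow> bool" where
  "continuous_functional T \<longleftrightarrow>
     (\<exists>m C. \<forall>f. smooth f \<longrightarrow> cmod (T f) \<le> C * smooth_seminorm m f)"

definition distribution :: "((su2 \<Rightarrow> complex) \<Rightarrow> complex) \<Rightarrow> bool" where
  "distribution T \<longleftrightarrow> linear_functional T \<and> continuous_functional T"

definition represents ::
  "su2 measure \<Rightarrow> (su2 \<Rightarrow> complex) \<Rightarrow> ((su2 \<Rightarrow> complex) \<Rightarrow> complex) \<Rightarrow> bool" where
  "represents \<mu> g T \<longleftrightarrow> (\<forall>\<phi>. smooth \<phi> \<longrightarrow> T \<phi> = (\<integral>u. g u * \<phi> u \<partial>\<mu>))"

section \<open>Left-invariant operators\<close>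

definition ltrans :: "su2 \<Rightarrow> (su2 \<Rightarrow> complex) \<Rightarrow> su2 \<Rightarrow> complex" where
  "ltrans g f = (\<lambda>x. f (inverse g * x))"

text \<open>By duality, \<open>ltrans g\<close> acts on a distribution \<open>T\<close> by \<open>\<phi> \<mapsto> T (ltrans (inverse g) \<phi>)\<close>.\<close>

definition dist_ltrans ::
  "su2 \<Rightarrow> ((su2 \<Rightarrow> complex) \<Rightarrow> complex) \<Rightarrow> (su2 \<Rightarrow> complex) \<Rightarrow> complex" where
  "dist_ltrans g T = (\<lambda>\<phi>. T (ltrans (inverse g) \<phi>))"

text \<open>\<open>A f \<phi>\<close> is the pairing of the distribution \<open>A f\<close> with the test function \<open>\<phi>\<close>.
  Distributions carry the weak-* topology; since \<open>C\<^sup>\<infinity>(SU(2))\<close> is a Frechet space,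
  the strong topology gives the same continuous operators.\<close>

definition left_invariant_operator ::
  "((su2 \<Rightarrow> complex) \<Rightarrow> (su2 \<Rightarrow> complex) \<Rightarrow> complex) \<Rightarrow> bool" where
  "left_invariant_operator A \<longleftrightarrow>
     (\<forall>f. smooth f \<longrightarrow> distribution (A f)) \<and>
     (\<forall>\<phi>. smooth \<phi> \<longrightarrow> linear_functional (\<lambda>f. A f \<phi>) \<and> continuous_functional (\<lambda>f. A f \<phi>)) \<and>
     (\<forall>g f \<phi>. smooth f \<longrightarrow> smooth \<phi> \<longrightarrow> A (ltrans g f) \<phi> = dist_ltrans g (A f) \<phi>)"

section \<open>Representations, Fourier coefficients and symbols\<close>

text \<open>Everything below that is indexed by a half-integer \<open>l\<close> is indexed here by the natural number
  \<open>k = 2 l\<close>, so that \<open>2 l + 1 = Suc k\<close>. Polynomials are identified with polynomial functions.\<close>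

definition hom_poly :: "nat \<Rightarrow> (complex^2 \<Rightarrow> complex) set" where
  "hom_poly k = {P. \<exists>c::nat \<Rightarrow> complex. P = (\<lambda>z. \<Sum>i\<le>k. c i * vec_nth z 1 ^ i * vec_nth z 2 ^ (k - i))}"

definition su2_rep :: "su2 \<Rightarrow> (complex^2 \<Rightarrow> complex) \<Rightarrow> complex^2 \<Rightarrow> complex" where
  "su2_rep u P = (\<lambda>z. P (z v* Rep_su2 u))"

definition hom_poly_basis :: "nat \<Rightarrow> (nat \<Rightarrow> complex^2 \<Rightarrow> complex) \<Rightarrow> bool" where
  "hom_poly_basis k b \<longleftrightarrow> (\<forall>j<Suc k. b j \<in> hom_poly k) \<and>
     (\<forall>P\<in>hom_poly k. \<exists>!c. c \<in> carrier_vec (Suc k) \<and> P = (\<lambda>z. \<Sum>j<Suc k. vec_index c j * b j z))"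

definition unitary_matrix_rep :: "nat \<Rightarrow> (su2 \<Rightarrow> complex mat) \<Rightarrow> bool" where
  "unitary_matrix_rep k T \<longleftrightarrow> (\<exists>b. hom_poly_basis k b \<and>
     (\<forall>u. T u \<in> carrier_mat (Suc k) (Suc k) \<and>
       (\<forall>j<Suc k. su2_rep u (b j) = (\<lambda>z. \<Sum>i<Suc k. T u $$ (i, j) * b i z)) \<and>
       mat_adjoint (T u) * T u = 1\<^sub>m (Suc k)))"

definition fourier ::
  "su2 measure \<Rightarrow> (nat \<Rightarrow> su2 \<Rightarrow> complex mat) \<Rightarrow> (su2 \<Rightarrow> complex) \<Rightarrow> nat \<Rightarrow> complex mat" where
  "fourier \<mu> t f k =
     Matrix.mat (Suc k) (Suc k) (\<lambda>(i, j). \<integral>u. f u * mat_adjoint (t k u) $$ (i, j) \<partial>\<mu>)"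

definition dist_fourier ::
  "(nat \<Rightarrow> su2 \<Rightarrow> complex mat) \<Rightarrow> ((su2 \<Rightarrow> complex) \<Rightarrow> complex) \<Rightarrow> nat \<Rightarrow> complex mat" where
  "dist_fourier t T k =
     Matrix.mat (Suc k) (Suc k) (\<lambda>(i, j). T (\<lambda>u. mat_adjoint (t k u) $$ (i, j)))"

definition is_symbol ::
  "su2 measure \<Rightarrow> (nat \<Rightarrow> su2 \<Rightarrow> complex mat) \<Rightarrow>
   ((su2 \<Rightarrow> complex) \<Rightarrow> (su2 \<Rightarrow> complex) \<Rightarrow> complex) \<Rightarrow> (nat \<Rightarrow> complex mat) \<Rightarrow> bool" where
  "is_symbol \<mu> t A \<sigma> \<longleftrightarrow>
     (\<forall>k. \<sigma> k \<in> carrier_mat (Suc k) (Suc k) \<and>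
       (\<forall>f. smooth f \<longrightarrow> dist_fourier t (A f) k = \<sigma> k * fourier \<mu> t f k))"

section \<open>Norms\<close>

definition l2_norm :: "complex Matrix.vec \<Rightarrow> real" where
  "l2_norm v = sqrt (\<Sum>i<dim_vec v. (cmod (vec_index v i))\<^sup>2)"

definition mat_op_norm :: "complex mat \<Rightarrow> real" where
  "mat_op_norm M = (SUP v \<in> {v \<in> carrier_vec (dim_col M). l2_norm v \<le> 1}. l2_norm (M *\<^sub>v v))"

definition Lp :: "su2 measure \<Rightarrow> real \<Rightarrow> (su2 \<Rightarrow> complex) set" where
  "Lp \<mu> p = {f \<in> borel_measurable \<mu>. integrable \<mu> (\<lambda>u. cmod (f u) powr p)}"

definition Lp_norm :: "su2 measure \<Rightarrow> real \<Rightarrow> (su2 \<Rightarrow> complex) \<Rightarrow> real" where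
  "Lp_norm \<mu> p f = (\<integral>u. cmod (f u) powr p \<partial>\<mu>) powr (1 / p)"

text \<open>For finite \<open>p\<close> the smooth functions are dense in \<open>L\<^sup>p\<close>, so a bound on them is the same as a
  bounded extension to \<open>L\<^sup>p\<close>. The infimum of the empty set is \<open>\<infinity>\<close>.\<close>

definition Lp_Lq_norm ::
  "su2 measure \<Rightarrow> real \<Rightarrow> real \<Rightarrow> ((su2 \<Rightarrow> complex) \<Rightarrow> (su2 \<Rightarrow> complex) \<Rightarrow> complex) \<Rightarrow> ennreal" where
  "Lp_Lq_norm \<mu> p q A = Inf {ennreal C | C. 0 \<le> C \<and>
     (\<forall>f. smooth f \<longrightarrow>
       (\<exists>g\<in>Lp \<mu> q. represents \<mu> g (A f) \<and> Lp_norm \<mu> q g \<le> C * Lp_norm \<mu> p f))}"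

text \<open>Used for exponents \<open>a \<ge> 0\<close> only. Conventions for \<open>a = 0\<close>: the value is 0 at 0 (inherited from
  \<open>powr\<close>) and 1 at \<open>\<infinity>\<close>, so that the supremum in the theorem is the supremum of the operator norms
  of the symbol when \<open>p = q = 2\<close>; with \<open>0\<^sup>0 = 1\<close> it would be \<open>\<infinity>\<close> there.\<close>

definition epowr :: "ennreal \<Rightarrow> real \<Rightarrow> ennreal" (infixr \<open>epowr\<close> 80) where
  "x epowr a = (if x = \<infinity> then if a = 0 then 1 else \<infinity> else ennreal (enn2real x powr a))"

end

theory Submission
  imports Defs "HOL-Probability.Probability"
begin

text \<open>
  For trigonometric polynomials the pairing of \<open>A f\<close> with \<open>h\<close> is bounded by
  \<open>\<Sum>k. s k * sqrt (energy k f) * sqrt (energy k h)\<close>, where \<open>s k\<close> is the operator norm of the symbol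
  and \<open>energy k f\<close> is \<open>Suc k\<close> times the squared Hilbert-Schmidt norm of the Fourier coefficient. By Schur
  orthogonality the energies satisfy Bessel's inequality and are at most \<open>(Suc k)\<^sup>2\<close> times the squared
  \<open>L\<^sup>1\<close> norm. Real interpolation between these two facts, as in the Marcinkiewicz theorem, gives
  Paley's inequality from \<open>L\<^sup>p\<close> to a weighted \<open>\<ell>\<^sup>2\<close>. Cauchy-Schwarz, with the weight \<open>s\<close> split
  between \<open>f\<close> and \<open>h\<close>, then bounds the pairing by the \<open>L\<^sup>p\<close> norm of \<open>f\<close> and the dual
  \<open>L\<^sup>q\<close> norm of \<open>h\<close>, so the partial Fourier sums of \<open>A f\<close> are bounded in \<open>L\<^sup>q\<close> by duality.

  Being Cauchy in \<open>L\<^sup>2\<close>, they have a limit \<open>g\<close> in \<open>L\<^sup>q\<close> by Fatou's lemma. The distributions \<open>A f\<close>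
  and \<open>g\<close> agree on matrix coefficients, hence everywhere, since convolution with the normalized powers of the
  class function \<open>(2 + tr u) / 4\<close> approximates a smooth function by matrix coefficients in every seminorm
  of \<open>C\<^sup>\<infinity>\<close>.
\<close>

section \<open>Paley inequality\<close>

text \<open>Why the two exponents meet at 2: Paley's inequality requires an exponent at most 2, and
  the hypotheses place both \<open>p\<close> and the dual exponent \<open>q / (q - 1)\<close> there.
  Applied to \<open>f\<close> and to the test function \<open>h\<close>, it leaves two weighted l2
  norms on the dual side. The final constant is the geometric mean of the two Paley constants, and
  the weight (2l+1)^2 of the theorem is the constant in the L1 bound for the energies.

  The obstacle is that \<open>A f\<close> is only a distribution, so a function has to be
  constructed before it can be measured. Finiteness of the supremum helps twice: it is the weak-type
  hypothesis of Paley's inequality, and, because a nonempty level set has mass at least 1, it bounds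
  the operator norms of the symbol, which makes the partial sums Cauchy in L2. On the side of the
  test functions, partial Fourier sums would need decay estimates to converge in every seminorm; a
  nonnegative kernel concentrating at the identity needs none. The matrices \<open>t k\<close> are
  known only up to a choice of basis, so the algebra is done for monomials and transported.\<close>

lemma nn_integral_powr_from_0:
  fixes a B :: real
  assumes "a > 0" "B \<ge> 0"
  shows "(\<integral>\<^sup>+s. ennreal (a * s powr (a - 1)) * indicator {0<..B} s \<partial>lborel) = ennreal (B powr a)"
proof -
  have "((\<lambda>s. a * s powr (a - 1)) has_integral a * (B powr (a - 1 + 1) / (a - 1 + 1))) {0..B}"
    using has_integral_powr_from_0[of "a - 1" B] assms by (intro has_integral_mult_right) auto
  hence "((\<lambda>s. a * s powr (a - 1)) has_integral B powr a) {0..B}"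
    using assms by simp
  hence "(\<integral>\<^sup>+s. ennreal (a * s powr (a - 1)) * indicator {0..B} s \<partial>lborel) = ennreal (B powr a)"
    using assms by (intro nn_integral_has_integral_lebesgue') auto
  also have "(\<integral>\<^sup>+s. ennreal (a * s powr (a - 1)) * indicator {0..B} s \<partial>lborel)
     = (\<integral>\<^sup>+s. ennreal (a * s powr (a - 1)) * indicator {0<..B} s \<partial>lborel)"
    by (intro nn_integral_cong) (auto simp: indicator_def)
  finally show ?thesis .
qed

lemma nn_integral_powr_to_inf:
  fixes e B :: real
  assumes "e > 0" "B > 0"
  shows "(\<integral>\<^sup>+s. ennreal (s powr (- 1 - e)) * indicator {B<..} s \<partial>lborel) = ennreal (B powr (- e) / e)"
proof -
  have "((\<lambda>s. s powr (- 1 - e)) has_integral (B powr (- e) / e)) {B..}"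
    using has_integral_powr_to_inf[of "- 1 - e" B] assms by simp
  hence "(\<integral>\<^sup>+s. ennreal (s powr (- 1 - e)) * indicator {B..} s \<partial>lborel) = ennreal (B powr (- e) / e)"
    using assms by (intro nn_integral_has_integral_lebesgue') auto
  moreover have "(\<integral>\<^sup>+s. ennreal (s powr (- 1 - e)) * indicator {B..} s \<partial>lborel)
     = (\<integral>\<^sup>+s. ennreal (s powr (- 1 - e)) * indicator {B<..} s \<partial>lborel)"
    by (rule nn_integral_cong_AE, use AE_lborel_singleton[of B] in eventually_elim) (auto simp: indicator_def)
  ultimately show ?thesis by simp
qed

lemma nn_integral_powr_from_0_open:
  fixes a B :: real
  assumes "a > 0" "B \<ge> 0"
  shows "(\<integral>\<^sup>+s. ennreal (a * s powr (a - 1)) * indicator {0<..<B} s \<partial>lborel) = ennreal (B powr a)"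
  unfolding nn_integral_powr_from_0[OF assms, symmetric]
  by (rule nn_integral_cong_AE, use AE_lborel_singleton[of B] in eventually_elim) (auto simp: indicator_def)

text \<open>A pointwise bound, not an essential one: the class is stable under cutting at a height,
  sums, products and conjugation, and on a probability space it lies in every Lp, so the estimates
  below carry no integrability hypotheses.\<close>

definition bounded_measurable :: "'a measure \<Rightarrow> ('a \<Rightarrow> complex) \<Rightarrow> bool" where
  "bounded_measurable \<mu> f \<longleftrightarrow> f \<in> borel_measurable \<mu> \<and> (\<exists>B. \<forall>x. cmod (f x) \<le> B)"

lemma bounded_measurableE:
  assumes "bounded_measurable \<mu> f"
  obtains B where "f \<in> borel_measurable \<mu>" "\<And>x. cmod (f x) \<le> B" "B > 0"
proof -
  obtain B where B: "f \<in> borel_measurable \<mu>" "\<And>x. cmod (f x) \<le> B"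
    using assms unfolding bounded_measurable_def by blast
  show ?thesis by (rule that[of "max B 1"]) (use B in \<open>auto simp: le_max_iff_disj\<close>)
qed

lemma bounded_measurable_integrable:
  assumes "prob_space \<mu>" "bounded_measurable \<mu> f"
  shows "integrable \<mu> f"
proof -
  interpret prob_space \<mu> by fact
  show ?thesis using assms(2) by (elim bounded_measurableE) (auto intro!: integrable_const_bound)
qed

lemma bounded_measurable_powr_integrable:
  assumes "prob_space \<mu>" "bounded_measurable \<mu> f" "a \<ge> 0"
  shows "integrable \<mu> (\<lambda>x. cmod (f x) powr a)"
proof -
  interpret prob_space \<mu> by fact
  obtain B where B: "f \<in> borel_measurable \<mu>" "\<And>x. cmod (f x) \<le> B" "B > 0"
    using assms(2) bounded_measurableE by blast
  have [measurable]: "f \<in> borel_measurable \<mu>" by fact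
  show ?thesis
    by (rule integrable_const_bound[of _ "B powr a"]) (use B assms in \<open>auto intro!: powr_mono2\<close>)
qed

lemma bounded_measurable_add:
  assumes "bounded_measurable \<mu> f" "bounded_measurable \<mu> g"
  shows "bounded_measurable \<mu> (\<lambda>x. f x + g x)"
proof -
  obtain B where B: "f \<in> borel_measurable \<mu>" "\<And>x. cmod (f x) \<le> B" using assms(1) bounded_measurableE by blast
  obtain C where C: "g \<in> borel_measurable \<mu>" "\<And>x. cmod (g x) \<le> C" using assms(2) bounded_measurableE by blast
  have "cmod (f x + g x) \<le> B + C" for x using B(2)[of x] C(2)[of x] norm_triangle_ineq[of "f x" "g x"] by linarith
  with B C show ?thesis unfolding bounded_measurable_def by (auto intro!: borel_measurable_add borel_measurable_times)
qed

lemma bounded_measurable_mult: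
  assumes "bounded_measurable \<mu> f" "bounded_measurable \<mu> g"
  shows "bounded_measurable \<mu> (\<lambda>x. f x * g x)"
proof -
  obtain B where B: "f \<in> borel_measurable \<mu>" "\<And>x. cmod (f x) \<le> B" "B > 0" using assms(1) bounded_measurableE by blast
  obtain C where C: "g \<in> borel_measurable \<mu>" "\<And>x. cmod (g x) \<le> C" "C > 0" using assms(2) bounded_measurableE by blast
  have "cmod (f x * g x) \<le> B * C" for x unfolding norm_mult
    by (intro mult_mono) (use B C in \<open>auto intro: less_imp_le\<close>)
  with B C show ?thesis unfolding bounded_measurable_def by (auto intro!: borel_measurable_add borel_measurable_times)
qed

lemma bounded_measurable_const: "bounded_measurable \<mu> (\<lambda>_. c)"
  unfolding bounded_measurable_def by auto

lemma bounded_measurable_cnj: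
  "bounded_measurable \<mu> f \<Longrightarrow> bounded_measurable \<mu> (\<lambda>x. cnj (f x))"
  unfolding bounded_measurable_def using borel_measurable_continuous_onI[of cnj] 
  by (auto intro: measurable_compose continuous_on_cnj continuous_on_id)

lemma bounded_measurable_sum:
  "(\<And>i. i \<in> I \<Longrightarrow> bounded_measurable \<mu> (f i)) \<Longrightarrow> bounded_measurable \<mu> (\<lambda>x. \<Sum>i\<in>I. f i x)"
  by (induction I rule: infinite_finite_induct)
     (auto intro!: bounded_measurable_add bounded_measurable_const)

text \<open>The factors 2 come from \<open>(x + y)^2 \<le> 2 * x^2 + 2 * y^2\<close>. The first
  summand belongs to the small part of \<open>f\<close>. In the second, \<open>2 / p - 1\<close> is
  the layer-cake exponent and \<open>1 - 1 / p\<close> the decay rate in the integral over high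
  levels, so the constant blows up as \<open>p\<close> tends to 1.\<close>

definition paley_const :: "real \<Rightarrow> real" where
  "paley_const p = 2 + 2 * (2 / p - 1) / (1 - 1 / p)"

text \<open>Inverts the decreasing cut height: once the order of integration is exchanged, the cut
  has to be read as a condition on \<open>s\<close> for fixed \<open>y\<close>.\<close>

lemma powr_threshold:
  fixes p c s y :: real
  assumes "p > 0" "c > 0" "s > 0" "y > 0"
  shows "c * s powr (- 1 / p) < y \<longleftrightarrow> (c / y) powr p < s"
proof -
  have *: "(c * s powr (- 1 / p)) powr p = c powr p / s"
    using assms by (simp add: powr_mult powr_powr powr_minus powr_divide divide_inverse inverse_powr)
  have "c * s powr (- 1 / p) < y \<longleftrightarrow> (c * s powr (- 1 / p)) powr p < y powr p"
    using powr_less_mono2[of p "c * s powr (- 1 / p)" y] powr_mono2[of p y "c * s powr (- 1 / p)"] assms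
    by (smt (verit) mult_nonneg_nonneg powr_ge_zero)
  also have "\<dots> \<longleftrightarrow> (c / y) powr p < s"
    unfolding * using assms by (simp add: powr_divide field_simps)
  finally show ?thesis .
qed


text \<open>Layer cake in \<open>\<phi>\<close>: on the level set \<open>s < \<phi>\<close> the function \<open>f\<close> is cut at the height
  \<open>c * s powr (- 1 / p)\<close>. The large part is estimated by \<open>triv\<close> and the small part by \<open>bessel\<close>; the choice
  of \<open>c\<close> balances the two contributions.\<close>

lemma paley_inequality:
  fixes a :: "'k \<Rightarrow> ('a \<Rightarrow> complex) \<Rightarrow> real" and m \<phi> :: "'k \<Rightarrow> real"
  assumes P: "prob_space \<mu>" and p: "1 < p" "p < 2" and I: "finite I"
    and \<phi>: "\<And>k. k \<in> I \<Longrightarrow> 0 \<le> \<phi> k" and m: "\<And>k. k \<in> I \<Longrightarrow> 0 < m k"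
    and M: "\<And>s. s > 0 \<Longrightarrow> (\<Sum>k\<in>{k\<in>I. s < \<phi> k}. m k) \<le> M / s"
    and nonneg: "\<And>k g. k \<in> I \<Longrightarrow> 0 \<le> a k g"
    and add: "\<And>k g h. k \<in> I \<Longrightarrow> bounded_measurable \<mu> g \<Longrightarrow> bounded_measurable \<mu> h \<Longrightarrow>
        a k (\<lambda>x. g x + h x) \<le> 2 * a k g + 2 * a k h"
    and bessel: "\<And>g J. bounded_measurable \<mu> g \<Longrightarrow> J \<subseteq> I \<Longrightarrow>
        (\<Sum>k\<in>J. a k g) \<le> (\<integral>x. (cmod (g x))\<^sup>2 \<partial>\<mu>)"
    and triv: "\<And>k g. k \<in> I \<Longrightarrow> bounded_measurable \<mu> g \<Longrightarrow>
        a k g \<le> m k * (\<integral>x. cmod (g x) \<partial>\<mu>)\<^sup>2"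
    and f: "bounded_measurable \<mu> f"
  shows "(\<Sum>k\<in>I. \<phi> k powr (2 / p - 1) * a k f)
    \<le> paley_const p * M powr (2 / p - 1) * (\<integral>x. cmod (f x) powr p \<partial>\<mu>) powr (2 / p)"
proof -
  interpret prob_space \<mu> by fact
  define \<alpha> where "\<alpha> = 2 / p - 1"
  define N where "N = (\<integral>x. cmod (f x) powr p \<partial>\<mu>)"
  have \<alpha>: "\<alpha> > 0" using p by (simp add: \<alpha>_def)
  obtain B0 where B0: "f \<in> borel_measurable \<mu>" "\<And>x. cmod (f x) \<le> B0" "B0 > 0"
    using f bounded_measurableE by blast
  note [measurable] = B0(1)
  have fp: "integrable \<mu> (\<lambda>x. cmod (f x) powr p)"
    using P f p by (intro bounded_measurable_powr_integrable) auto
  have "N \<ge> 0" unfolding N_def by (intro integral_nonneg_AE) auto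
  have "M \<ge> 0" using M[of 1] sum_nonneg[of "{k \<in> I. 1 < \<phi> k}" m] m by (force intro: less_imp_le)
  have pc: "paley_const p \<ge> 0" using p by (auto simp: paley_const_def field_simps intro!: add_nonneg_nonneg divide_nonneg_nonneg)
  have rhs0: "0 \<le> paley_const p * M powr \<alpha> * N powr (2 / p)" using pc by auto
  \<comment> \<open>The cut height needs \<open>c > 0\<close>, so the degenerate cases are split
    off; in both of them the left-hand side vanishes.\<close>
  consider "M = 0" | "N = 0" | "M > 0" "N > 0" using \<open>N \<ge> 0\<close> \<open>M \<ge> 0\<close> by linarith
  hence "(\<Sum>k\<in>I. \<phi> k powr \<alpha> * a k f) \<le> paley_const p * M powr \<alpha> * N powr (2 / p)"
  proof cases
    case 1
    have "\<phi> k = 0" if k: "k \<in> I" for k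
    proof (rule ccontr)
      assume "\<phi> k \<noteq> 0"
      with \<phi>[OF k] have pos: "\<phi> k > 0" by simp
      have "m k \<le> (\<Sum>k\<in>{j\<in>I. \<phi> k / 2 < \<phi> j}. m k)"
        using I k m pos by (intro member_le_sum) (auto intro: less_imp_le)
      also have "\<dots> \<le> 0" using M[of "\<phi> k / 2"] pos 1 by simp
      finally show False using m[OF k] by simp
    qed
    hence "(\<Sum>k\<in>I. \<phi> k powr \<alpha> * a k f) = 0" by (intro sum.neutral) auto
    with rhs0 show ?thesis by simp
  next
    case 2
    have "AE x in \<mu>. cmod (f x) powr p = 0"
      using 2 fp unfolding N_def by (subst (asm) integral_nonneg_eq_0_iff_AE) auto
    hence "AE x in \<mu>. cmod (f x) = 0" by eventually_elim auto
    hence "(\<integral>x. cmod (f x) \<partial>\<mu>) = 0" using integral_cong_AE[of "\<lambda>x. cmod (f x)" \<mu> "\<lambda>_. 0"] by simp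
    hence "a k f = 0" if "k \<in> I" for k using triv[OF that f] nonneg[OF that, of f] by simp
    hence "(\<Sum>k\<in>I. \<phi> k powr \<alpha> * a k f) = 0" by (intro sum.neutral) auto
    with rhs0 show ?thesis by simp
  next
    case 3
    \<comment> \<open>After integration in \<open>s\<close> the large part carries
      \<open>M * N * c powr (2 - 2 * p)\<close> and the small part \<open>c powr (2 - p)\<close>;
      these agree exactly when \<open>c powr p = M * N\<close>.\<close>
    define c where "c = (M * N) powr (1 / p)"
    have c: "c > 0" using 3 by (simp add: c_def)
    define l where "l = (\<lambda>s. c * s powr (- 1 / p))"
    \<comment> \<open>The bound for the level set \<open>s < \<phi> k\<close>, arranged as a single
      integral over \<open>x\<close> so that Fubini applies.\<close>
    define R where "R = (\<lambda>s x. 2 * (M * N * c powr (1 - p) * s powr (- 1 / p)) * (if l s < cmod (f x) then cmod (f x) else 0)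
       + 2 * (if l s < cmod (f x) then 0 else (cmod (f x))\<^sup>2))"
    have R0: "R s x \<ge> 0" for s x using 3 by (auto simp: R_def)
    have Rint: "integrable \<mu> (R s)" for s
    proof -
      have "integrable \<mu> (\<lambda>x. if l s < cmod (f x) then cmod (f x) else 0)"
        by (rule integrable_const_bound[of _ B0]) (use B0 in \<open>auto intro: less_imp_le\<close>)
      moreover have "integrable \<mu> (\<lambda>x. if l s < cmod (f x) then 0 else (cmod (f x))\<^sup>2)"
        by (rule integrable_const_bound[of _ "B0\<^sup>2"]) (use B0 in \<open>auto intro!: power_mono\<close>)
      ultimately show ?thesis unfolding R_def by auto
    qed
    have lpos: "l s > 0" if "s > 0" for s using that c by (simp add: l_def)
    have step1: "(\<Sum>k\<in>{k\<in>I. s < \<phi> k}. a k f) \<le> (\<integral>x. R s x \<partial>\<mu>)" if s: "s > 0" for s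
    proof -
      define fh where "fh = (\<lambda>x. if l s < cmod (f x) then f x else 0)"
      define fl where "fl = (\<lambda>x. if l s < cmod (f x) then 0 else f x)"
      have bh: "bounded_measurable \<mu> fh" unfolding bounded_measurable_def fh_def
        by (auto intro!: exI[of _ B0] B0 simp: less_imp_le[OF B0(3)])
      have bl: "bounded_measurable \<mu> fl" unfolding bounded_measurable_def fl_def
        by (auto intro!: exI[of _ B0] B0 simp: less_imp_le[OF B0(3)])
      let ?J = "{k\<in>I. s < \<phi> k}" and ?H = "\<integral>x. cmod (fh x) \<partial>\<mu>" and ?L = "\<integral>x. (cmod (fl x))\<^sup>2 \<partial>\<mu>"
      have H0: "?H \<ge> 0" by simp
      have fhint: "integrable \<mu> (\<lambda>x. cmod (fh x))"
        using bounded_measurable_integrable[OF P bh] by simp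
      have "f = (\<lambda>x. fh x + fl x)" by (auto simp: fh_def fl_def)
      hence "(\<Sum>k\<in>?J. a k f) \<le> (\<Sum>k\<in>?J. 2 * a k fh + 2 * a k fl)"
        using add[OF _ bh bl] by (intro sum_mono) auto
      also have "\<dots> = 2 * (\<Sum>k\<in>?J. a k fh) + 2 * (\<Sum>k\<in>?J. a k fl)"
        by (simp add: sum.distrib sum_distrib_left)
      also have "\<dots> \<le> 2 * (\<Sum>k\<in>?J. m k * ?H\<^sup>2) + 2 * ?L"
        using triv[OF _ bh] by (intro add_mono mult_left_mono sum_mono bessel bl) auto
      also have "(\<Sum>k\<in>?J. m k * ?H\<^sup>2) = (\<Sum>k\<in>?J. m k) * ?H\<^sup>2" by (simp add: sum_distrib_right)
      also have "\<dots> \<le> M / s * ?H\<^sup>2" by (intro mult_right_mono M s) auto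
      \<comment> \<open>Only one of the two factors \<open>?H\<close> is estimated, by Chebyshev's
        argument \<open>cmod (f x) \<le> l s powr (1 - p) * cmod (f x) powr p\<close> above the cut.
        The other stays an integral, which keeps the bound linear in an integral over
        \<open>x\<close>.\<close>
      also have "M / s * ?H\<^sup>2 \<le> M / s * ((l s powr (1 - p) * N) * ?H)"
      proof -
        have "?H \<le> (\<integral>x. l s powr (1 - p) * cmod (f x) powr p \<partial>\<mu>)"
      proof (intro integral_mono fhint integrable_mult_right fp)
        fix x
        show "cmod (fh x) \<le> l s powr (1 - p) * cmod (f x) powr p"
        proof (cases "l s < cmod (f x)")
          case True
          hence "cmod (f x) = cmod (f x) powr (1 - p) * cmod (f x) powr p"
            using lpos[OF s] by (simp add: powr_add[symmetric])
          also have "\<dots> \<le> l s powr (1 - p) * cmod (f x) powr p"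
            using True lpos[OF s] p by (intro mult_right_mono powr_mono2') auto
          finally show ?thesis using True by (simp add: fh_def)
        qed (auto simp: fh_def)
      qed
      hence "?H \<le> l s powr (1 - p) * N" by (simp add: N_def)
      from mult_right_mono[OF this H0] show ?thesis
        unfolding power2_eq_square using 3 s by (intro mult_left_mono) auto
      qed
      also have "\<dots> = M * N * (l s powr (1 - p) / s) * ?H" by simp
      also have "l s powr (1 - p) / s = c powr (1 - p) * s powr (- 1 / p)"
      proof -
        have "l s powr (1 - p) = c powr (1 - p) * s powr ((- 1 / p) * (1 - p))"
          using c s unfolding l_def by (simp add: powr_mult powr_powr)
        also have "(- 1 / p) * (1 - p) = - 1 / p + 1" using p by (simp add: field_simps)
        also have "s powr (- 1 / p + 1) = s powr (- 1 / p) * s" using s powr_add[of s "- 1 / p" 1] by simp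
        finally show ?thesis using s by simp
      qed
      finally have "(\<Sum>k\<in>?J. a k f) \<le> 2 * (M * N * (c powr (1 - p) * s powr (- 1 / p)) * ?H) + 2 * ?L" by simp
      also have "\<dots> = (\<integral>x. 2 * (M * N * c powr (1 - p) * s powr (- 1 / p)) * cmod (fh x) + 2 * (cmod (fl x))\<^sup>2 \<partial>\<mu>)"
      proof -
        have "integrable \<mu> (\<lambda>x. (cmod (fl x))\<^sup>2)"
          using bounded_measurable_powr_integrable[OF P bl, of 2] by (simp add: powr_numeral)
        thus ?thesis using fhint by (simp add: mult_ac)
      qed
      also have "\<dots> = (\<integral>x. R s x \<partial>\<mu>)"
        by (intro Bochner_Integration.integral_cong) (auto simp: R_def fh_def fl_def)
      finally show ?thesis .
    qed
    define K where "K = paley_const p * (M * N) powr \<alpha>"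
    have inner: "(\<integral>\<^sup>+s. ennreal (indicator {0<..} s * (\<alpha> * s powr (\<alpha> - 1)) * R s x) \<partial>lborel)
        \<le> ennreal (K * cmod (f x) powr p)" for x
    proof (cases "cmod (f x) = 0")
      case True
      hence "R s x = 0" for s by (auto simp: R_def)
      thus ?thesis by simp
    next
      case False
      define y where "y = cmod (f x)"
      have y: "y > 0" using False by (simp add: y_def)
      \<comment> \<open>The level at which the cut height equals \<open>cmod (f x)\<close>: for
        \<open>s > B\<close> the point \<open>x\<close> belongs to the large part, for
        \<open>s \<le> B\<close> to the small one.\<close>
      define B where "B = (c / y) powr p"
      have B: "B > 0" using c y by (simp add: B_def)
      have thr: "l s < y \<longleftrightarrow> B < s" if "s > 0" for s
        unfolding l_def B_def using powr_threshold[of p c s y] p c y that by simp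
      define e where "e = 1 - 1 / p"
      have e: "e > 0" using p by (simp add: e_def)
      define A where "A = 2 * (M * N * c powr (1 - p)) * y * \<alpha>"
      have A: "A \<ge> 0" using 3 y \<alpha> by (simp add: A_def)
      have eq: "ennreal (indicator {0<..} s * (\<alpha> * s powr (\<alpha> - 1)) * R s x) =
         ennreal A * (ennreal (s powr (- 1 - e)) * indicator {B<..} s) +
         ennreal (2 * y\<^sup>2) * (ennreal (\<alpha> * s powr (\<alpha> - 1)) * indicator {0<..B} s)" for s
      proof (cases "s > 0")
        case True
        have "s powr (\<alpha> - 1) * s powr (- 1 / p) = s powr (- 1 - e)"
          using p by (simp add: powr_add[symmetric] \<alpha>_def e_def)
        hence *: "\<alpha> * s powr (\<alpha> - 1) * (2 * (M * N * c powr (1 - p) * s powr (- 1 / p)) * y) = A * s powr (- 1 - e)"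
          by (simp add: A_def mult_ac)
        show ?thesis
        proof (cases "B < s")
          case t: True
          hence "R s x = 2 * (M * N * c powr (1 - p) * s powr (- 1 / p)) * y"
            using thr[OF True] by (simp add: R_def y_def)
          with * t True A show ?thesis by (simp add: ennreal_mult)
        next
          case t: False
          hence "R s x = 2 * y\<^sup>2" using thr[OF True] by (simp add: R_def y_def)
          with t True \<alpha> show ?thesis by (simp add: ennreal_mult[symmetric] mult_ac)
        qed
      qed (use B in auto)
      have "(\<integral>\<^sup>+s. ennreal (indicator {0<..} s * (\<alpha> * s powr (\<alpha> - 1)) * R s x) \<partial>lborel)
         = ennreal A * ennreal (B powr (- e) / e) + ennreal (2 * y\<^sup>2) * ennreal (B powr \<alpha>)"
        unfolding eq using e B \<alpha>
        by (simp add: nn_integral_add nn_integral_cmult nn_integral_powr_to_inf nn_integral_powr_from_0)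
      also have "\<dots> = ennreal (A * (B powr (- e) / e) + 2 * y\<^sup>2 * B powr \<alpha>)"
        using A e by (simp add: ennreal_mult[symmetric] ennreal_plus[symmetric] del: ennreal_plus)
      also have "A * (B powr (- e) / e) = (2 * \<alpha> / e) * (M * N) powr \<alpha> * y powr p"
      proof -
        have "B powr (- e) = (c / y) powr (1 - p)"
          using p unfolding B_def powr_powr e_def by (simp add: algebra_simps)
        also have "\<dots> = c powr (1 - p) * y powr (p - 1)"
          using c y powr_minus_divide[of y "p - 1"] by (simp add: powr_divide)
        finally have "A * (B powr (- e) / e) = (2 * \<alpha> / e) * (M * N * (c powr (1 - p) * c powr (1 - p))) * (y * y powr (p - 1))"
          by (simp add: A_def)
        also have "y * y powr (p - 1) = y powr p" using y by (simp add: powr_mult_base)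
        also have "M * N * (c powr (1 - p) * c powr (1 - p)) = (M * N) powr 1 * (M * N) powr (1 / p * ((1 - p) + (1 - p)))"
        proof -
          have "c powr (1 - p) * c powr (1 - p) = (M * N) powr (1 / p * ((1 - p) + (1 - p)))"
            unfolding c_def powr_powr powr_add[symmetric] by (simp add: algebra_simps add_divide_distrib diff_divide_distrib)
          thus ?thesis using 3 by simp
        qed
        also have "\<dots> = (M * N) powr \<alpha>"
          unfolding powr_add[symmetric] using p by (simp add: \<alpha>_def field_simps)
        finally show ?thesis .
      qed
      also have "2 * y\<^sup>2 * B powr \<alpha> = 2 * (M * N) powr \<alpha> * y powr p"
      proof -
        have pa: "p * \<alpha> = 2 - p" using p by (simp add: \<alpha>_def field_simps)
        have "B powr \<alpha> = c powr (2 - p) * y powr (p - 2)"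
          using c y powr_minus_divide[of y "p - 2"] unfolding B_def powr_powr pa by (simp add: powr_divide)
        also have "c powr (2 - p) = (M * N) powr \<alpha>"
          unfolding c_def powr_powr \<alpha>_def using p by (simp add: field_simps)
        finally have "2 * y\<^sup>2 * B powr \<alpha> = 2 * (M * N) powr \<alpha> * (y powr 2 * y powr (p - 2))"
          using y by (simp add: powr_numeral)
        also have "y powr 2 * y powr (p - 2) = y powr p" by (simp add: powr_add[symmetric])
        finally show ?thesis .
      qed
      also have "2 * \<alpha> / e * (M * N) powr \<alpha> * y powr p + 2 * (M * N) powr \<alpha> * y powr p = K * y powr p"
        by (simp add: K_def paley_const_def \<alpha>_def e_def algebra_simps)
      finally show ?thesis by (simp add: y_def)
    qed
    interpret PS: pair_sigma_finite lborel \<mu> ..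
    have "ennreal (\<Sum>k\<in>I. \<phi> k powr \<alpha> * a k f) = (\<Sum>k\<in>I. ennreal (a k f) * ennreal (\<phi> k powr \<alpha>))"
      using nonneg by (simp add: ennreal_mult[symmetric] sum_ennreal mult.commute)
    also have "\<dots> = (\<Sum>k\<in>I. \<integral>\<^sup>+s. ennreal (a k f) * (ennreal (\<alpha> * s powr (\<alpha> - 1)) * indicator {0<..<\<phi> k} s) \<partial>lborel)"
      using \<phi> \<alpha> by (intro sum.cong refl) (simp add: nn_integral_cmult nn_integral_powr_from_0_open)
    also have "\<dots> = (\<integral>\<^sup>+s. (\<Sum>k\<in>I. ennreal (a k f) * (ennreal (\<alpha> * s powr (\<alpha> - 1)) * indicator {0<..<\<phi> k} s)) \<partial>lborel)"
      by (subst nn_integral_sum) auto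
    also have "\<dots> \<le> (\<integral>\<^sup>+s. (\<integral>\<^sup>+x. ennreal (indicator {0<..} s * (\<alpha> * s powr (\<alpha> - 1)) * R s x) \<partial>\<mu>) \<partial>lborel)"
    proof (intro nn_integral_mono)
      fix s :: real
      show "(\<Sum>k\<in>I. ennreal (a k f) * (ennreal (\<alpha> * s powr (\<alpha> - 1)) * indicator {0<..<\<phi> k} s))
        \<le> (\<integral>\<^sup>+x. ennreal (indicator {0<..} s * (\<alpha> * s powr (\<alpha> - 1)) * R s x) \<partial>\<mu>)"
      proof (cases "s > 0")
        case True
        have "(\<Sum>k\<in>I. ennreal (a k f) * (ennreal (\<alpha> * s powr (\<alpha> - 1)) * indicator {0<..<\<phi> k} s))
          = (\<Sum>k\<in>I. if s < \<phi> k then ennreal (\<alpha> * s powr (\<alpha> - 1) * a k f) else 0)"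
          using True \<alpha> nonneg by (intro sum.cong) (auto simp: ennreal_mult[symmetric] mult.commute)
        also have "\<dots> = (\<Sum>k\<in>{k\<in>I. s < \<phi> k}. ennreal (\<alpha> * s powr (\<alpha> - 1) * a k f))"
          using I by (simp add: sum.inter_filter)
        also have "\<dots> = ennreal (\<alpha> * s powr (\<alpha> - 1) * (\<Sum>k\<in>{k\<in>I. s < \<phi> k}. a k f))"
          using nonneg \<alpha> by (subst sum_ennreal) (auto simp: sum_distrib_left)
        also have "\<dots> \<le> ennreal (\<alpha> * s powr (\<alpha> - 1) * (\<integral>x. R s x \<partial>\<mu>))"
          using \<alpha> by (intro ennreal_leI mult_left_mono step1 True) auto
        also have "\<dots> = ennreal (\<integral>x. \<alpha> * s powr (\<alpha> - 1) * R s x \<partial>\<mu>)"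
          by simp
        also have "\<dots> = (\<integral>\<^sup>+x. ennreal (indicator {0<..} s * (\<alpha> * s powr (\<alpha> - 1)) * R s x) \<partial>\<mu>)"
          using True \<alpha> R0 by (subst nn_integral_eq_integral) (auto intro!: Rint)
        finally show ?thesis .
      qed auto
    qed
    also have "\<dots> = (\<integral>\<^sup>+x. (\<integral>\<^sup>+s. ennreal (indicator {0<..} s * (\<alpha> * s powr (\<alpha> - 1)) * R s x) \<partial>lborel) \<partial>\<mu>)"
      unfolding R_def l_def by (intro PS.Fubini'[symmetric]) measurable
    also have "\<dots> \<le> (\<integral>\<^sup>+x. ennreal (K * cmod (f x) powr p) \<partial>\<mu>)"
      by (intro nn_integral_mono inner)
    also have "\<dots> = ennreal (\<integral>x. K * cmod (f x) powr p \<partial>\<mu>)"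
      using fp pc by (intro nn_integral_eq_integral) (auto simp: K_def)
    also have "\<dots> = ennreal (K * N)" by (simp add: N_def)
    also have "K * N = paley_const p * M powr \<alpha> * N powr (2 / p)"
    proof -
      have "(M * N) powr \<alpha> * N = M powr \<alpha> * (N powr \<alpha> * N powr 1)" using 3 by (simp add: powr_mult)
      also have "N powr \<alpha> * N powr 1 = N powr (2 / p)" unfolding powr_add[symmetric] by (simp add: \<alpha>_def)
      finally show ?thesis by (simp add: K_def)
    qed
    finally show ?thesis using rhs0 by (simp add: ennreal_le_iff)
  qed
  thus ?thesis by (simp add: \<alpha>_def N_def)
qed

section \<open>Topology and Haar measure of SU(2)\<close>

lemma mat_mult_nth: "vec_nth (vec_nth (A ** B) i) j = (\<Sum>k\<in>UNIV. vec_nth (vec_nth A i) k * vec_nth (vec_nth B k) j)"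
  by (simp add: matrix_matrix_mult_def)

lemma Rep_su2_mult: "Rep_su2 (u * v) = Rep_su2 u ** Rep_su2 v"
  by (simp add: times_su2_def Abs_su2_inverse SU2_mult Rep_su2)

lemma Rep_su2_one: "Rep_su2 1 = Finite_Cartesian_Product.mat 1"
  by (simp add: one_su2_def Abs_su2_inverse SU2_one)

lemma Rep_su2_inverse_group: "Rep_su2 (inverse u) = cadjoint (Rep_su2 u)"
  by (simp add: inverse_su2_def Abs_su2_inverse SU2_cadjoint Rep_su2)

lemma su2_inverse_mult_cancel: "inverse u * ((u::su2) * v) = v" "u * (inverse u * v) = v"
  by (simp_all add: mult.assoc[symmetric] su2_left_inverse su2_right_inverse)

lemma su2_inverse_inverse: "inverse (inverse (u::su2)) = u"
  using su2_inverse_mult_cancel(1)[of "inverse u" u] by (simp add: su2_left_inverse)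

lemma su2_inverse_mult: "inverse ((u::su2) * v) = inverse v * inverse u"
  using su2_inverse_mult_cancel(1)[of "u * v" "inverse v * inverse u"]
  by (simp add: mult.assoc su2_inverse_mult_cancel su2_right_inverse)

abbreviation su2_entry :: "su2 \<Rightarrow> 2 \<Rightarrow> 2 \<Rightarrow> complex" where
  "su2_entry u i j \<equiv> vec_nth (vec_nth (Rep_su2 u) i) j"

text \<open>The adjoint inverts \<open>U\<close> by unitarity, and the adjugate does so because the
  determinant is 1. The comparison is carried out by inserting
  \<open>a * cnj a + b * cnj b = 1\<close>.\<close>

lemma SU2_entries:
  assumes "U \<in> SU2"
  shows "vec_nth (vec_nth U 2) 2 = cnj (vec_nth (vec_nth U 1) 1)"
    and "vec_nth (vec_nth U 2) 1 = - cnj (vec_nth (vec_nth U 1) 2)"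
    and "(cmod (vec_nth (vec_nth U 1) 1))\<^sup>2 + (cmod (vec_nth (vec_nth U 1) 2))\<^sup>2 = 1"
proof -
  define a b c d where abcd: "a = vec_nth (vec_nth U 1) 1" "b = vec_nth (vec_nth U 1) 2"
    "c = vec_nth (vec_nth U 2) 1" "d = vec_nth (vec_nth U 2) 2"
  have "U ** cadjoint U = Finite_Cartesian_Product.mat 1" "Determinants.det U = 1"
    using assms by (auto simp: SU2_def)
  hence U: "vec_nth (vec_nth (U ** cadjoint U) i) j = vec_nth (vec_nth (Finite_Cartesian_Product.mat 1) i) j"
    and 3: "a * d - b * c = 1" for i j
    by (simp_all add: Determinants.det_2 abcd)
  have 1: "a * cnj a + b * cnj b = 1" and 2: "a * cnj c + b * cnj d = 0"
    using U[of 1 1] U[of 1 2]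
    unfolding mat_mult_nth by (simp_all add: sum_2 cadjoint_def Finite_Cartesian_Product.mat_def abcd)
  from arg_cong[OF 2, of cnj] have z2: "cnj a * c + cnj b * d = 0" by simp
  have "d = d * (a * cnj a + b * cnj b)" using 1 by simp
  also have "\<dots> = cnj a * (a * d - b * c) + b * (cnj a * c + cnj b * d)" by (simp add: algebra_simps)
  finally show "vec_nth (vec_nth U 2) 2 = cnj (vec_nth (vec_nth U 1) 1)" using z2 3 by (simp add: abcd)
  have "c = c * (a * cnj a + b * cnj b)" using 1 by simp
  also have "\<dots> = a * (cnj a * c + cnj b * d) - cnj b * (a * d - b * c)" by (simp add: algebra_simps)
  finally show "vec_nth (vec_nth U 2) 1 = - cnj (vec_nth (vec_nth U 1) 2)" using z2 3 by (simp add: abcd)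
  have "complex_of_real ((cmod a)\<^sup>2 + (cmod b)\<^sup>2) = 1"
    using 1 by (simp only: of_real_add complex_norm_square)
  thus "(cmod (vec_nth (vec_nth U 1) 1))\<^sup>2 + (cmod (vec_nth (vec_nth U 1) 2))\<^sup>2 = 1"
    unfolding abcd of_real_eq_1_iff .
qed

lemmas su2_entries = SU2_entries[OF Rep_su2]

lemma norm_matrix2: "(norm (U::complex^2^2))\<^sup>2 = (cmod (vec_nth (vec_nth U 1) 1))\<^sup>2 + (cmod (vec_nth (vec_nth U 1) 2))\<^sup>2
   + (cmod (vec_nth (vec_nth U 2) 1))\<^sup>2 + (cmod (vec_nth (vec_nth U 2) 2))\<^sup>2"
  by (simp add: norm_vec_def L2_set_def sum_2)

lemma continuous_on_su2_iff: "continuous_on S f \<longleftrightarrow> continuous_on S (\<lambda>x. Rep_su2 (f x))"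
  by (simp add: continuous_on_def tendsto_iff dist_su2_def)

lemma continuous_on_Rep_su2 [continuous_intros]:
  "continuous_on S f \<Longrightarrow> continuous_on S (\<lambda>x. Rep_su2 (f x))"
  by (simp add: continuous_on_su2_iff)

lemma continuous_on_su2_entry [continuous_intros]:
  "continuous_on S f \<Longrightarrow> continuous_on S (\<lambda>x. su2_entry (f x) i j)"
  by (intro continuous_intros)

lemma continuous_on_su2_mult [continuous_intros]:
  fixes f g :: "'a::topological_space \<Rightarrow> su2"
  assumes "continuous_on S f" "continuous_on S g"
  shows "continuous_on S (\<lambda>x. f x * g x)"
  unfolding continuous_on_su2_iff Rep_su2_mult matrix_matrix_mult_def
  by (intro continuous_intros assms)

lemma continuous_on_su2_inverse [continuous_intros]:
  fixes f :: "'a::topological_space \<Rightarrow> su2"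
  assumes "continuous_on S f"
  shows "continuous_on S (\<lambda>x. inverse (f x))"
  unfolding continuous_on_su2_iff Rep_su2_inverse_group cadjoint_def
  by (intro continuous_intros assms)

lemma compact_SU2: "compact SU2"
proof -
  have "continuous_on UNIV (\<lambda>U::complex^2^2. U ** cadjoint U)"
    unfolding matrix_matrix_mult_def cadjoint_def by (intro continuous_intros)
  hence 1: "closed ((\<lambda>U. U ** cadjoint U) -` {Finite_Cartesian_Product.mat 1 :: complex^2^2})"
    by (intro closed_vimage) auto
  have "continuous_on UNIV (\<lambda>U::complex^2^2. Determinants.det U)"
    unfolding Determinants.det_2 by (intro continuous_intros)
  hence 2: "closed ((\<lambda>U::complex^2^2. Determinants.det U) -` {1})"
    by (intro closed_vimage) auto
  have "closed SU2"
    using closed_Int[OF 1 2] by (auto simp: SU2_def vimage_def Int_def conj_commute)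
  moreover have "bounded SU2"
  proof (rule boundedI[of _ 2])
    fix U assume U: "U \<in> SU2"
    have "(norm U)\<^sup>2 = 2" unfolding norm_matrix2 using SU2_entries[OF U] by simp
    hence "(norm U)\<^sup>2 \<le> 2\<^sup>2" by simp
    thus "norm U \<le> 2" by (rule power2_le_imp_le) simp
  qed
  ultimately show ?thesis by (simp add: compact_eq_bounded_closed)
qed

lemma compact_su2: "compact (UNIV :: su2 set)"
proof -
  have "continuous_on SU2 Abs_su2"
    unfolding continuous_on_su2_iff
    by (rule continuous_on_eq[OF continuous_on_id]) (simp add: Abs_su2_inverse)
  hence "compact (Abs_su2 ` SU2)" using compact_SU2 by (rule compact_continuous_image)
  moreover have "Abs_su2 ` SU2 = UNIV" using Abs_su2_cases by blast
  ultimately show ?thesis by simp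
qed

text \<open>Makes the Borel sets of a product the product sigma-algebra (\<open>borel_prod\<close>),
  which Fubini on the group requires.\<close>

instance su2 :: second_countable_topology
proof
  obtain B :: "(complex^2^2) set set" where B: "countable B" "topological_basis B"
    using ex_countable_basis by blast
  have op: "open (Rep_su2 -` b)" if "open b" for b
    by (rule open_vimage[OF that]) (intro continuous_intros)
  have "topological_basis ((\<lambda>b. Rep_su2 -` b) ` B)"
  proof (rule topological_basisI)
    fix S :: "su2 set" and u assume "open S" "u \<in> S"
    then obtain e where e: "e > 0" "\<And>v. dist v u < e \<Longrightarrow> v \<in> S" unfolding open_dist by blast
    obtain b where "b \<in> B" "Rep_su2 u \<in> b" "b \<subseteq> ball (Rep_su2 u) e"
      using topological_basisE[OF B(2) open_ball[of "Rep_su2 u" e]] e(1) by (metis centre_in_ball)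
    thus "\<exists>B'\<in>(\<lambda>b. Rep_su2 -` b) ` B. u \<in> B' \<and> B' \<subseteq> S"
      using e(2) by (intro bexI[of _ "Rep_su2 -` b"]) (auto simp: dist_su2_def dist_commute)
  qed (use B op topological_basis_open in auto)
  thus "\<exists>B::su2 set set. countable B \<and> open = generate_topology B"
    using B(1) topological_basis_imp_subbasis by blast
qed

section \<open>Basic properties of the normalized Haar measure\<close>

context
  fixes \<mu> :: "su2 measure"
  assumes haar: "normalized_haar \<mu>"
begin

lemma haar_sets [measurable_cong, simp]: "sets \<mu> = sets borel"
  using haar by (simp add: normalized_haar_def)

lemma haar_space [simp]: "space \<mu> = UNIV"
  using sets_eq_imp_space_eq[OF haar_sets] by simp

lemma haar_prob: "prob_space \<mu>"
  using haar by (intro prob_spaceI) (simp add: normalized_haar_def)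

lemma haar_measurable: "borel_measurable \<mu> = borel_measurable borel"
  by (rule measurable_cong_sets) auto

lemma continuous_bounded_measurable:
  assumes "continuous_on UNIV f" shows "f \<in> borel_measurable \<mu>" "\<exists>B. \<forall>x. cmod (f x) \<le> B"
proof -
  show "f \<in> borel_measurable \<mu>"
    unfolding haar_measurable using assms by (rule borel_measurable_continuous_onI)
  have "bounded (range f)"
    using compact_continuous_image[OF assms compact_su2] compact_imp_bounded by blast
  thus "\<exists>B. \<forall>x. cmod (f x) \<le> B" by (auto simp: bounded_iff)
qed

lemma haar_left:
  fixes f :: "su2 \<Rightarrow> 'b::{banach, second_countable_topology}"
  assumes "f \<in> borel_measurable borel"
  shows "(\<integral>u. f (g * u) \<partial>\<mu>) = (\<integral>u. f u \<partial>\<mu>)"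
proof -
  have m: "(\<lambda>u. g * u) \<in> \<mu> \<rightarrow>\<^sub>M borel"
    unfolding haar_measurable by (intro borel_measurable_continuous_onI continuous_intros)
  have "(\<integral>u. f u \<partial>\<mu>) = (\<integral>u. f u \<partial>distr \<mu> borel (\<lambda>u. g * u))"
    using haar by (simp add: normalized_haar_def)
  also have "\<dots> = (\<integral>u. f (g * u) \<partial>\<mu>)" by (rule integral_distr[OF m assms])
  finally show ?thesis ..
qed

end

text \<open>With \<open>\<nu> = \<mu>\<close> included, this says that the left-invariant probability measure is unique on
  continuous functions, which gives right invariance.\<close>

lemma haar_inverse:
  fixes f :: "su2 \<Rightarrow> complex"
  assumes \<mu>: "normalized_haar \<mu>" and \<nu>: "normalized_haar \<nu>" and f: "continuous_on UNIV f"
  shows "(\<integral>u. f u \<partial>\<nu>) = (\<integral>u. f (inverse u) \<partial>\<mu>)"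
proof -
  interpret M: prob_space \<mu> using haar_prob[OF \<mu>] .
  interpret N: prob_space \<nu> using haar_prob[OF \<nu>] .
  interpret P: pair_prob_space \<mu> \<nu> ..
  note [measurable_cong] = haar_sets[OF \<mu>] haar_sets[OF \<nu>]
  have fm: "f \<in> borel_measurable borel" using f by (rule borel_measurable_continuous_onI)
  have cinv: "continuous_on UNIV (\<lambda>u. f (inverse u))"
    by (rule continuous_on_compose2[OF f _ subset_UNIV]) (intro continuous_intros)
  obtain B where B: "\<And>x. cmod (f x) \<le> B" using continuous_bounded_measurable(2)[OF \<mu> f] by blast
  have c: "continuous_on UNIV (\<lambda>(v, w). f (inverse v * w))"
    unfolding split_beta by (rule continuous_on_compose2[OF f _ subset_UNIV]) (intro continuous_intros)
  have "(\<lambda>(v, w). f (inverse v * w)) \<in> borel_measurable (borel \<Otimes>\<^sub>M borel)"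
    unfolding borel_prod using c by (rule borel_measurable_continuous_onI)
  hence m: "(\<lambda>(v, w). f (inverse v * w)) \<in> borel_measurable (\<mu> \<Otimes>\<^sub>M \<nu>)"
    using measurable_cong_sets[OF sets_pair_measure_cong[OF haar_sets[OF \<mu>] haar_sets[OF \<nu>]] refl] by blast
  have i: "integrable (\<mu> \<Otimes>\<^sub>M \<nu>) (\<lambda>(v, w). f (inverse v * w))"
    by (rule P.integrable_const_bound[of _ B]) (use m B in auto)
  \<comment> \<open>Left invariance of \<nu> absorbs \<open>inverse v\<close> in the inner integral.
    After the swap, replacing \<open>v\<close> by \<open>w * v\<close> removes \<open>w\<close>,
    since \<open>inverse (w * v) * w = inverse v\<close>.\<close>
  have "(\<integral>u. f u \<partial>\<nu>) = (\<integral>v. (\<integral>w. f (inverse v * w) \<partial>\<nu>) \<partial>\<mu>)"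
    by (simp add: haar_left[OF \<nu> fm] M.prob_space)
  also have "\<dots> = (\<integral>w. (\<integral>v. f (inverse v * w) \<partial>\<mu>) \<partial>\<nu>)"
    using P.Fubini_integral[OF i] by simp
  also have "\<dots> = (\<integral>w. (\<integral>v. f (inverse v) \<partial>\<mu>) \<partial>\<nu>)"
  proof (rule Bochner_Integration.integral_cong[OF refl])
    fix w
    have "(\<lambda>v. f (inverse v * w)) \<in> borel_measurable borel"
      by (intro borel_measurable_continuous_onI continuous_on_compose2[OF f _ subset_UNIV] continuous_intros)
    from haar_left[OF \<mu> this, of w] show "(\<integral>v. f (inverse v * w) \<partial>\<mu>) = (\<integral>v. f (inverse v) \<partial>\<mu>)"
      by (simp add: su2_inverse_mult mult.assoc su2_left_inverse)
  qed
  also have "\<dots> = (\<integral>u. f (inverse u) \<partial>\<mu>)" by (simp add: N.prob_space)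
  finally show ?thesis .
qed

text \<open>Left and right translations commute, so the right translate of \<mu> is again a
  normalized Haar measure; both integrals then equal the integral of
  \<open>f (inverse u)\<close>.\<close>

lemma haar_right:
  fixes f :: "su2 \<Rightarrow> complex"
  assumes \<mu>: "normalized_haar \<mu>" and f: "continuous_on UNIV f"
  shows "(\<integral>u. f (u * g) \<partial>\<mu>) = (\<integral>u. f u \<partial>\<mu>)"
proof -
  note [measurable_cong] = haar_sets[OF \<mu>]
  interpret M: prob_space \<mu> using haar_prob[OF \<mu>] .
  have m: "(\<lambda>u. u * g) \<in> \<mu> \<rightarrow>\<^sub>M borel" "(\<lambda>u. u * g) \<in> borel \<rightarrow>\<^sub>M borel" for g
    unfolding haar_measurable[OF \<mu>] by (intro borel_measurable_continuous_onI continuous_intros)+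
  have ml: "(\<lambda>u. h * u) \<in> borel \<rightarrow>\<^sub>M borel" "(\<lambda>u. h * u) \<in> \<mu> \<rightarrow>\<^sub>M borel" for h :: su2
    unfolding haar_measurable[OF \<mu>] by (intro borel_measurable_continuous_onI continuous_intros)+
  define \<nu> where "\<nu> = distr \<mu> borel (\<lambda>u. u * g)"
  have "normalized_haar \<nu>"
    unfolding normalized_haar_def
  proof (intro conjI allI)
    show "emeasure \<nu> UNIV = 1"
      using M.emeasure_space_1 m haar_space[OF \<mu>] by (simp add: \<nu>_def emeasure_distr)
    fix h
    have "distr \<nu> borel (\<lambda>u. h * u) = distr \<mu> borel (\<lambda>u. h * u * g)"
      unfolding \<nu>_def by (subst distr_distr) (auto intro!: m ml simp: o_def mult.assoc)
    also have "\<dots> = distr (distr \<mu> borel (\<lambda>u. h * u)) borel (\<lambda>u. u * g)"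
      by (subst distr_distr) (auto intro!: m ml simp: o_def mult.assoc)
    also have "distr \<mu> borel (\<lambda>u. h * u) = \<mu>" using \<mu> unfolding normalized_haar_def by blast
    also have "distr \<mu> borel (\<lambda>u. u * g) = \<nu>" by (simp only: \<nu>_def)
    finally show "distr \<nu> borel (\<lambda>u. h * u) = \<nu>" .
  qed (simp add: \<nu>_def)
  hence "(\<integral>u. f u \<partial>\<nu>) = (\<integral>u. f u \<partial>\<mu>)"
    using haar_inverse[OF \<mu> _ f] \<mu> by metis
  moreover have "(\<integral>u. f u \<partial>\<nu>) = (\<integral>u. f (u * g) \<partial>\<mu>)"
    unfolding \<nu>_def using m f by (intro integral_distr) (auto intro: borel_measurable_continuous_onI)
  ultimately show ?thesis by simp
qed

section \<open>The representations in the monomial basis\<close>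

lemma mat_adjoint_index:
  assumes "A \<in> carrier_mat n m" "i < m" "j < n"
  shows "mat_adjoint (A :: complex mat) $$ (i, j) = cnj (A $$ (j, i))"
  using assms by (simp add: mat_adjoint_def mat_of_rows_index)

definition hom_monom :: "nat \<Rightarrow> nat \<Rightarrow> complex^2 \<Rightarrow> complex" where
  "hom_monom k i z = vec_nth z 1 ^ i * vec_nth z 2 ^ (k - i)"

text \<open>The coefficient of \<open>hom_monom k i\<close> in the transformed
  \<open>hom_monom k m\<close>, obtained by multiplying two binomial expansions. It makes sense for
  every 2x2 matrix and is a polynomial in the entries, which later yields continuity and
  differentiability.\<close>

definition hom_monom_coeff :: "nat \<Rightarrow> nat \<Rightarrow> nat \<Rightarrow> complex^2^2 \<Rightarrow> complex" where
  "hom_monom_coeff k m i U = (\<Sum>(a, b)\<in>{(a, b) \<in> {..m} \<times> {..k - m}. a + b = i}.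
     of_nat (m choose a) * of_nat ((k - m) choose b) * vec_nth (vec_nth U 1) 1 ^ a * vec_nth (vec_nth U 2) 1 ^ (m - a)
     * vec_nth (vec_nth U 1) 2 ^ b * vec_nth (vec_nth U 2) 2 ^ (k - m - b))"

lemma vec_mult_nth: "vec_nth (z v* U) j = vec_nth z 1 * vec_nth (vec_nth U 1) j + vec_nth z 2 * vec_nth (vec_nth (U::complex^2^2) 2) j"
  by (simp add: vector_matrix_mult_def sum_2)

lemma hom_monom_expand:
  assumes "m \<le> k"
  shows "hom_monom k m (z v* U) = (\<Sum>i\<le>k. hom_monom_coeff k m i U * hom_monom k i z)"
proof -
  define x y where "x = vec_nth z 1" and "y = vec_nth z 2"
  define p q r s where pqrs: "p = vec_nth (vec_nth U 1) 1" "q = vec_nth (vec_nth U 2) 1"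
    "r = vec_nth (vec_nth U 1) 2" "s = vec_nth (vec_nth U 2) 2"
  let ?A = "{..m} \<times> {..k - m}"
  let ?t = "\<lambda>(a, b). of_nat (m choose a) * of_nat ((k - m) choose b) * p ^ a * q ^ (m - a) * r ^ b * s ^ (k - m - b)"
  have "hom_monom k m (z v* U) = (x * p + y * q) ^ m * (x * r + y * s) ^ (k - m)"
    unfolding hom_monom_def vec_mult_nth x_def y_def pqrs ..
  also have "\<dots> = (\<Sum>a\<le>m. of_nat (m choose a) * (x * p) ^ a * (y * q) ^ (m - a)) *
      (\<Sum>b\<le>k - m. of_nat ((k - m) choose b) * (x * r) ^ b * (y * s) ^ (k - m - b))"
    by (simp only: binomial_ring)
  also have "\<dots> = (\<Sum>ab\<in>?A. ?t ab * (x ^ (fst ab + snd ab) * y ^ (k - (fst ab + snd ab))))"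
    unfolding sum_product sum.cartesian_product
  proof (rule sum.cong[OF refl])
    fix ab assume ab: "ab \<in> ?A"
    have H: "k - (fst ab + snd ab) = (m - fst ab) + (k - m - snd ab)" using ab assms by auto
    show "(case ab of (a, b) \<Rightarrow> of_nat (m choose a) * (x * p) ^ a * (y * q) ^ (m - a) *
        (of_nat ((k - m) choose b) * (x * r) ^ b * (y * s) ^ (k - m - b)))
      = ?t ab * (x ^ (fst ab + snd ab) * y ^ (k - (fst ab + snd ab)))"
      unfolding split_beta H power_mult_distrib power_add by (simp only: mult_ac)
  qed
  also have "\<dots> = (\<Sum>i\<le>k. \<Sum>ab\<in>{ab \<in> ?A. fst ab + snd ab = i}. ?t ab * (x ^ (fst ab + snd ab) * y ^ (k - (fst ab + snd ab))))"
    using assms by (intro sum.group[symmetric]) auto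
  also have "\<dots> = (\<Sum>i\<le>k. hom_monom_coeff k m i U * hom_monom k i z)"
    unfolding hom_monom_coeff_def hom_monom_def sum_distrib_right
    by (intro sum.cong refl) (auto simp: x_def y_def pqrs)
  finally show ?thesis .
qed

text \<open>Setting the second variable to 1 reduces the claim to polynomials in one
  variable.\<close>

lemma hom_monom_independent:
  assumes "\<And>z. (\<Sum>i\<le>k. c i * hom_monom k i z) = (\<Sum>i\<le>k. d i * hom_monom k i z)" "i \<le> k"
  shows "c i = d i"
proof -
  have "(\<Sum>i\<le>k. c i * x ^ i) = (\<Sum>i\<le>k. d i * x ^ i)" for x
    using assms(1)[of "\<chi> j. if j = 1 then x else 1"] by (simp add: hom_monom_def)
  thus ?thesis using polyfun_eq_coeffs[of c k d] assms(2) by blast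
qed

lemma hom_poly_iff: "P \<in> hom_poly k \<longleftrightarrow> (\<exists>c. P = (\<lambda>z. \<Sum>i\<le>k. c i * hom_monom k i z))"
  by (simp add: hom_poly_def hom_monom_def mult.assoc)

lemma hom_monom_in_hom_poly: "i \<le> k \<Longrightarrow> hom_monom k i \<in> hom_poly k"
  unfolding hom_poly_iff
  by (intro exI[of _ "\<lambda>j. if j = i then 1 else 0"] ext) (simp add: if_distrib[of "\<lambda>x. x * _"] cong: if_cong)

lemma hom_poly_basis_independent:
  assumes "hom_poly_basis k b"
    and eq: "\<And>z. (\<Sum>j<Suc k. c j * b j z) = (\<Sum>j<Suc k. d j * b j z)" and j: "j < Suc k"
  shows "c j = d j"
proof -
  have "\<forall>j. \<exists>e. j < Suc k \<longrightarrow> b j = (\<lambda>z. \<Sum>i\<le>k. e i * hom_monom k i z)"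
    using assms(1) unfolding hom_poly_basis_def hom_poly_iff by blast
  from choice[OF this] obtain e where
    e: "\<And>j. j < Suc k \<Longrightarrow> b j = (\<lambda>z. \<Sum>i\<le>k. e j i * hom_monom k i z)"
    by blast
  let ?P = "\<lambda>z. \<Sum>j<Suc k. c j * b j z"
  have "?P = (\<lambda>z. \<Sum>j<Suc k. \<Sum>i\<le>k. c j * e j i * hom_monom k i z)"
    by (intro ext sum.cong refl) (simp add: e sum_distrib_left mult.assoc)
  also have "\<dots> = (\<lambda>z. \<Sum>i\<le>k. (\<Sum>j<Suc k. c j * e j i) * hom_monom k i z)"
    by (subst sum.swap) (simp only: sum_distrib_right)
  finally have "?P \<in> hom_poly k"
    unfolding hom_poly_iff by (rule exI[of _ "\<lambda>i. \<Sum>j<Suc k. c j * e j i"])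
  hence "\<exists>!c. c \<in> carrier_vec (Suc k) \<and> ?P = (\<lambda>z. \<Sum>j<Suc k. vec_index c j * b j z)"
    using assms(1) unfolding hom_poly_basis_def by blast
  moreover have "?P = (\<lambda>z. \<Sum>j<Suc k. vec_index (Matrix.vec (Suc k) c) j * b j z)"
    by (intro ext sum.cong) auto
  moreover have "?P = (\<lambda>z. \<Sum>j<Suc k. vec_index (Matrix.vec (Suc k) d) j * b j z)"
    unfolding eq by (intro ext sum.cong) auto
  moreover have "Matrix.vec (Suc k) c \<in> carrier_vec (Suc k)" "Matrix.vec (Suc k) d \<in> carrier_vec (Suc k)" by auto
  ultimately have "Matrix.vec (Suc k) c = Matrix.vec (Suc k) d" by blast
  from arg_cong[OF this, of "\<lambda>v. vec_index v j"] j show ?thesis by simp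
qed

definition monom_rep :: "nat \<Rightarrow> su2 \<Rightarrow> complex mat" where
  "monom_rep k u = Matrix.mat (Suc k) (Suc k) (\<lambda>(i, m). hom_monom_coeff k m i (Rep_su2 u))"

lemma monom_rep_carrier [simp]: "monom_rep k u \<in> carrier_mat (Suc k) (Suc k)"
  by (simp add: monom_rep_def)

lemma mat_mult_entry:
  assumes "A \<in> carrier_mat n m" "B \<in> carrier_mat m l" "i < n" "j < l"
  shows "(A * B) $$ (i, j) = (\<Sum>x<m. A $$ (i, x) * B $$ (x, j))"
  using assms by (auto simp: scalar_prod_def lessThan_atLeast0 intro!: sum.cong)

text \<open>The basis hidden in \<open>unitary_matrix_rep\<close> is used only through this
  conjugation: \<open>B\<close> expresses it in monomials and \<open>C\<close> expresses monomials
  in it. Apart from unitarity, the properties of \<open>T\<close> are transported from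
  \<open>monom_rep\<close>.\<close>

lemma unitary_matrix_rep_conj:
  assumes "unitary_matrix_rep k T"
  obtains B C where "B \<in> carrier_mat (Suc k) (Suc k)" "C \<in> carrier_mat (Suc k) (Suc k)"
    "B * C = 1\<^sub>m (Suc k)" "C * B = 1\<^sub>m (Suc k)" "\<And>u. T u = C * monom_rep k u * B"
proof -
  obtain b where b: "hom_poly_basis k b" and Tc: "\<And>u. T u \<in> carrier_mat (Suc k) (Suc k)"
    and Tb: "\<And>u j. j < Suc k \<Longrightarrow> su2_rep u (b j) = (\<lambda>z. \<Sum>i<Suc k. T u $$ (i, j) * b i z)"
    using assms unfolding unitary_matrix_rep_def by blast
  have "\<forall>j. \<exists>e. j < Suc k \<longrightarrow> b j = (\<lambda>z. \<Sum>i\<le>k. e i * hom_monom k i z)"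
    using b unfolding hom_poly_basis_def hom_poly_iff by blast
  from choice[OF this] obtain \<beta> where
    \<beta>: "\<And>j. j < Suc k \<Longrightarrow> b j = (\<lambda>z. \<Sum>i\<le>k. \<beta> j i * hom_monom k i z)"
    by blast
  have "\<forall>i. \<exists>c. i < Suc k \<longrightarrow> hom_monom k i = (\<lambda>z. \<Sum>j<Suc k. c j * b j z)"
  proof
    fix i show "\<exists>c. i < Suc k \<longrightarrow> hom_monom k i = (\<lambda>z. \<Sum>j<Suc k. c j * b j z)"
    proof (cases "i < Suc k")
      case True
      hence "hom_monom k i \<in> hom_poly k" by (intro hom_monom_in_hom_poly) auto
      then obtain v where "hom_monom k i = (\<lambda>z. \<Sum>j<Suc k. vec_index v j * b j z)"
        using b unfolding hom_poly_basis_def by blast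
      thus ?thesis by (intro exI[of _ "vec_index v"]) simp
    qed simp
  qed
  from choice[OF this] obtain \<gamma> where
    \<gamma>: "\<And>i. i < Suc k \<Longrightarrow> hom_monom k i = (\<lambda>z. \<Sum>j<Suc k. \<gamma> i j * b j z)"
    by blast
  define B where "B = Matrix.mat (Suc k) (Suc k) (\<lambda>(i, j). \<beta> j i)"
  define C where "C = Matrix.mat (Suc k) (Suc k) (\<lambda>(i, j). \<gamma> j i)"
  have Bc: "B \<in> carrier_mat (Suc k) (Suc k)" and Cc: "C \<in> carrier_mat (Suc k) (Suc k)"
    by (auto simp: B_def C_def)
  have at: "{..k} = {..<Suc k}" by auto
  have BC: "B * C = 1\<^sub>m (Suc k)"
  proof (rule eq_matI)
    fix i m assume "i < dim_row (1\<^sub>m (Suc k))" "m < dim_col (1\<^sub>m (Suc k))"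
    hence i: "i < Suc k" and m: "m < Suc k" by auto
    have "(\<Sum>i\<le>k. (\<Sum>j<Suc k. \<beta> j i * \<gamma> m j) * hom_monom k i z)
        = (\<Sum>i\<le>k. (if i = m then 1 else 0) * hom_monom k i z)" for z
    proof -
      have "(\<Sum>i\<le>k. (\<Sum>j<Suc k. \<beta> j i * \<gamma> m j) * hom_monom k i z)
         = (\<Sum>j<Suc k. \<gamma> m j * (\<Sum>i\<le>k. \<beta> j i * hom_monom k i z))"
        unfolding sum_distrib_right sum_distrib_left by (subst sum.swap) (simp add: mult_ac)
      also have "\<dots> = (\<Sum>j<Suc k. \<gamma> m j * b j z)" by (intro sum.cong refl) (simp add: \<beta>)
      also have "\<dots> = hom_monom k m z" unfolding \<gamma>[OF m] ..
      also have "\<dots> = (\<Sum>i\<le>k. (if i = m then 1 else 0) * hom_monom k i z)"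
        using m by (simp add: if_distrib[of "\<lambda>x. x * _"] cong: if_cong)
      finally show ?thesis .
    qed
    from hom_monom_independent[OF this, of i] i m
    show "(B * C) $$ (i, m) = 1\<^sub>m (Suc k) $$ (i, m)"
      by (subst mat_mult_entry[OF Bc Cc i m]) (simp add: B_def C_def del: sum.lessThan_Suc)
  qed (use Bc Cc in auto)
  have CB: "C * B = 1\<^sub>m (Suc k)"
    using mat_mult_left_right_inverse[OF Bc Cc BC] .
  have "T u = C * monom_rep k u * B" for u
  proof (rule eq_matI)
    fix l j assume "l < dim_row (C * monom_rep k u * B)" "j < dim_col (C * monom_rep k u * B)"
    hence l: "l < Suc k" and j: "j < Suc k" using Bc Cc by auto
    let ?E = "\<lambda>i m. hom_monom_coeff k m i (Rep_su2 u)"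
    have "(\<Sum>l<Suc k. T u $$ (l, j) * b l z) = (\<Sum>l<Suc k. (C * monom_rep k u * B) $$ (l, j) * b l z)" for z
    proof -
      have "(\<Sum>l<Suc k. T u $$ (l, j) * b l z) = b j (z v* Rep_su2 u)"
        using fun_cong[OF Tb[OF j, of u], of z] by (simp add: su2_rep_def)
      also have "\<dots> = (\<Sum>m\<le>k. \<beta> j m * hom_monom k m (z v* Rep_su2 u))" using \<beta>[OF j] by simp
      also have "\<dots> = (\<Sum>m\<le>k. \<beta> j m * (\<Sum>i\<le>k. ?E i m * (\<Sum>l<Suc k. \<gamma> i l * b l z)))"
      proof (rule sum.cong[OF refl])
        fix m assume "m \<in> {..k}"
        hence m: "m \<le> k" by simp
        have "(\<Sum>i\<le>k. ?E i m * hom_monom k i z) = (\<Sum>i\<le>k. ?E i m * (\<Sum>l<Suc k. \<gamma> i l * b l z))"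
        proof (rule sum.cong[OF refl])
          fix i assume "i \<in> {..k}"
          hence "i < Suc k" by simp
          from fun_cong[OF \<gamma>[OF this], of z]
          show "?E i m * hom_monom k i z = ?E i m * (\<Sum>l<Suc k. \<gamma> i l * b l z)" by (simp only:)
        qed
        thus "\<beta> j m * hom_monom k m (z v* Rep_su2 u) = \<beta> j m * (\<Sum>i\<le>k. ?E i m * (\<Sum>l<Suc k. \<gamma> i l * b l z))"
          by (simp only: hom_monom_expand[OF m])
      qed
      also have "\<dots> = (\<Sum>m<Suc k. \<Sum>i<Suc k. \<Sum>l<Suc k. \<beta> j m * ?E i m * \<gamma> i l * b l z)"
        unfolding at by (simp only: sum_distrib_left mult.assoc)
      also have "\<dots> = (\<Sum>m<Suc k. \<Sum>l<Suc k. \<Sum>i<Suc k. \<beta> j m * ?E i m * \<gamma> i l * b l z)"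
        by (intro sum.cong refl sum.swap)
      also have "\<dots> = (\<Sum>l<Suc k. \<Sum>m<Suc k. \<Sum>i<Suc k. \<beta> j m * ?E i m * \<gamma> i l * b l z)"
        by (rule sum.swap)
      also have "\<dots> = (\<Sum>l<Suc k. (C * monom_rep k u * B) $$ (l, j) * b l z)"
      proof (intro sum.cong refl)
        fix l assume "l \<in> {..<Suc k}"
        hence l: "l < Suc k" by simp
        have CE: "C * monom_rep k u \<in> carrier_mat (Suc k) (Suc k)" using Cc by simp
        have "(C * monom_rep k u * B) $$ (l, j) = (\<Sum>m<Suc k. (C * monom_rep k u) $$ (l, m) * B $$ (m, j))"
          by (rule mat_mult_entry[OF CE Bc l j])
        also have "\<dots> = (\<Sum>m<Suc k. (\<Sum>i<Suc k. \<gamma> i l * ?E i m) * \<beta> j m)"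
        proof (rule sum.cong[OF refl])
          fix m assume "m \<in> {..<Suc k}"
          hence m: "m < Suc k" by simp
          have "(C * monom_rep k u) $$ (l, m) = (\<Sum>i<Suc k. \<gamma> i l * ?E i m)"
            unfolding mat_mult_entry[OF Cc monom_rep_carrier l m]
            using l m by (intro sum.cong refl) (simp add: C_def monom_rep_def)
          thus "(C * monom_rep k u) $$ (l, m) * B $$ (m, j) = (\<Sum>i<Suc k. \<gamma> i l * ?E i m) * \<beta> j m"
            using m j by (simp add: B_def)
        qed
        finally show "(\<Sum>m<Suc k. \<Sum>i<Suc k. \<beta> j m * ?E i m * \<gamma> i l * b l z) = (C * monom_rep k u * B) $$ (l, j) * b l z"
          by (simp only: sum_distrib_right) (simp only: mult_ac)
      qed
      finally show ?thesis .
    qed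
    from hom_poly_basis_independent[OF b this l]
    show "T u $$ (l, j) = (C * monom_rep k u * B) $$ (l, j)" .
  qed (use Tc[of u] Bc Cc in auto)
  from that[OF Bc Cc BC CB this] show ?thesis .
qed

text \<open>Entries can be read off from any expansion in monomials, so the double sum in
  \<open>hom_monom_coeff\<close> never has to be evaluated.\<close>

lemma monom_rep_entry:
  assumes "m \<le> k" "\<And>z. hom_monom k m (z v* Rep_su2 u) = (\<Sum>i\<le>k. c i * hom_monom k i z)" "i \<le> k"
  shows "monom_rep k u $$ (i, m) = c i"
proof -
  have "hom_monom_coeff k m i (Rep_su2 u) = c i"
    using hom_monom_independent[of "\<lambda>i. hom_monom_coeff k m i (Rep_su2 u)" k c, OF _ assms(3)]
    by (simp add: hom_monom_expand[OF assms(1), symmetric] assms(2))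
  thus ?thesis using assms by (simp add: monom_rep_def)
qed

lemma Rep_su2_exp: "Rep_su2 (su2_exp a t) = exp_mat a t"
  by (simp add: su2_exp_def Abs_su2_inverse exp_mat_SU2)

section \<open>Weights and Schur's lemma for the monomial representations\<close>

lemma monom_rep_diag:
  assumes "vec_nth (vec_nth (Rep_su2 u) 1) 2 = 0" "vec_nth (vec_nth (Rep_su2 u) 2) 1 = 0" "i \<le> k" "m \<le> k"
  shows "monom_rep k u $$ (i, m) = (if i = m then su2_entry u 1 1 ^ m * su2_entry u 2 2 ^ (k - m) else 0)"
proof (rule monom_rep_entry)
  show "hom_monom k m (z v* Rep_su2 u)
    = (\<Sum>i\<le>k. (if i = m then su2_entry u 1 1 ^ m * su2_entry u 2 2 ^ (k - m) else 0) * hom_monom k i z)" for z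
  proof -
    have "hom_monom k m (z v* Rep_su2 u) = su2_entry u 1 1 ^ m * su2_entry u 2 2 ^ (k - m) * hom_monom k m z"
      using assms by (simp add: hom_monom_def vec_mult_nth power_mult_distrib mult_ac)
    thus ?thesis using assms by (simp add: if_distrib[of "\<lambda>x. x * _"] cong: if_cong)
  qed
qed (use assms in auto)

lemma monom_rep_torus:
  assumes "i \<le> k" "m \<le> k"
  shows "monom_rep k (su2_exp AZ \<theta>) $$ (i, m) = (if i = m then cis (\<theta> * (2 * real m - real k)) else 0)"
proof -
  have "cis \<theta> ^ m * cis (- \<theta>) ^ (k - m) = cis (real m * \<theta> + real (k - m) * (- \<theta>))"
    by (simp add: Complex.DeMoivre cis_mult)
  also have "real m * \<theta> + real (k - m) * (- \<theta>) = \<theta> * (2 * real m - real k)"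
    using assms by (simp add: of_nat_diff algebra_simps)
  finally show ?thesis using assms by (subst monom_rep_diag) (auto simp: Rep_su2_exp)
qed

text \<open>One angle separates distinct weights: at \<open>\<theta> = pi / (a - b)\<close> the
  quotient of the two characters is \<open>cis pi = - 1\<close>.\<close>

lemma torus_weight_eq:
  fixes n :: int
  assumes "\<And>\<theta>. y * cis (\<theta> * a) = cis (\<theta> * b) * y" "y \<noteq> 0" "a - b = of_int n"
  shows "a = b"
proof (rule ccontr)
  assume "a \<noteq> b"
  hence ab: "a - b \<noteq> 0" by simp
  define \<theta> where "\<theta> = pi / (a - b)"
  have "cis (\<theta> * a) = cis (\<theta> * b)" using assms(1)[of \<theta>] assms(2) by simp
  hence "cis (\<theta> * a) / cis (\<theta> * b) = 1" by simp
  hence "cis (\<theta> * a - \<theta> * b) = 1" by (simp add: cis_divide)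
  also have "\<theta> * a - \<theta> * b = \<theta> * (a - b)" by (simp add: algebra_simps)
  finally have "cis (\<theta> * (a - b)) = 1" .
  moreover have "\<theta> * (a - b) = pi" using ab by (simp add: \<theta>_def)
  ultimately show False by simp
qed

text \<open>All four entries of this rotation are nonzero, so the image of the top monomial is a
  full binomial expansion and every monomial has a nonzero top component. This is the element that
  mixes the weights in the proofs of Schur's lemma.\<close>

lemma monom_rep_rotation_top:
  assumes "i \<le> k"
  shows "monom_rep k (su2_exp AY (pi / 4)) $$ (i, k) \<noteq> 0" (is ?A)
    and "monom_rep k (su2_exp AY (pi / 4)) $$ (k, i) \<noteq> 0" (is ?B)
proof -
  define r where "r = complex_of_real (sqrt 2 / 2)"
  have r: "r \<noteq> 0" by (simp add: r_def)
  have e: "su2_entry (su2_exp AY (pi / 4)) 1 1 = r" "su2_entry (su2_exp AY (pi / 4)) 1 2 = r"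
    "su2_entry (su2_exp AY (pi / 4)) 2 1 = - r" "su2_entry (su2_exp AY (pi / 4)) 2 2 = r"
    by (simp_all add: Rep_su2_exp r_def cos_45 sin_45)
  have "monom_rep k (su2_exp AY (pi / 4)) $$ (i, k) = of_nat (k choose i) * r ^ i * (- r) ^ (k - i)"
  proof (rule monom_rep_entry)
    fix z
    have "hom_monom k k (z v* Rep_su2 (su2_exp AY (pi / 4))) = (vec_nth z 1 * r + vec_nth z 2 * (- r)) ^ k"
      unfolding hom_monom_def vec_mult_nth e by simp
    also have "\<dots> = (\<Sum>i\<le>k. of_nat (k choose i) * (vec_nth z 1 * r) ^ i * (vec_nth z 2 * (- r)) ^ (k - i))"
      by (rule binomial_ring)
    also have "\<dots> = (\<Sum>i\<le>k. of_nat (k choose i) * r ^ i * (- r) ^ (k - i) * hom_monom k i z)"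
      by (intro sum.cong refl) (simp only: hom_monom_def power_mult_distrib mult_ac)
    finally show "hom_monom k k (z v* Rep_su2 (su2_exp AY (pi / 4))) =
        (\<Sum>i\<le>k. of_nat (k choose i) * r ^ i * (- r) ^ (k - i) * hom_monom k i z)" .
  qed (use assms in auto)
  thus ?A using r assms by simp
  \<comment> \<open>Every monomial except the top one vanishes at this point, so evaluating an
    expansion there extracts its coefficient of index \<open>k\<close>.\<close>
  define z0 :: "complex^2" where "z0 = (\<chi> j. if j = 1 then 1 else 0)"
  have z0: "hom_monom k j z0 = (if j = k then 1 else 0)" if "j \<le> k" for j
    using that by (auto simp: hom_monom_def z0_def)
  have "(\<Sum>j\<le>k. hom_monom_coeff k i j (Rep_su2 (su2_exp AY (pi / 4))) * hom_monom k j z0)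
     = (\<Sum>j\<le>k. if j = k then hom_monom_coeff k i k (Rep_su2 (su2_exp AY (pi / 4))) else 0)"
    using z0 by (intro sum.cong refl) auto
  hence "hom_monom_coeff k i k (Rep_su2 (su2_exp AY (pi / 4))) = hom_monom k i (z0 v* Rep_su2 (su2_exp AY (pi / 4)))"
    unfolding hom_monom_expand[OF assms] by simp
  also have "\<dots> = r ^ i * r ^ (k - i)"
    unfolding hom_monom_def vec_mult_nth e by (simp add: z0_def)
  finally show ?B using r assms by (simp add: monom_rep_def)
qed

lemma sum_single_nonzero:
  fixes f :: "nat \<Rightarrow> 'a::comm_monoid_add"
  assumes "j < n" "\<And>x. x < n \<Longrightarrow> x \<noteq> j \<Longrightarrow> f x = 0"
  shows "(\<Sum>x<n. f x) = f j"
  using assms by (subst sum.remove[of _ j]) (auto intro!: sum.neutral)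

text \<open>On the torus both representations are diagonal, with weights \<open>2 * j - l\<close>
  and \<open>2 * i - k\<close>, and a nonzero entry can only join equal weights. The conclusion is
  rearranged to avoid subtraction on natural numbers.\<close>

lemma monom_rep_intertwiner_weight:
  assumes Y: "Y \<in> carrier_mat (Suc k) (Suc l)"
    and tw: "\<And>g. Y * monom_rep l g = monom_rep k g * Y"
    and ij: "i \<le> k" "j \<le> l" "Y $$ (i, j) \<noteq> 0"
  shows "2 * j + k = 2 * i + l"
proof -
  have "Y $$ (i, j) * cis (\<theta> * (2 * real j - real l)) = cis (\<theta> * (2 * real i - real k)) * Y $$ (i, j)" for \<theta>
  proof -
    have "(Y * monom_rep l (su2_exp AZ \<theta>)) $$ (i, j) = Y $$ (i, j) * cis (\<theta> * (2 * real j - real l))"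
      using ij by (subst mat_mult_entry[OF Y monom_rep_carrier])
        (auto simp: monom_rep_torus sum_single_nonzero[of j])
    moreover have "(monom_rep k (su2_exp AZ \<theta>) * Y) $$ (i, j) = cis (\<theta> * (2 * real i - real k)) * Y $$ (i, j)"
      using ij by (subst mat_mult_entry[OF monom_rep_carrier Y])
        (auto simp: monom_rep_torus sum_single_nonzero[of i])
    ultimately show ?thesis using tw[of "su2_exp AZ \<theta>"] by metis
  qed
  from torus_weight_eq[OF this ij(3), of "(2 * int j - int l) - (2 * int i - int k)"]
  have "2 * real j - real l = 2 * real i - real k" by simp
  thus ?thesis by linarith
qed

text \<open>Commuting with the torus forces \<open>Y\<close> to preserve weights. A rotation moves the top weight vector to
  a vector without zero coordinates, and the top weight \<open>k\<close> does not occur in the smaller representation.\<close>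

lemma monom_rep_schur_neq:
  assumes Y: "Y \<in> carrier_mat (Suc k) (Suc l)"
    and tw: "\<And>g. Y * monom_rep l g = monom_rep k g * Y" and kl: "l < k"
  shows "Y = 0\<^sub>m (Suc k) (Suc l)"
proof -
  note w = monom_rep_intertwiner_weight[OF Y tw]
  define g where "g = su2_exp AY (pi / 4)"
  have topl: "monom_rep l g $$ (i, l) \<noteq> 0" if "i \<le> l" for i
    using monom_rep_rotation_top[OF that] by (simp add: g_def)
  have topk: "monom_rep k g $$ (k, i) \<noteq> 0" if "i \<le> k" for i
    using monom_rep_rotation_top[OF that] by (simp add: g_def)
  have top: "Y $$ (i, l) = 0" if i: "i \<le> k" for i
  proof (rule ccontr)
    assume nz: "Y $$ (i, l) \<noteq> 0"
    \<comment> \<open>Row \<open>k\<close> of \<open>Y\<close> vanishes, as a nonzero entry in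
      column \<open>x\<close> would give \<open>2 * x = k + l > 2 * l\<close>. On the other side of
      the intertwining identity a single term survives, because column \<open>l\<close> can meet
      only one weight.\<close>
    have "(Y * monom_rep l g) $$ (k, l) = (\<Sum>x<Suc l. Y $$ (k, x) * monom_rep l g $$ (x, l))"
      by (rule mat_mult_entry[OF Y monom_rep_carrier]) auto
    also have "\<dots> = 0"
    proof (intro sum.neutral ballI)
      fix x assume "x \<in> {..<Suc l}"
      hence "Y $$ (k, x) = 0" using w[of k x] kl by fastforce
      thus "Y $$ (k, x) * monom_rep l g $$ (x, l) = 0" by simp
    qed
    finally have "(monom_rep k g * Y) $$ (k, l) = 0" using tw by simp
    moreover have "(monom_rep k g * Y) $$ (k, l) = (\<Sum>x<Suc k. monom_rep k g $$ (k, x) * Y $$ (x, l))"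
      by (rule mat_mult_entry[OF monom_rep_carrier Y]) auto
    moreover have "\<dots> = monom_rep k g $$ (k, i) * Y $$ (i, l)"
    proof (rule sum_single_nonzero)
      fix x assume "x < Suc k" "x \<noteq> i"
      hence "Y $$ (x, l) = 0" using w[of x l] w[of i l] i nz by fastforce
      thus "monom_rep k g $$ (k, x) * Y $$ (x, l) = 0" by simp
    qed (use i in auto)
    ultimately show False using topk[OF i] nz by simp
  qed
  show ?thesis
  proof (rule eq_matI)
    fix i j assume "i < dim_row (0\<^sub>m (Suc k) (Suc l))" "j < dim_col (0\<^sub>m (Suc k) (Suc l))"
    hence ij: "i \<le> k" "j \<le> l" by auto
    have "Y $$ (i, j) = 0"
    proof (rule ccontr)
      assume nz: "Y $$ (i, j) \<noteq> 0"
      \<comment> \<open>The top column being zero, the entry \<open>(i, l)\<close> of the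
        intertwining identity isolates \<open>Y $$ (i, j)\<close> times a nonzero entry of the
        rotation.\<close>
      have "(monom_rep k g * Y) $$ (i, l) = (\<Sum>x<Suc k. monom_rep k g $$ (i, x) * Y $$ (x, l))"
        using ij by (intro mat_mult_entry[OF monom_rep_carrier Y]) auto
      also have "\<dots> = 0" using top by (intro sum.neutral) auto
      finally have "(Y * monom_rep l g) $$ (i, l) = 0" using tw by simp
      moreover have "(Y * monom_rep l g) $$ (i, l) = (\<Sum>x<Suc l. Y $$ (i, x) * monom_rep l g $$ (x, l))"
        using ij by (intro mat_mult_entry[OF Y monom_rep_carrier]) auto
      moreover have "\<dots> = Y $$ (i, j) * monom_rep l g $$ (j, l)"
      proof (rule sum_single_nonzero)
        fix x assume "x < Suc l" "x \<noteq> j"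
        hence "Y $$ (i, x) = 0" using w[of i x] w[of i j] ij nz by fastforce
        thus "Y $$ (i, x) * monom_rep l g $$ (x, l) = 0" by simp
      qed (use ij in auto)
      ultimately show False using topl[OF ij(2)] nz by simp
    qed
    thus "Y $$ (i, j) = 0\<^sub>m (Suc k) (Suc l) $$ (i, j)" using ij by simp
  qed (use Y in auto)
qed

text \<open>The weights of one representation are distinct, so \<open>Y\<close> is diagonal.
  Comparing the entries \<open>(i, k)\<close> of the identity for the rotation, whose top column has
  no zeros, equates each diagonal entry with the last one.\<close>

lemma monom_rep_schur_eq:
  assumes Y: "Y \<in> carrier_mat (Suc k) (Suc k)"
    and tw: "\<And>g. Y * monom_rep k g = monom_rep k g * Y"
  shows "Y = Y $$ (k, k) \<cdot>\<^sub>m 1\<^sub>m (Suc k)"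
proof -
  note w = monom_rep_intertwiner_weight[OF Y tw]
  define g where "g = su2_exp AY (pi / 4)"
  have off: "Y $$ (i, j) = 0" if "i \<le> k" "j \<le> k" "i \<noteq> j" for i j
    using w[of i j] that by fastforce
  have diag: "Y $$ (i, i) = Y $$ (k, k)" if i: "i \<le> k" for i
  proof -
    have "(Y * monom_rep k g) $$ (i, k) = (\<Sum>x<Suc k. Y $$ (i, x) * monom_rep k g $$ (x, k))"
      using i by (intro mat_mult_entry[OF Y monom_rep_carrier]) auto
    also have "\<dots> = Y $$ (i, i) * monom_rep k g $$ (i, k)"
      using i off by (intro sum_single_nonzero) auto
    finally have 1: "(Y * monom_rep k g) $$ (i, k) = Y $$ (i, i) * monom_rep k g $$ (i, k)" .
    have "(monom_rep k g * Y) $$ (i, k) = (\<Sum>x<Suc k. monom_rep k g $$ (i, x) * Y $$ (x, k))"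
      using i by (intro mat_mult_entry[OF monom_rep_carrier Y]) auto
    also have "\<dots> = monom_rep k g $$ (i, k) * Y $$ (k, k)"
      using i off by (intro sum_single_nonzero) auto
    finally show ?thesis using 1 tw[of g] monom_rep_rotation_top(1)[OF i] by (simp add: g_def)
  qed
  show ?thesis
  proof (rule eq_matI)
    fix i j assume "i < dim_row (Y $$ (k, k) \<cdot>\<^sub>m 1\<^sub>m (Suc k))" "j < dim_col (Y $$ (k, k) \<cdot>\<^sub>m 1\<^sub>m (Suc k))"
    hence ij: "i \<le> k" "j \<le> k" by auto
    show "Y $$ (i, j) = (Y $$ (k, k) \<cdot>\<^sub>m 1\<^sub>m (Suc k)) $$ (i, j)"
    proof (cases "i = j")
      case True
      have "Y $$ (i, i) = Y $$ (k, k)" by (rule diag[OF ij(1)])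
      thus ?thesis using ij True by simp
    qed (use ij off[OF ij] in simp)
  qed (use Y in auto)
qed

text \<open>Conjugating with the monomial bases turns an intertwiner of the matrix representations into an
  intertwiner of the monomial ones.\<close>

lemma unitary_rep_schur:
  assumes T: "unitary_matrix_rep k T" and S: "unitary_matrix_rep l S"
    and X: "X \<in> carrier_mat (Suc k) (Suc l)"
    and tw: "\<And>g. X * S g = T g * X"
  shows "l < k \<Longrightarrow> X = 0\<^sub>m (Suc k) (Suc l)" and "l = k \<Longrightarrow> S = T \<Longrightarrow> \<exists>c. X = c \<cdot>\<^sub>m 1\<^sub>m (Suc k)"
proof -
  obtain B C where BC: "B \<in> carrier_mat (Suc k) (Suc k)" "C \<in> carrier_mat (Suc k) (Suc k)"
    "B * C = 1\<^sub>m (Suc k)" "C * B = 1\<^sub>m (Suc k)" "\<And>u. T u = C * monom_rep k u * B"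
    using unitary_matrix_rep_conj[OF T] by metis
  \<comment> \<open>Kept general in \<open>B'\<close> and \<open>C'\<close>: the vanishing case uses
    unrelated bases, whereas the scalar case needs the same pair on both sides, since only then does
    conjugating back leave a scalar matrix unchanged.\<close>
  have *: "l < k \<longrightarrow> X = 0\<^sub>m (Suc k) (Suc l)" "l = k \<longrightarrow> B' = B \<longrightarrow> C' = C \<longrightarrow> (\<exists>c. X = c \<cdot>\<^sub>m 1\<^sub>m (Suc k))"
    if BC': "B' \<in> carrier_mat (Suc l) (Suc l)" "C' \<in> carrier_mat (Suc l) (Suc l)"
    "B' * C' = 1\<^sub>m (Suc l)" "C' * B' = 1\<^sub>m (Suc l)" "\<And>u. S u = C' * monom_rep l u * B'" for B' C'
  proof -
    note carr = mult_carrier_mat[of _ "Suc l" "Suc l" _ "Suc l"] mult_carrier_mat[of _ "Suc k" "Suc l" _ "Suc l"]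
      mult_carrier_mat[of _ "Suc k" "Suc k" _ "Suc k"] mult_carrier_mat[of _ "Suc k" "Suc k" _ "Suc l"]
    define Y where "Y = B * (X * C')"
    have Y: "Y \<in> carrier_mat (Suc k) (Suc l)" using BC BC' X by (auto simp: Y_def)
    have XY: "X = C * (Y * B')"
    proof -
      have "C * (Y * B') = C * ((B * (X * C')) * B')" by (simp add: Y_def)
      also have "\<dots> = C * (B * (X * (C' * B')))"
        using BC(1,2) BC'(1,2) X by (simp add: carr assoc_mult_mat[of _ "Suc k" "Suc l" _ "Suc l" _ "Suc l"]
            assoc_mult_mat[of _ "Suc k" "Suc k" _ "Suc l" _ "Suc l"])
      also have "\<dots> = (C * B) * X"
        using BC(1,2) BC'(4) X by (simp add: carr assoc_mult_mat[of _ "Suc k" "Suc k" _ "Suc k" _ "Suc l"])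
      finally show ?thesis using BC(4) X by simp
    qed
    have twY: "Y * monom_rep l g = monom_rep k g * Y" for g
    proof -
      have E: "monom_rep l g \<in> carrier_mat (Suc l) (Suc l)" "monom_rep k g \<in> carrier_mat (Suc k) (Suc k)" by auto
      have "Y * monom_rep l g = B * (X * (C' * monom_rep l g))"
        using BC(1) BC'(1,2) X E by (simp add: Y_def carr assoc_mult_mat[of _ "Suc k" "Suc l" _ "Suc l" _ "Suc l"]
            assoc_mult_mat[of _ "Suc k" "Suc k" _ "Suc l" _ "Suc l"])
      also have "\<dots> = B * (X * (C' * (monom_rep l g * (B' * C'))))"
        by (simp only: BC'(3) right_mult_one_mat[OF monom_rep_carrier])
      also have "\<dots> = B * ((X * (C' * monom_rep l g * B')) * C')"
        using BC(1) BC'(1,2) X E by (simp add: carr assoc_mult_mat[of _ "Suc k" "Suc l" _ "Suc l" _ "Suc l"]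
            assoc_mult_mat[of _ "Suc l" "Suc l" _ "Suc l" _ "Suc l"])
      also have "X * (C' * monom_rep l g * B') = (C * monom_rep k g * B) * X"
        using tw[of g] BC(5) BC'(5) by simp
      also have "B * (((C * monom_rep k g * B) * X) * C') = (B * C) * (monom_rep k g * (B * (X * C')))"
        using BC(1,2) BC'(2) X E by (simp add: carr assoc_mult_mat[of _ "Suc k" "Suc k" _ "Suc l" _ "Suc l"]
          assoc_mult_mat[of _ "Suc k" "Suc k" _ "Suc k" _ "Suc l"] assoc_mult_mat[of _ "Suc k" "Suc k" _ "Suc k" _ "Suc k"])
      also have "\<dots> = monom_rep k g * Y"
        unfolding Y_def[symmetric] BC(3) by (rule left_mult_one_mat[OF mult_carrier_mat[OF monom_rep_carrier Y]])
      finally show ?thesis .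
    qed
    have "X = 0\<^sub>m (Suc k) (Suc l)" if "l < k"
      unfolding XY monom_rep_schur_neq[OF Y twY that] using BC' BC by simp
    moreover have "\<exists>c. X = c \<cdot>\<^sub>m 1\<^sub>m (Suc k)" if "l = k" "B' = B" "C' = C"
    proof -
      have Y': "Y \<in> carrier_mat (Suc k) (Suc k)" and twY': "\<And>g. Y * monom_rep k g = monom_rep k g * Y"
        using Y twY that(1) by auto
      define c where "c = Y $$ (k, k)"
      have c: "Y = c \<cdot>\<^sub>m 1\<^sub>m (Suc k)" unfolding c_def by (rule monom_rep_schur_eq[OF Y' twY'])
      have "(c \<cdot>\<^sub>m 1\<^sub>m (Suc k)) * B = c \<cdot>\<^sub>m B"
        using mult_smult_assoc_mat[OF one_carrier_mat BC(1), of c] BC(1) by simp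
      hence "X = c \<cdot>\<^sub>m (C * B)" unfolding XY c that using mult_smult_distrib[OF BC(2,1)] by simp
      thus ?thesis using BC(4) by auto
    qed
    ultimately show "l < k \<longrightarrow> X = 0\<^sub>m (Suc k) (Suc l)" "l = k \<longrightarrow> B' = B \<longrightarrow> C' = C \<longrightarrow> (\<exists>c. X = c \<cdot>\<^sub>m 1\<^sub>m (Suc k))"
      by blast+
  qed
  obtain B' C' where BC': "B' \<in> carrier_mat (Suc l) (Suc l)" "C' \<in> carrier_mat (Suc l) (Suc l)"
    "B' * C' = 1\<^sub>m (Suc l)" "C' * B' = 1\<^sub>m (Suc l)" "\<And>u. S u = C' * monom_rep l u * B'"
    using unitary_matrix_rep_conj[OF S] by metis
  from *(1)[OF BC'] show "l < k \<Longrightarrow> X = 0\<^sub>m (Suc k) (Suc l)" by blast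
  show "\<exists>c. X = c \<cdot>\<^sub>m 1\<^sub>m (Suc k)" if "l = k" "S = T"
    using *(2)[of B C] BC that by auto
qed

section \<open>Schur orthogonality\<close>

lemma cmod_sum_power2_eq:
  fixes c :: "'i \<Rightarrow> complex"
  shows "(\<Sum>x\<in>I. c x * cnj (c x)) = complex_of_real (\<Sum>x\<in>I. (cmod (c x))\<^sup>2)"
  by (simp only: of_real_sum complex_norm_square)

lemma complex_integral_norm_square:
  "(\<integral>u. complex_of_real ((cmod (f u))\<^sup>2) \<partial>\<mu>) = (\<integral>u. f u * cnj (f u) \<partial>\<mu>)"
  by (simp only: complex_norm_square)

section \<open>Finite orthonormal systems in a probability space\<close>

context
  fixes \<mu> :: "'a measure" and I :: "'i set" and \<phi> :: "'i \<Rightarrow> 'a \<Rightarrow> complex"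
  assumes P: "prob_space \<mu>" and I: "finite I"
    and \<phi>: "\<And>x. x \<in> I \<Longrightarrow> bounded_measurable \<mu> (\<phi> x)"
begin

lemma integrable_mult_cnj:
  assumes "bounded_measurable \<mu> f" "bounded_measurable \<mu> g"
  shows "integrable \<mu> (\<lambda>u. f u * cnj (g u))"
  using assms by (intro bounded_measurable_integrable[OF P] bounded_measurable_mult bounded_measurable_cnj)

lemma integral_orthonormal_sum:
  assumes orth: "\<And>x y. x \<in> I \<Longrightarrow> y \<in> I \<Longrightarrow> (\<integral>u. \<phi> x u * cnj (\<phi> y u) \<partial>\<mu>) = (if x = y then 1 else 0)"
  shows "(\<integral>u. (\<Sum>x\<in>I. c x * \<phi> x u) * cnj (\<Sum>y\<in>I. d y * \<phi> y u) \<partial>\<mu>) = (\<Sum>x\<in>I. c x * cnj (d x))"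
proof -
  have int: "integrable \<mu> (\<lambda>u. (c x * cnj (d y)) * (\<phi> x u * cnj (\<phi> y u)))" if "x \<in> I" "y \<in> I" for x y
    using that by (intro integrable_mult_right integrable_mult_cnj \<phi>)
  have "(\<integral>u. (\<Sum>x\<in>I. c x * \<phi> x u) * cnj (\<Sum>y\<in>I. d y * \<phi> y u) \<partial>\<mu>)
     = (\<integral>u. (\<Sum>x\<in>I. \<Sum>y\<in>I. (c x * cnj (d y)) * (\<phi> x u * cnj (\<phi> y u))) \<partial>\<mu>)"
    unfolding cnj_sum sum_product by (intro Bochner_Integration.integral_cong refl sum.cong) (simp add: mult_ac)
  also have "\<dots> = (\<Sum>x\<in>I. \<integral>u. (\<Sum>y\<in>I. (c x * cnj (d y)) * (\<phi> x u * cnj (\<phi> y u))) \<partial>\<mu>)"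
    using int by (intro Bochner_Integration.integral_sum Bochner_Integration.integrable_sum)
  also have "\<dots> = (\<Sum>x\<in>I. \<Sum>y\<in>I. \<integral>u. (c x * cnj (d y)) * (\<phi> x u * cnj (\<phi> y u)) \<partial>\<mu>)"
    using int by (intro sum.cong refl Bochner_Integration.integral_sum)
  also have "\<dots> = (\<Sum>x\<in>I. \<Sum>y\<in>I. (c x * cnj (d y)) * (\<integral>u. \<phi> x u * cnj (\<phi> y u) \<partial>\<mu>))"
    by (simp only: integral_mult_right_zero)
  also have "\<dots> = (\<Sum>x\<in>I. \<Sum>y\<in>I. if x = y then c x * cnj (d y) else 0)"
    using orth by (intro sum.cong refl) auto
  also have "\<dots> = (\<Sum>x\<in>I. c x * cnj (d x))" using I by simp
  finally show ?thesis .
qed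

lemma parseval_finite:
  assumes orth: "\<And>x y. x \<in> I \<Longrightarrow> y \<in> I \<Longrightarrow> (\<integral>u. \<phi> x u * cnj (\<phi> y u) \<partial>\<mu>) = (if x = y then 1 else 0)"
  shows "(\<integral>u. (cmod (\<Sum>x\<in>I. c x * \<phi> x u))\<^sup>2 \<partial>\<mu>) = (\<Sum>x\<in>I. (cmod (c x))\<^sup>2)"
proof -
  have "complex_of_real (\<integral>u. (cmod (\<Sum>x\<in>I. c x * \<phi> x u))\<^sup>2 \<partial>\<mu>)
     = (\<integral>u. (\<Sum>x\<in>I. c x * \<phi> x u) * cnj (\<Sum>x\<in>I. c x * \<phi> x u) \<partial>\<mu>)"
    unfolding integral_complex_of_real[symmetric] complex_integral_norm_square ..
  also have "\<dots> = (\<Sum>x\<in>I. c x * cnj (c x))"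
    using orth by (rule integral_orthonormal_sum)
  also have "\<dots> = complex_of_real (\<Sum>x\<in>I. (cmod (c x))\<^sup>2)"
    by (rule cmod_sum_power2_eq)
  finally have "complex_of_real (\<integral>u. (cmod (\<Sum>x\<in>I. c x * \<phi> x u))\<^sup>2 \<partial>\<mu>)
     = complex_of_real (\<Sum>x\<in>I. (cmod (c x))\<^sup>2)" .
  thus ?thesis by (simp only: of_real_eq_iff)
qed

lemma bessel_finite:
  assumes orth: "\<And>x y. x \<in> I \<Longrightarrow> y \<in> I \<Longrightarrow> (\<integral>u. \<phi> x u * cnj (\<phi> y u) \<partial>\<mu>) = (if x = y then 1 else 0)"
    and f: "bounded_measurable \<mu> f"
  shows "(\<Sum>x\<in>I. (cmod (\<integral>u. f u * cnj (\<phi> x u) \<partial>\<mu>))\<^sup>2) \<le> (\<integral>u. (cmod (f u))\<^sup>2 \<partial>\<mu>)"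
proof -
  define c where "c = (\<lambda>x. \<integral>u. f u * cnj (\<phi> x u) \<partial>\<mu>)"
  define S where "S = (\<lambda>u. \<Sum>x\<in>I. c x * \<phi> x u)"
  have S: "bounded_measurable \<mu> S"
    unfolding S_def using \<phi> by (intro bounded_measurable_sum bounded_measurable_mult bounded_measurable_const)
  have fS: "(\<integral>u. f u * cnj (S u) \<partial>\<mu>) = complex_of_real (\<Sum>x\<in>I. (cmod (c x))\<^sup>2)"
  proof -
    have "(\<integral>u. f u * cnj (S u) \<partial>\<mu>) = (\<integral>u. (\<Sum>x\<in>I. cnj (c x) * (f u * cnj (\<phi> x u))) \<partial>\<mu>)"
      unfolding S_def by (simp add: sum_distrib_left mult_ac)
    also have "\<dots> = (\<Sum>x\<in>I. cnj (c x) * c x)"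
      using \<phi> f integrable_mult_cnj by (subst Bochner_Integration.integral_sum) (simp_all add: c_def)
    finally show ?thesis using cmod_sum_power2_eq[of c I] by (simp add: mult.commute)
  qed
  have "(\<integral>u. S u * cnj (f u) \<partial>\<mu>) = (\<integral>u. cnj (f u * cnj (S u)) \<partial>\<mu>)" by (simp add: mult.commute)
  also have "\<dots> = cnj (\<integral>u. f u * cnj (S u) \<partial>\<mu>)" by (rule Bochner_Integration.integral_cnj)
  finally have Sf: "(\<integral>u. S u * cnj (f u) \<partial>\<mu>) = complex_of_real (\<Sum>x\<in>I. (cmod (c x))\<^sup>2)"
    unfolding fS by simp
  have SS: "(\<integral>u. S u * cnj (S u) \<partial>\<mu>) = complex_of_real (\<Sum>x\<in>I. (cmod (c x))\<^sup>2)"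
    unfolding S_def cmod_sum_power2_eq[symmetric] using orth by (rule integral_orthonormal_sum)
  have ff: "(\<integral>u. f u * cnj (f u) \<partial>\<mu>) = complex_of_real (\<integral>u. (cmod (f u))\<^sup>2 \<partial>\<mu>)"
    unfolding complex_integral_norm_square[symmetric] by (rule integral_complex_of_real)
  have "complex_of_real (\<integral>u. (cmod (f u - S u))\<^sup>2 \<partial>\<mu>) = (\<integral>u. (f u - S u) * cnj (f u - S u) \<partial>\<mu>)"
    unfolding integral_complex_of_real[symmetric] complex_integral_norm_square ..
  also have "\<dots> = (\<integral>u. f u * cnj (f u) - f u * cnj (S u) - S u * cnj (f u) + S u * cnj (S u) \<partial>\<mu>)"
    by (intro Bochner_Integration.integral_cong refl) (simp add: algebra_simps)
  also have "\<dots> = (\<integral>u. f u * cnj (f u) \<partial>\<mu>) - (\<integral>u. f u * cnj (S u) \<partial>\<mu>) - (\<integral>u. S u * cnj (f u) \<partial>\<mu>) + (\<integral>u. S u * cnj (S u) \<partial>\<mu>)"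
    using integrable_mult_cnj f S by simp
  also have "\<dots> = complex_of_real ((\<integral>u. (cmod (f u))\<^sup>2 \<partial>\<mu>) - (\<Sum>x\<in>I. (cmod (c x))\<^sup>2))"
    unfolding ff fS Sf SS by simp
  finally have "(\<integral>u. (cmod (f u - S u))\<^sup>2 \<partial>\<mu>) = (\<integral>u. (cmod (f u))\<^sup>2 \<partial>\<mu>) - (\<Sum>x\<in>I. (cmod (c x))\<^sup>2)"
    by (simp only: of_real_eq_iff)
  moreover have "(\<integral>u. (cmod (f u - S u))\<^sup>2 \<partial>\<mu>) \<ge> 0" by simp
  ultimately show ?thesis by (simp add: c_def)
qed

text \<open>Pairing \<open>f\<close> with the combination formed by its own coefficients and using
  Cauchy-Schwarz pointwise bounds \<open>A\<close> by \<open>sqrt A * sqrt D\<close> times the L1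
  norm. For the entries of \<open>t k\<close> this gives \<open>D = Suc k\<close>, while estimating
  the coefficients one by one would cost their number \<open>(Suc k)^2\<close>.\<close>

lemma coeff_sum_le_L1:
  assumes D: "\<And>u. (\<Sum>x\<in>I. (cmod (\<phi> x u))\<^sup>2) \<le> D" and f: "bounded_measurable \<mu> f"
  shows "(\<Sum>x\<in>I. (cmod (\<integral>u. f u * cnj (\<phi> x u) \<partial>\<mu>))\<^sup>2) \<le> D * (\<integral>u. cmod (f u) \<partial>\<mu>)\<^sup>2"
proof -
  define c where "c = (\<lambda>x. \<integral>u. f u * cnj (\<phi> x u) \<partial>\<mu>)"
  define A where "A = (\<Sum>x\<in>I. (cmod (c x))\<^sup>2)"
  have A0: "A \<ge> 0" unfolding A_def by (intro sum_nonneg) auto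
  have D0: "D \<ge> 0" using D[of undefined] sum_nonneg[of I "\<lambda>x. (cmod (\<phi> x undefined))\<^sup>2"] by simp
  have fi: "integrable \<mu> (\<lambda>u. cmod (f u))" using bounded_measurable_integrable[OF P f] by simp
  have "complex_of_real A = (\<Sum>x\<in>I. cnj (c x) * c x)"
    unfolding A_def cmod_sum_power2_eq[symmetric] by (simp add: mult.commute)
  also have "\<dots> = (\<integral>u. (\<Sum>x\<in>I. cnj (c x) * (f u * cnj (\<phi> x u))) \<partial>\<mu>)"
    using \<phi> f integrable_mult_cnj by (subst Bochner_Integration.integral_sum) (simp_all add: c_def)
  also have "\<dots> = (\<integral>u. f u * cnj (\<Sum>x\<in>I. c x * \<phi> x u) \<partial>\<mu>)"
    by (simp add: sum_distrib_left mult_ac)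
  finally have *: "complex_of_real A = (\<integral>u. f u * cnj (\<Sum>x\<in>I. c x * \<phi> x u) \<partial>\<mu>)" .
  have "A = cmod (\<integral>u. f u * cnj (\<Sum>x\<in>I. c x * \<phi> x u) \<partial>\<mu>)"
    unfolding *[symmetric] using A0 by simp
  also have "\<dots> \<le> (\<integral>u. cmod (f u) * (sqrt A * sqrt D) \<partial>\<mu>)"
  proof (rule order_trans[OF integral_norm_bound integral_mono'])
    show "integrable \<mu> (\<lambda>u. cmod (f u) * (sqrt A * sqrt D))" using fi by simp
    fix u
    have "cmod (\<Sum>x\<in>I. c x * \<phi> x u) \<le> (\<Sum>x\<in>I. cmod (c x) * cmod (\<phi> x u))"
      by (rule order_trans[OF norm_sum]) (simp add: norm_mult)
    also have "\<dots> = (\<Sum>x\<in>I. \<bar>cmod (c x)\<bar> * \<bar>cmod (\<phi> x u)\<bar>)" by simp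
    also have "\<dots> \<le> L2_set (\<lambda>x. cmod (c x)) I * L2_set (\<lambda>x. cmod (\<phi> x u)) I"
      by (rule L2_set_mult_ineq)
    also have "\<dots> \<le> sqrt A * sqrt D"
      unfolding L2_set_def A_def using D[of u] by (intro mult_mono) (auto intro!: sum_nonneg)
    finally show "norm (f u * cnj (\<Sum>x\<in>I. c x * \<phi> x u)) \<le> cmod (f u) * (sqrt A * sqrt D)"
      unfolding norm_mult complex_mod_cnj by (intro mult_left_mono) auto
    show "0 \<le> cmod (f u) * (sqrt A * sqrt D)" using A0 D0 by simp
  qed
  also have "\<dots> = sqrt A * (sqrt D * (\<integral>u. cmod (f u) \<partial>\<mu>))" by simp
  finally have le: "A \<le> sqrt A * (sqrt D * (\<integral>u. cmod (f u) \<partial>\<mu>))" .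
  have "A \<le> D * (\<integral>u. cmod (f u) \<partial>\<mu>)\<^sup>2"
  proof (cases "A = 0")
    case False
    hence pos: "sqrt A > 0" using A0 by simp
    have "sqrt A * sqrt A \<le> sqrt A * (sqrt D * (\<integral>u. cmod (f u) \<partial>\<mu>))" using le A0 by simp
    hence "sqrt A \<le> sqrt D * (\<integral>u. cmod (f u) \<partial>\<mu>)" using pos by (simp only: mult_le_cancel_left_pos)
    hence "(sqrt A)\<^sup>2 \<le> (sqrt D * (\<integral>u. cmod (f u) \<partial>\<mu>))\<^sup>2" using pos by (intro power_mono) auto
    thus ?thesis using A0 D0 by (simp add: power_mult_distrib)
  qed (use D0 in simp)
  thus ?thesis by (simp add: A_def c_def)
qed

end

section \<open>Homomorphism property, continuity and unitarity of the representations\<close>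

lemma monom_rep_mult: "monom_rep k (u * v) = monom_rep k u * monom_rep k v"
proof (rule eq_matI)
  fix l m assume "l < dim_row (monom_rep k u * monom_rep k v)" "m < dim_col (monom_rep k u * monom_rep k v)"
  hence l: "l < Suc k" and m: "m < Suc k" by (auto simp: monom_rep_def)
  have at: "{..k} = {..<Suc k}" by auto
  let ?E = "\<lambda>u i m. hom_monom_coeff k m i (Rep_su2 u)"
  have "monom_rep k (u * v) $$ (l, m) = (\<Sum>i\<le>k. ?E u l i * ?E v i m)"
  proof (rule monom_rep_entry)
    fix z
    have m': "m \<le> k" using m by simp
    have "hom_monom k m (z v* Rep_su2 (u * v)) = hom_monom k m ((z v* Rep_su2 u) v* Rep_su2 v)"
      by (simp add: Rep_su2_mult vector_matrix_mul_assoc)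
    also have "\<dots> = (\<Sum>i\<le>k. ?E v i m * (\<Sum>l\<le>k. ?E u l i * hom_monom k l z))"
      unfolding hom_monom_expand[OF m'] by (intro sum.cong refl) (simp only: hom_monom_expand atMost_iff)
    also have "\<dots> = (\<Sum>l\<le>k. (\<Sum>i\<le>k. ?E u l i * ?E v i m) * hom_monom k l z)"
      unfolding sum_distrib_right sum_distrib_left by (subst sum.swap) (simp only: mult_ac)
    finally show "hom_monom k m (z v* Rep_su2 (u * v)) = (\<Sum>l\<le>k. (\<Sum>i\<le>k. ?E u l i * ?E v i m) * hom_monom k l z)" .
  qed (use l m in auto)
  also have "\<dots> = (monom_rep k u * monom_rep k v) $$ (l, m)"
    unfolding mat_mult_entry[OF monom_rep_carrier monom_rep_carrier l m] at
    using l m by (intro sum.cong refl) (simp add: monom_rep_def)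
  finally show "monom_rep k (u * v) $$ (l, m) = (monom_rep k u * monom_rep k v) $$ (l, m)" .
qed (auto simp: monom_rep_def)

lemma monom_rep_one: "monom_rep k 1 = 1\<^sub>m (Suc k)"
  by (rule eq_matI) (auto simp: monom_rep_diag Rep_su2_one Finite_Cartesian_Product.mat_def less_Suc_eq_le monom_rep_carrier[THEN carrier_matD(1)] monom_rep_carrier[THEN carrier_matD(2)])

lemma continuous_on_hom_monom_coeff:
  assumes "continuous_on S f"
  shows "continuous_on S (\<lambda>x. hom_monom_coeff k m i (f x))"
  unfolding hom_monom_coeff_def split_beta by (intro continuous_intros assms)

locale su2_dual =
  fixes \<mu> :: "su2 measure" and t :: "nat \<Rightarrow> su2 \<Rightarrow> complex mat"
  assumes haar: "normalized_haar \<mu>" and rep: "\<And>k. unitary_matrix_rep k (t k)"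
begin

lemma t_carrier [simp]: "t k u \<in> carrier_mat (Suc k) (Suc k)"
  using rep[of k] unfolding unitary_matrix_rep_def by blast

lemma t_dim [simp]: "dim_row (t k u) = Suc k" "dim_col (t k u) = Suc k"
  by (rule carrier_matD[OF t_carrier])+

lemma t_mult: "t k (u * v) = t k u * t k v"
proof -
  obtain B C where BC: "B \<in> carrier_mat (Suc k) (Suc k)" "C \<in> carrier_mat (Suc k) (Suc k)"
    "B * C = 1\<^sub>m (Suc k)" "C * B = 1\<^sub>m (Suc k)" "\<And>u. t k u = C * monom_rep k u * B"
    using unitary_matrix_rep_conj[OF rep] by metis
  note c = mult_carrier_mat[of _ "Suc k" "Suc k" _ "Suc k"] monom_rep_carrier[of k]
  note a = assoc_mult_mat[of _ "Suc k" "Suc k" _ "Suc k" _ "Suc k"]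
  have "t k u * t k v = C * (monom_rep k u * ((B * C) * (monom_rep k v * B)))"
    unfolding BC(5) using BC(1,2) by (simp add: c a)
  also have "(B * C) * (monom_rep k v * B) = monom_rep k v * B"
    unfolding BC(3) by (rule left_mult_one_mat[OF mult_carrier_mat[OF monom_rep_carrier BC(1)]])
  also have "C * (monom_rep k u * (monom_rep k v * B)) = t k (u * v)"
    unfolding BC(5) monom_rep_mult using BC(1,2) by (simp add: c a)
  finally show ?thesis ..
qed

lemma t_one: "t k 1 = 1\<^sub>m (Suc k)"
proof -
  obtain B C where BC: "B \<in> carrier_mat (Suc k) (Suc k)" "C \<in> carrier_mat (Suc k) (Suc k)"
    "B * C = 1\<^sub>m (Suc k)" "C * B = 1\<^sub>m (Suc k)" "\<And>u. t k u = C * monom_rep k u * B"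
    using unitary_matrix_rep_conj[OF rep] by metis
  thus ?thesis by (simp add: monom_rep_one)
qed

text \<open>The coefficients \<open>B\<close> and \<open>C\<close> do not depend on
  \<open>u\<close>, so the entries of \<open>t k\<close> inherit continuity, and differentiability
  along one-parameter subgroups, from polynomials in the entries of \<open>u\<close>.\<close>

lemma t_entry_formula:
  "\<exists>B C. \<forall>u. \<forall>i<Suc k. \<forall>j<Suc k.
       t k u $$ (i, j) = (\<Sum>m<Suc k. (\<Sum>l<Suc k. C i l * hom_monom_coeff k m l (Rep_su2 u)) * B m j)"
proof -
  obtain B C where BC: "B \<in> carrier_mat (Suc k) (Suc k)" "C \<in> carrier_mat (Suc k) (Suc k)"
    "B * C = 1\<^sub>m (Suc k)" "C * B = 1\<^sub>m (Suc k)" "\<And>u. t k u = C * monom_rep k u * B"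
    using unitary_matrix_rep_conj[OF rep] by metis
  have *: "t k u $$ (i, j) = (\<Sum>m<Suc k. (\<Sum>l<Suc k. C $$ (i, l) * hom_monom_coeff k m l (Rep_su2 u)) * B $$ (m, j))"
    if ij: "i < Suc k" "j < Suc k" for u i j
  proof -
    have "t k u $$ (i, j) = (\<Sum>m<Suc k. (C * monom_rep k u) $$ (i, m) * B $$ (m, j))"
      unfolding BC(5) using ij BC by (intro mat_mult_entry[where n = "Suc k" and l = "Suc k"] mult_carrier_mat[OF BC(2) monom_rep_carrier])
    also have "\<dots> = (\<Sum>m<Suc k. (\<Sum>l<Suc k. C $$ (i, l) * hom_monom_coeff k m l (Rep_su2 u)) * B $$ (m, j))"
    proof (rule sum.cong[OF refl])
      fix m assume "m \<in> {..<Suc k}"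
      hence m: "m < Suc k" by simp
      have "(C * monom_rep k u) $$ (i, m) = (\<Sum>l<Suc k. C $$ (i, l) * hom_monom_coeff k m l (Rep_su2 u))"
        unfolding mat_mult_entry[OF BC(2) monom_rep_carrier ij(1) m]
        using m by (intro sum.cong refl) (simp add: monom_rep_def)
      thus "(C * monom_rep k u) $$ (i, m) * B $$ (m, j) = (\<Sum>l<Suc k. C $$ (i, l) * hom_monom_coeff k m l (Rep_su2 u)) * B $$ (m, j)"
        by simp
    qed
    finally show ?thesis .
  qed
  show ?thesis
    by (rule exI[of _ "\<lambda>m j. B $$ (m, j)"], rule exI[of _ "\<lambda>i l. C $$ (i, l)"], intro allI impI, rule *)
qed

text \<open>Reduces characters to the monomial basis, on which diagonal group elements act
  diagonally.\<close>

lemma t_trace: "(\<Sum>i<Suc k. t k u $$ (i, i)) = (\<Sum>i<Suc k. monom_rep k u $$ (i, i))"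
proof -
  obtain B C where BC: "B \<in> carrier_mat (Suc k) (Suc k)" "C \<in> carrier_mat (Suc k) (Suc k)"
    "B * C = 1\<^sub>m (Suc k)" "C * B = 1\<^sub>m (Suc k)" "\<And>u. t k u = C * monom_rep k u * B"
    using unitary_matrix_rep_conj[OF rep] by metis
  have EB: "monom_rep k u * B \<in> carrier_mat (Suc k) (Suc k)" using BC by (intro mult_carrier_mat[OF monom_rep_carrier])
  have tr: "(\<Sum>i<Suc k. (X * Y) $$ (i, i)) = (\<Sum>i<Suc k. (Y * X) $$ (i, i))"
    if X: "X \<in> carrier_mat (Suc k) (Suc k)" and Y: "Y \<in> carrier_mat (Suc k) (Suc k)" for X Y :: "complex mat"
  proof -
    have "(\<Sum>i<Suc k. (X * Y) $$ (i, i)) = (\<Sum>i<Suc k. \<Sum>j<Suc k. X $$ (i, j) * Y $$ (j, i))"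
      by (intro sum.cong refl mat_mult_entry[OF X Y]) auto
    also have "\<dots> = (\<Sum>j<Suc k. \<Sum>i<Suc k. Y $$ (j, i) * X $$ (i, j))"
      by (subst sum.swap) (simp only: mult.commute)
    also have "\<dots> = (\<Sum>i<Suc k. (Y * X) $$ (i, i))"
      by (intro sum.cong refl mat_mult_entry[OF Y X, symmetric]) auto
    finally show ?thesis .
  qed
  have "t k u = C * (monom_rep k u * B)"
    unfolding BC(5) by (rule assoc_mult_mat[OF BC(2) monom_rep_carrier BC(1)])
  hence "(\<Sum>i<Suc k. t k u $$ (i, i)) = (\<Sum>i<Suc k. ((monom_rep k u * B) * C) $$ (i, i))"
    using tr[OF BC(2) EB] by simp
  also have "(monom_rep k u * B) * C = monom_rep k u * (B * C)"
    by (rule assoc_mult_mat[OF monom_rep_carrier BC(1,2)])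
  finally show ?thesis unfolding BC(3) by (simp only: right_mult_one_mat[OF monom_rep_carrier])
qed

lemma t_continuous:
  assumes "i < Suc k" "j < Suc k" "continuous_on S f"
  shows "continuous_on S (\<lambda>x. t k (f x) $$ (i, j))"
proof -
  obtain B C where BC: "\<forall>u. \<forall>i<Suc k. \<forall>j<Suc k.
       t k u $$ (i, j) = (\<Sum>m<Suc k. (\<Sum>l<Suc k. C i l * hom_monom_coeff k m l (Rep_su2 u)) * B m j)"
    using t_entry_formula[of k] by (elim exE) (rule that)
  have "t k u $$ (i, j) = (\<Sum>m<Suc k. (\<Sum>l<Suc k. C i l * hom_monom_coeff k m l (Rep_su2 u)) * B m j)" for u
    by (rule BC[rule_format, OF assms(1,2)])
  thus ?thesis
    by (simp only:) (intro continuous_intros continuous_on_hom_monom_coeff assms)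
qed

lemma t_adjoint_carrier [simp]: "mat_adjoint (t k u) \<in> carrier_mat (Suc k) (Suc k)"
  by (rule carrier_matI) (simp_all add: mat_adjoint_def)

lemma t_adjoint_left: "mat_adjoint (t k u) * t k u = 1\<^sub>m (Suc k)"
  using rep[of k] unfolding unitary_matrix_rep_def by blast

lemma t_adjoint_right: "t k u * mat_adjoint (t k u) = 1\<^sub>m (Suc k)"
  by (rule mat_mult_left_right_inverse[OF t_adjoint_carrier t_carrier t_adjoint_left])

lemma t_adjoint_index: "i < Suc k \<Longrightarrow> j < Suc k \<Longrightarrow> mat_adjoint (t k u) $$ (i, j) = cnj (t k u $$ (j, i))"
  by (rule mat_adjoint_index[OF t_carrier])

lemma t_inverse: "t k (inverse u) = mat_adjoint (t k u)"
proof -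
  have "t k (inverse u) = t k (inverse u) * (t k u * mat_adjoint (t k u))"
    by (simp add: t_adjoint_right)
  also have "\<dots> = (t k (inverse u) * t k u) * mat_adjoint (t k u)"
    by (rule assoc_mult_mat[symmetric, OF t_carrier t_carrier t_adjoint_carrier])
  also have "\<dots> = mat_adjoint (t k u)"
    unfolding t_mult[symmetric] su2_left_inverse t_one by (rule left_mult_one_mat[OF t_adjoint_carrier])
  finally show ?thesis .
qed

lemma t_mult_index:
  assumes "i < Suc k" "j < Suc k"
  shows "t k (u * v) $$ (i, j) = (\<Sum>m<Suc k. t k u $$ (i, m) * t k v $$ (m, j))"
  unfolding t_mult by (rule mat_mult_entry[OF t_carrier t_carrier assms])

lemma t_column_orth:
  assumes "a < Suc k" "b < Suc k"
  shows "(\<Sum>i<Suc k. cnj (t k u $$ (i, a)) * t k u $$ (i, b)) = (if a = b then 1 else 0)"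
proof -
  have "(\<Sum>i<Suc k. cnj (t k u $$ (i, a)) * t k u $$ (i, b)) = (mat_adjoint (t k u) * t k u) $$ (a, b)"
    unfolding mat_mult_entry[OF t_adjoint_carrier t_carrier assms]
    using assms by (intro sum.cong refl) (simp add: t_adjoint_index)
  thus ?thesis using assms by (simp add: t_adjoint_left)
qed

lemma t_hs: "(\<Sum>j<Suc k. \<Sum>i<Suc k. (cmod (t k u $$ (i, j)))\<^sup>2) = real (Suc k)"
proof -
  have "(\<Sum>i<Suc k. (cmod (t k u $$ (i, j)))\<^sup>2) = 1" if "j < Suc k" for j
  proof -
    have "complex_of_real (\<Sum>i<Suc k. (cmod (t k u $$ (i, j)))\<^sup>2) = (\<Sum>i<Suc k. cnj (t k u $$ (i, j)) * t k u $$ (i, j))"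
      unfolding cmod_sum_power2_eq[symmetric] by (simp only: mult.commute)
    also have "\<dots> = 1" using t_column_orth[OF that that] by simp
    finally show ?thesis by (simp only: of_real_eq_1_iff)
  qed
  thus ?thesis by (simp del: sum.lessThan_Suc)
qed

lemma cont_bm: "continuous_on UNIV f \<Longrightarrow> bounded_measurable \<mu> f"
  unfolding bounded_measurable_def using continuous_bounded_measurable[OF haar] by blast

lemma t_bm: "i < Suc k \<Longrightarrow> j < Suc k \<Longrightarrow> bounded_measurable \<mu> (\<lambda>u. t k u $$ (i, j))"
  by (intro cont_bm t_continuous continuous_on_id)

lemma haar_prob': "prob_space \<mu>" using haar_prob[OF haar] .

text \<open>The Haar average of \<open>t k u * E * mat_adjoint (t l u)\<close>, where
  \<open>E\<close> is the matrix unit at position \<open>(a, b)\<close>.\<close>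

definition coeff_pairing :: "nat \<Rightarrow> nat \<Rightarrow> nat \<Rightarrow> nat \<Rightarrow> complex mat" where
  "coeff_pairing k l a b = Matrix.mat (Suc k) (Suc l)
     (\<lambda>(i, j). \<integral>u. t k u $$ (i, a) * cnj (t l u $$ (j, b)) \<partial>\<mu>)"

lemma coeff_pairing_carrier [simp]: "coeff_pairing k l a b \<in> carrier_mat (Suc k) (Suc l)"
  by (simp add: coeff_pairing_def)

text \<open>Substituting \<open>g * u\<close> in the integral pulls \<open>t k g\<close> out on the
  left and the adjoint of \<open>t l g\<close> on the right; unitarity moves the latter
  across.\<close>

lemma coeff_pairing_intertwines:
  assumes a: "a < Suc k" and b: "b < Suc l"
  shows "coeff_pairing k l a b * t l g = t k g * coeff_pairing k l a b"
proof -
  let ?X = "coeff_pairing k l a b"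
  have "?X = t k g * (?X * mat_adjoint (t l g))"
  proof (rule eq_matI)
    fix i j assume "i < dim_row (t k g * (?X * mat_adjoint (t l g)))" "j < dim_col (t k g * (?X * mat_adjoint (t l g)))"
    hence i: "i < Suc k" and j: "j < Suc l" by (auto simp: mat_adjoint_def)
    let ?F = "\<lambda>i j u. t k u $$ (i, a) * cnj (t l u $$ (j, b))"
    have F: "integrable \<mu> (?F i j)" if "i < Suc k" "j < Suc l" for i j
      using that a b by (intro bounded_measurable_integrable[OF haar_prob'] bounded_measurable_mult bounded_measurable_cnj t_bm)
    have Fm: "?F i j \<in> borel_measurable borel"
      using i j a b by (intro borel_measurable_continuous_onI continuous_intros t_continuous)
    have "?X $$ (i, j) = (\<integral>u. ?F i j (g * u) \<partial>\<mu>)"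
      using i j haar_left[OF haar Fm, of g] by (simp add: coeff_pairing_def)
    also have "\<dots> = (\<integral>u. (\<Sum>x<Suc k. \<Sum>y<Suc l. (t k g $$ (i, x) * cnj (t l g $$ (j, y))) * ?F x y u) \<partial>\<mu>)"
      unfolding t_mult_index[OF i a] t_mult_index[OF j b] cnj_sum sum_product
      by (intro Bochner_Integration.integral_cong refl sum.cong) (simp only: complex_cnj_mult mult_ac)
    also have "\<dots> = (\<Sum>x<Suc k. \<Sum>y<Suc l. (t k g $$ (i, x) * cnj (t l g $$ (j, y))) * (\<integral>u. ?F x y u \<partial>\<mu>))"
    proof -
      have int: "integrable \<mu> (\<lambda>u. (t k g $$ (i, x) * cnj (t l g $$ (j, y))) * ?F x y u)"
        if "x \<in> {..<Suc k}" "y \<in> {..<Suc l}" for x y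
        using that F[of x y] by (intro integrable_mult_right) auto
      have "(\<integral>u. (\<Sum>x<Suc k. \<Sum>y<Suc l. (t k g $$ (i, x) * cnj (t l g $$ (j, y))) * ?F x y u) \<partial>\<mu>)
        = (\<Sum>x<Suc k. \<integral>u. (\<Sum>y<Suc l. (t k g $$ (i, x) * cnj (t l g $$ (j, y))) * ?F x y u) \<partial>\<mu>)"
        using int by (intro Bochner_Integration.integral_sum Bochner_Integration.integrable_sum)
      also have "\<dots> = (\<Sum>x<Suc k. \<Sum>y<Suc l. \<integral>u. (t k g $$ (i, x) * cnj (t l g $$ (j, y))) * ?F x y u \<partial>\<mu>)"
        using int by (intro sum.cong refl Bochner_Integration.integral_sum)
      finally show ?thesis by (simp only: integral_mult_right_zero)
    qed
    also have "\<dots> = (\<Sum>x<Suc k. t k g $$ (i, x) * (\<Sum>y<Suc l. ?X $$ (x, y) * mat_adjoint (t l g) $$ (y, j)))"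
      unfolding sum_distrib_left using j
      by (intro sum.cong refl) (simp add: coeff_pairing_def t_adjoint_index mult_ac)
    also have "\<dots> = (t k g * (?X * mat_adjoint (t l g))) $$ (i, j)"
      unfolding mat_mult_entry[OF t_carrier mult_carrier_mat[OF coeff_pairing_carrier t_adjoint_carrier] i j]
      using j by (intro sum.cong refl) (simp add: mat_mult_entry[OF coeff_pairing_carrier t_adjoint_carrier] del: sum.lessThan_Suc)
    finally show "?X $$ (i, j) = (t k g * (?X * mat_adjoint (t l g))) $$ (i, j)" .
  qed (auto simp: mat_adjoint_def coeff_pairing_def)
  hence "?X * t l g = (t k g * (?X * mat_adjoint (t l g))) * t l g" by simp
  also have "\<dots> = t k g * ((?X * mat_adjoint (t l g)) * t l g)"
    by (rule assoc_mult_mat[OF t_carrier mult_carrier_mat[OF coeff_pairing_carrier t_adjoint_carrier] t_carrier])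
  also have "(?X * mat_adjoint (t l g)) * t l g = ?X * (mat_adjoint (t l g) * t l g)"
    by (rule assoc_mult_mat[OF coeff_pairing_carrier t_adjoint_carrier t_carrier])
  also have "\<dots> = ?X" unfolding t_adjoint_left by (rule right_mult_one_mat[OF coeff_pairing_carrier])
  finally show ?thesis .
qed

theorem schur_orthogonality:
  assumes "i < Suc k" "a < Suc k" "j < Suc l" "b < Suc l"
  shows "(\<integral>u. t k u $$ (i, a) * cnj (t l u $$ (j, b)) \<partial>\<mu>)
     = (if k = l \<and> i = j \<and> a = b then 1 / of_nat (Suc k) else 0)"
proof -
  have less: "(\<integral>u. t k u $$ (i, a) * cnj (t l u $$ (j, b)) \<partial>\<mu>) = 0"
    if "l < k" "i < Suc k" "a < Suc k" "j < Suc l" "b < Suc l" for k l i a j b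
  proof -
    have "coeff_pairing k l a b = 0\<^sub>m (Suc k) (Suc l)"
      using unitary_rep_schur(1)[OF rep rep coeff_pairing_carrier coeff_pairing_intertwines] that by blast
    from arg_cong[OF this, of "\<lambda>M. M $$ (i, j)"] that show ?thesis by (simp add: coeff_pairing_def)
  qed
  consider "l < k" | "k < l" | "k = l" by linarith
  thus ?thesis
  proof cases
    case 1
    thus ?thesis using less assms by simp
  next
    case 2
    \<comment> \<open>Schur's lemma is available for \<open>l < k\<close> only; complex conjugation
      exchanges the two representations.\<close>
    have "(\<integral>u. t k u $$ (i, a) * cnj (t l u $$ (j, b)) \<partial>\<mu>) = (\<integral>u. cnj (t l u $$ (j, b) * cnj (t k u $$ (i, a))) \<partial>\<mu>)"
      by (simp add: mult.commute)
    also have "\<dots> = cnj (\<integral>u. t l u $$ (j, b) * cnj (t k u $$ (i, a)) \<partial>\<mu>)"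
      by (rule Bochner_Integration.integral_cnj)
    finally show ?thesis using 2 less[OF 2 assms(3,4,1,2)] by simp
  next
    case 3
    have b: "b < Suc k" and j: "j < Suc k" using assms 3 by auto
    obtain c where c: "coeff_pairing k k a b = c \<cdot>\<^sub>m 1\<^sub>m (Suc k)"
      using unitary_rep_schur(2)[OF rep rep coeff_pairing_carrier coeff_pairing_intertwines] assms(2) b by blast
    have e: "(\<integral>u. t k u $$ (i, a) * cnj (t k u $$ (j, b)) \<partial>\<mu>) = (if i = j then c else 0)"
      if "i < Suc k" "j < Suc k" for i j
      using arg_cong[OF c, of "\<lambda>M. M $$ (i, j)"] that by (simp add: coeff_pairing_def)
    \<comment> \<open>The scalar is found from the trace: summed over \<open>i\<close>, the
      integrand is an inner product of two columns of a unitary matrix and hence constant.\<close>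
    have "of_nat (Suc k) * c = (\<Sum>i<Suc k. \<integral>u. t k u $$ (i, a) * cnj (t k u $$ (i, b)) \<partial>\<mu>)"
      using e by (simp del: sum.lessThan_Suc)
    also have "\<dots> = (\<integral>u. (\<Sum>i<Suc k. t k u $$ (i, a) * cnj (t k u $$ (i, b))) \<partial>\<mu>)"
      using assms b by (intro Bochner_Integration.integral_sum[symmetric] bounded_measurable_integrable[OF haar_prob'] bounded_measurable_mult bounded_measurable_cnj t_bm) auto
    also have "\<dots> = (\<integral>u. (if a = b then 1 else 0) \<partial>\<mu>)"
      using t_column_orth[OF b assms(2)] by (simp only: mult.commute eq_commute[of a b])
    also have "\<dots> = (if a = b then 1 else 0)"
      using prob_space.prob_space[OF haar_prob'] haar_space[OF haar] by simp
    finally have "c = (if a = b then 1 / of_nat (Suc k) else 0)"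
      by (auto simp: field_simps simp del: of_nat_Suc)
    thus ?thesis using e[OF assms(1) j] 3 by auto
  qed
qed

end

section \<open>Fourier energies and multipliers\<close>

declare sum.lessThan_Suc [simp del] sum.atMost_Suc [simp del]

lemma duality_bound:
  assumes P: "prob_space \<mu>" and G: "bounded_measurable \<mu> G" and q: "2 \<le> q" and B: "0 \<le> B"
    and dual: "\<And>h. bounded_measurable \<mu> h \<Longrightarrow>
      cmod (\<integral>u. G u * cnj (h u) \<partial>\<mu>) \<le> B * (\<integral>u. cmod (h u) powr (q / (q - 1)) \<partial>\<mu>) powr (1 - 1 / q)"
  shows "(\<integral>u. cmod (G u) powr q \<partial>\<mu>) powr (1 / q) \<le> B"
proof -
  obtain D where D: "G \<in> borel_measurable \<mu>" "\<And>x. cmod (G x) \<le> D" "D > 0"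
    using bounded_measurableE[OF G] by blast
  note [measurable] = D(1)
  define N where "N = (\<integral>u. cmod (G u) powr q \<partial>\<mu>)"
  \<comment> \<open>The extremal function of Hoelder's inequality: its pairing with \<open>G\<close>
    is \<open>N\<close>, and its dual norm is \<open>N powr (1 - 1 / q)\<close>. Boundedness of
    \<open>G\<close> ensures that \<open>h\<close> is admissible and that \<open>N\<close> is a
    genuine integral, so that its power can be cancelled.\<close>
  define h where "h = (\<lambda>u. complex_of_real (cmod (G u) powr (q - 2)) * G u)"
  have N0: "N \<ge> 0" unfolding N_def by simp
  have h: "bounded_measurable \<mu> h"
    unfolding bounded_measurable_def
  proof (intro conjI exI allI)
    show "h \<in> borel_measurable \<mu>" unfolding h_def by measurable
    fix u
    show "cmod (h u) \<le> D powr (q - 2) * D"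
      unfolding h_def norm_mult using D q by (intro mult_mono) (auto intro!: powr_mono2)
  qed
  have hq: "cmod (h u) powr (q / (q - 1)) = cmod (G u) powr q" for u
  proof (cases "G u = 0")
    case False
    hence "cmod (h u) = cmod (G u) powr (q - 2) * cmod (G u) powr 1" by (simp add: h_def norm_mult)
    also have "\<dots> = cmod (G u) powr (q - 1)" by (simp only: powr_add[symmetric]) simp
    finally show ?thesis using q by (simp add: powr_powr)
  qed (simp add: h_def)
  have "G u * cnj (h u) = complex_of_real (cmod (G u) powr q)" for u
  proof (cases "G u = 0")
    case False
    have "G u * cnj (h u) = complex_of_real (cmod (G u) powr (q - 2)) * (G u * cnj (G u))"
      by (simp add: h_def)
    also have "\<dots> = complex_of_real (cmod (G u) powr (q - 2) * (cmod (G u))\<^sup>2)"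
      by (simp only: complex_norm_square[symmetric] of_real_mult)
    also have "(cmod (G u))\<^sup>2 = cmod (G u) powr 2" using False by (simp add: powr_numeral)
    also have "cmod (G u) powr (q - 2) * cmod (G u) powr 2 = cmod (G u) powr q"
      by (simp only: powr_add[symmetric]) simp
    finally show ?thesis .
  qed simp
  hence "(\<integral>u. G u * cnj (h u) \<partial>\<mu>) = complex_of_real N"
    by (simp add: N_def)
  with dual[OF h] N0 have le: "N \<le> B * N powr (1 - 1 / q)" unfolding hq by (simp add: N_def)
  show ?thesis
  proof (cases "N = 0")
    case False
    hence pos: "N > 0" using N0 by simp
    have "N powr (1 / q) * N powr (1 - 1 / q) = N"
      using pos by (simp only: powr_add[symmetric]) simp
    hence "N powr (1 / q) * N powr (1 - 1 / q) \<le> B * N powr (1 - 1 / q)" using le by simp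
    hence "N powr (1 / q) \<le> B" using pos by (simp add: mult_le_cancel_right)
    thus ?thesis by (simp add: N_def)
  qed (use B N_def in auto)
qed

lemma paley_const_ge: "1 < p \<Longrightarrow> p \<le> 2 \<Longrightarrow> 2 \<le> paley_const p"
  by (auto simp: paley_const_def field_simps)

lemma cmod_add_power2_le: "(cmod (x + y))\<^sup>2 \<le> 2 * (cmod x)\<^sup>2 + 2 * (cmod y)\<^sup>2"
proof -
  have "(cmod (x + y))\<^sup>2 \<le> (cmod x + cmod y)\<^sup>2" by (intro power_mono norm_triangle_ineq) auto
  also have "\<dots> \<le> 2 * (cmod x)\<^sup>2 + 2 * (cmod y)\<^sup>2"
    using zero_le_power2[of "cmod x - cmod y"] by (simp add: power2_eq_square algebra_simps)
  finally show ?thesis .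
qed

context su2_dual
begin

text \<open>The indices of \<open>t\<close> are swapped because the Fourier coefficient is formed
  with the adjoint. As a plain function of indices it needs no carrier conditions.\<close>

definition coef :: "(su2 \<Rightarrow> complex) \<Rightarrow> nat \<Rightarrow> nat \<Rightarrow> nat \<Rightarrow> complex" where
  "coef f k i j = (\<integral>u. f u * cnj (t k u $$ (j, i)) \<partial>\<mu>)"

lemma fourier_index: "i < Suc k \<Longrightarrow> j < Suc k \<Longrightarrow> fourier \<mu> t f k $$ (i, j) = coef f k i j"
  by (simp add: fourier_def coef_def t_adjoint_index)

definition hs2 :: "nat \<Rightarrow> (nat \<Rightarrow> nat \<Rightarrow> complex) \<Rightarrow> real" where
  "hs2 k S = (\<Sum>i<Suc k. \<Sum>j<Suc k. (cmod (S i j))\<^sup>2)"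

lemma hs2_nonneg [simp]: "0 \<le> hs2 k S"
  unfolding hs2_def by (intro sum_nonneg) auto

definition energy :: "nat \<Rightarrow> (su2 \<Rightarrow> complex) \<Rightarrow> real" where
  "energy k f = real (Suc k) * hs2 k (coef f k)"

lemma energy_nonneg [simp]: "0 \<le> energy k f"
  by (simp add: energy_def)

definition coef_index :: "nat set \<Rightarrow> (nat \<times> nat \<times> nat) set" where
  "coef_index K = Sigma K (\<lambda>k. {..<Suc k} \<times> {..<Suc k})"

text \<open>Schur orthogonality makes this the normalized system. The swap of indices lets the
  element \<open>(k, i, j)\<close> pair with \<open>f\<close> to a multiple of
  \<open>coef f k i j\<close>.\<close>

definition coef_fun :: "nat \<times> nat \<times> nat \<Rightarrow> su2 \<Rightarrow> complex" where
  "coef_fun = (\<lambda>(k, i, j) u. complex_of_real (sqrt (real (Suc k))) * t k u $$ (j, i))"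

lemma finite_coef_index: "finite K \<Longrightarrow> finite (coef_index K)"
  unfolding coef_index_def by (intro finite_SigmaI) auto

lemma sum_coef_index:
  "finite K \<Longrightarrow> (\<Sum>x\<in>coef_index K. F x) = (\<Sum>k\<in>K. \<Sum>i<Suc k. \<Sum>j<Suc k. F (k, i, j))"
proof -
  assume K: "finite K"
  have "(\<Sum>k\<in>K. \<Sum>i<Suc k. \<Sum>j<Suc k. F (k, i, j)) = (\<Sum>k\<in>K. \<Sum>y\<in>{..<Suc k} \<times> {..<Suc k}. F (k, y))"
    by (simp add: sum.cartesian_product split_beta)
  also have "\<dots> = (\<Sum>x\<in>coef_index K. F x)"
    unfolding coef_index_def using K by (subst sum.Sigma) (auto simp: split_beta)
  finally show ?thesis ..
qed

lemma coef_fun_bm: "x \<in> coef_index K \<Longrightarrow> bounded_measurable \<mu> (coef_fun x)"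
  unfolding coef_index_def coef_fun_def
  by (auto intro!: bounded_measurable_mult bounded_measurable_const t_bm simp del: of_nat_Suc)

lemma coef_fun_orth:
  assumes "x \<in> coef_index K" "y \<in> coef_index K"
  shows "(\<integral>u. coef_fun x u * cnj (coef_fun y u) \<partial>\<mu>) = (if x = y then 1 else 0)"
proof -
  obtain k i j where x: "x = (k, i, j)" "i < Suc k" "j < Suc k"
    using assms(1) by (auto simp: coef_index_def)
  obtain l a b where y: "y = (l, a, b)" "a < Suc l" "b < Suc l"
    using assms(2) by (auto simp: coef_index_def)
  let ?c = "complex_of_real (sqrt (real (Suc k))) * complex_of_real (sqrt (real (Suc l)))"
  have "(\<integral>u. coef_fun x u * cnj (coef_fun y u) \<partial>\<mu>) = (\<integral>u. ?c * (t k u $$ (j, i) * cnj (t l u $$ (b, a))) \<partial>\<mu>)"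
    by (intro Bochner_Integration.integral_cong refl) (simp add: x y coef_fun_def mult_ac del: of_nat_Suc)
  also have "\<dots> = ?c * (\<integral>u. t k u $$ (j, i) * cnj (t l u $$ (b, a)) \<partial>\<mu>)"
    by (rule integral_mult_right_zero)
  also have "\<dots> = ?c * (if k = l \<and> j = b \<and> i = a then 1 / of_nat (Suc k) else 0)"
    using x y by (simp only: schur_orthogonality)
  also have "\<dots> = (if x = y then 1 else 0)"
  proof (cases "x = y")
    case True
    have "complex_of_real (sqrt (real (Suc k))) * complex_of_real (sqrt (real (Suc k))) = of_nat (Suc k)"
      by (simp only: of_real_mult[symmetric] real_sqrt_mult_self) simp
    thus ?thesis using True x y by (simp del: of_nat_Suc)
  qed (use x y in auto)
  finally show ?thesis .
qed

lemma coef_fun_pairing: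
  "(\<integral>u. f u * cnj (coef_fun (k, i, j) u) \<partial>\<mu>) = complex_of_real (sqrt (real (Suc k))) * coef f k i j"
proof -
  have "(\<integral>u. f u * cnj (coef_fun (k, i, j) u) \<partial>\<mu>)
     = (\<integral>u. complex_of_real (sqrt (real (Suc k))) * (f u * cnj (t k u $$ (j, i))) \<partial>\<mu>)"
    by (intro Bochner_Integration.integral_cong refl) (simp add: coef_fun_def mult_ac del: of_nat_Suc)
  thus ?thesis by (simp only: coef_def integral_mult_right_zero)
qed

lemma sqrt_Suc_scale:
  "(cmod (complex_of_real (sqrt (real (Suc k))) * z))\<^sup>2 = real (Suc k) * (cmod z)\<^sup>2"
  by (simp add: norm_mult power_mult_distrib del: of_nat_Suc)

lemma energy_bessel:
  assumes K: "finite K" and f: "bounded_measurable \<mu> f"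
  shows "(\<Sum>k\<in>K. energy k f) \<le> (\<integral>u. (cmod (f u))\<^sup>2 \<partial>\<mu>)"
proof -
  have "(\<Sum>x\<in>coef_index K. (cmod (\<integral>u. f u * cnj (coef_fun x u) \<partial>\<mu>))\<^sup>2) \<le> (\<integral>u. (cmod (f u))\<^sup>2 \<partial>\<mu>)"
    by (rule bessel_finite[OF haar_prob' finite_coef_index[OF K] coef_fun_bm coef_fun_orth f])
  thus ?thesis
    unfolding sum_coef_index[OF K] coef_fun_pairing sqrt_Suc_scale energy_def hs2_def sum_distrib_left .
qed

text \<open>One factor \<open>Suc k\<close> is the squared Hilbert-Schmidt norm of a unitary matrix,
  the other is the weight in \<open>energy\<close>. Their product is the mass of degree
  \<open>k\<close> in Paley's inequality, and from there the weight in the theorem.\<close>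

lemma energy_le_L1:
  assumes f: "bounded_measurable \<mu> f"
  shows "energy k f \<le> (real (Suc k))\<^sup>2 * (\<integral>u. cmod (f u) \<partial>\<mu>)\<^sup>2"
proof -
  let ?I = "{..<Suc k} \<times> {..<Suc k}"
  have "(\<Sum>x\<in>?I. (cmod (\<integral>u. f u * cnj (t k u $$ (snd x, fst x)) \<partial>\<mu>))\<^sup>2)
      \<le> real (Suc k) * (\<integral>u. cmod (f u) \<partial>\<mu>)\<^sup>2"
  proof (rule coeff_sum_le_L1[OF haar_prob' _ _ _ f])
    fix u
    have "(\<Sum>x\<in>?I. (cmod (t k u $$ (snd x, fst x)))\<^sup>2) = (\<Sum>j<Suc k. \<Sum>i<Suc k. (cmod (t k u $$ (i, j)))\<^sup>2)"
      by (simp add: sum.cartesian_product split_beta)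
    thus "(\<Sum>x\<in>?I. (cmod (t k u $$ (snd x, fst x)))\<^sup>2) \<le> real (Suc k)" unfolding t_hs by simp
  qed (auto intro!: t_bm)
  hence "hs2 k (coef f k) \<le> real (Suc k) * (\<integral>u. cmod (f u) \<partial>\<mu>)\<^sup>2"
    by (simp add: hs2_def coef_def sum.cartesian_product split_beta)
  hence "real (Suc k) * hs2 k (coef f k) \<le> real (Suc k) * (real (Suc k) * (\<integral>u. cmod (f u) \<partial>\<mu>)\<^sup>2)"
    by (intro mult_left_mono) auto
  thus ?thesis by (simp only: energy_def power2_eq_square[of "real (Suc k)"] mult.assoc)
qed

lemma coef_add:
  assumes "bounded_measurable \<mu> f" "bounded_measurable \<mu> g" "i < Suc k" "j < Suc k"
  shows "coef (\<lambda>u. f u + g u) k i j = coef f k i j + coef g k i j"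
proof -
  have "integrable \<mu> (\<lambda>u. h u * cnj (t k u $$ (j, i)))" if "bounded_measurable \<mu> h" for h
    using assms(3,4) that
    by (intro bounded_measurable_integrable[OF haar_prob'] bounded_measurable_mult bounded_measurable_cnj t_bm)
  from this[OF assms(1)] this[OF assms(2)] show ?thesis by (simp add: coef_def distrib_right)
qed

lemma energy_add:
  assumes "bounded_measurable \<mu> f" "bounded_measurable \<mu> g"
  shows "energy k (\<lambda>u. f u + g u) \<le> 2 * energy k f + 2 * energy k g"
proof -
  have "hs2 k (coef (\<lambda>u. f u + g u) k) \<le> (\<Sum>i<Suc k. \<Sum>j<Suc k. 2 * (cmod (coef f k i j))\<^sup>2 + 2 * (cmod (coef g k i j))\<^sup>2)"
    unfolding hs2_def by (intro sum_mono) (simp add: coef_add[OF assms] cmod_add_power2_le)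
  also have "\<dots> = 2 * hs2 k (coef f k) + 2 * hs2 k (coef g k)"
    by (simp add: hs2_def sum.distrib sum_distrib_left)
  finally have "real (Suc k) * hs2 k (coef (\<lambda>u. f u + g u) k) \<le> real (Suc k) * (2 * hs2 k (coef f k) + 2 * hs2 k (coef g k))"
    by (intro mult_left_mono) auto
  thus ?thesis by (simp only: energy_def) (simp only: algebra_simps)
qed

text \<open>The layer-cake argument needs the exponent \<open>2 / p - 1\<close> to be positive; at
  \<open>p = 2\<close> the estimate is a consequence of Bessel's inequality.\<close>

lemma energy_paley:
  assumes p: "1 < p" "p \<le> 2" and K: "finite K"
    and \<phi>: "\<And>k. 0 \<le> \<phi> k" and M: "\<And>s. s > 0 \<Longrightarrow> (\<Sum>k\<in>{k\<in>K. s < \<phi> k}. (real (Suc k))\<^sup>2) \<le> M / s"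
    and f: "bounded_measurable \<mu> f"
  shows "(\<Sum>k\<in>K. \<phi> k powr (2 / p - 1) * energy k f)
    \<le> paley_const p * M powr (2 / p - 1) * (\<integral>u. cmod (f u) powr p \<partial>\<mu>) powr (2 / p)"
proof (cases "p = 2")
  case False
  show ?thesis
    by (rule paley_inequality[OF haar_prob', where m = "\<lambda>k. (real (Suc k))\<^sup>2" and a = energy])
      (use False p K \<phi> M f in \<open>auto intro: energy_add energy_le_L1 energy_bessel finite_subset simp del: of_nat_Suc\<close>)
next
  case True
  have M0: "M \<ge> 0" using M[of 1] sum_nonneg[of "{k \<in> K. 1 < \<phi> k}" "\<lambda>k. (real (Suc k))\<^sup>2"] by simp
  have N: "(\<integral>u. cmod (f u) powr p \<partial>\<mu>) powr (2 / p) = (\<integral>u. (cmod (f u))\<^sup>2 \<partial>\<mu>)"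
    using True by (simp add: powr_numeral)
  show ?thesis
  proof (cases "M = 0")
    case z: True
    \<comment> \<open>As \<open>0 powr 0 = 0\<close>, the right-hand side is 0 for
      \<open>M = 0\<close> even though the exponent is 0; the left-hand side obeys the same
      convention once \<phi> vanishes on \<open>K\<close>.\<close>
    have "\<phi> k = 0" if k: "k \<in> K" for k
    proof (rule ccontr)
      assume "\<phi> k \<noteq> 0"
      with \<phi>[of k] have pos: "\<phi> k > 0" by simp
      have "(real (Suc k))\<^sup>2 \<le> (\<Sum>k\<in>{j\<in>K. \<phi> k / 2 < \<phi> j}. (real (Suc k))\<^sup>2)"
        using K k pos by (intro member_le_sum) auto
      also have "\<dots> \<le> 0" using M[of "\<phi> k / 2"] pos z by simp
      finally show False by simp
    qed
    thus ?thesis using True z by (simp add: sum.neutral)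
  next
    case nz: False
    have "(\<Sum>k\<in>K. \<phi> k powr (2 / p - 1) * energy k f) \<le> (\<Sum>k\<in>K. 1 * energy k f)"
      using True by (intro sum_mono mult_right_mono) (auto simp: powr_def)
    also have "\<dots> \<le> (\<integral>u. (cmod (f u))\<^sup>2 \<partial>\<mu>)" using energy_bessel[OF K f] by simp
    also have "\<dots> \<le> paley_const p * M powr (2 / p - 1) * (\<integral>u. cmod (f u) powr p \<partial>\<mu>) powr (2 / p)"
      unfolding N using True nz M0 by (simp add: paley_const_def)
    finally show ?thesis .
  qed
qed

text \<open>The Fourier series over the degrees in \<open>K\<close>: each summand is the dimension
  times the trace of \<open>S k\<close> multiplied by \<open>t k u\<close>.\<close>

definition trig_sum :: "nat set \<Rightarrow> (nat \<Rightarrow> nat \<Rightarrow> nat \<Rightarrow> complex) \<Rightarrow> su2 \<Rightarrow> complex" where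
  "trig_sum K S u = (\<Sum>k\<in>K. of_nat (Suc k) * (\<Sum>i<Suc k. \<Sum>j<Suc k. S k i j * t k u $$ (j, i)))"

lemma trig_sum_continuous: "continuous_on UNIV (trig_sum K S)"
  unfolding trig_sum_def by (intro continuous_intros t_continuous) auto

lemma trig_sum_bm: "bounded_measurable \<mu> (trig_sum K S)"
  by (intro cont_bm trig_sum_continuous)

lemma trig_sum_coef_fun:
  assumes "finite K"
  shows "trig_sum K S u = (\<Sum>x\<in>coef_index K. (case x of (k, i, j) \<Rightarrow> complex_of_real (sqrt (real (Suc k))) * S k i j) * coef_fun x u)"
proof -
  have s: "complex_of_real (sqrt (real (Suc k))) * complex_of_real (sqrt (real (Suc k))) = of_nat (Suc k)" for k
    by (simp only: of_real_mult[symmetric] real_sqrt_mult_self) simp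
  have "of_nat (Suc k) * (x * y) = complex_of_real (sqrt (real (Suc k))) * x * (complex_of_real (sqrt (real (Suc k))) * y)" for k x y
    unfolding s[symmetric] by (simp only: mult_ac)
  thus ?thesis
    unfolding sum_coef_index[OF assms] trig_sum_def sum_distrib_left by (simp only: coef_fun_def split_conv)
qed

lemma trig_sum_L2:
  assumes K: "finite K"
  shows "(\<integral>u. (cmod (trig_sum K S u))\<^sup>2 \<partial>\<mu>) = (\<Sum>k\<in>K. real (Suc k) * hs2 k (S k))"
  unfolding trig_sum_coef_fun[OF K]
  by (subst parseval_finite[OF haar_prob' finite_coef_index[OF K] coef_fun_bm coef_fun_orth])
    (auto simp add: sum_coef_index[OF K] sqrt_Suc_scale hs2_def sum_distrib_left simp del: of_nat_Suc)

lemma trig_sum_pairing: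
  assumes K: "finite K" and h: "bounded_measurable \<mu> h"
  shows "(\<integral>u. trig_sum K S u * cnj (h u) \<partial>\<mu>)
    = (\<Sum>k\<in>K. of_nat (Suc k) * (\<Sum>i<Suc k. \<Sum>j<Suc k. S k i j * cnj (coef h k i j)))"
proof -
  have pair: "(\<integral>u. t k u $$ (j, i) * cnj (h u) \<partial>\<mu>) = cnj (coef h k i j)" for k i j
  proof -
    have "cnj (coef h k i j) = (\<integral>u. cnj (h u * cnj (t k u $$ (j, i))) \<partial>\<mu>)"
      unfolding coef_def by (rule Bochner_Integration.integral_cnj[symmetric])
    thus ?thesis by (simp add: mult.commute)
  qed
  have int: "integrable \<mu> (\<lambda>u. t k u $$ (j, i) * cnj (h u))" if "i \<in> {..<Suc k}" "j \<in> {..<Suc k}" for k i j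
    using that h by (intro bounded_measurable_integrable[OF haar_prob'] bounded_measurable_mult bounded_measurable_cnj t_bm) auto
  have "(\<integral>u. trig_sum K S u * cnj (h u) \<partial>\<mu>)
    = (\<integral>u. (\<Sum>k\<in>K. \<Sum>i<Suc k. \<Sum>j<Suc k. (of_nat (Suc k) * S k i j) * (t k u $$ (j, i) * cnj (h u))) \<partial>\<mu>)"
    unfolding trig_sum_def sum_distrib_left sum_distrib_right
    by (intro Bochner_Integration.integral_cong refl sum.cong) (simp only: mult_ac)
  also have "\<dots> = (\<Sum>k\<in>K. \<integral>u. (\<Sum>i<Suc k. \<Sum>j<Suc k. (of_nat (Suc k) * S k i j) * (t k u $$ (j, i) * cnj (h u))) \<partial>\<mu>)"
    using int by (intro Bochner_Integration.integral_sum Bochner_Integration.integrable_sum integrable_mult_right)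
  also have "\<dots> = (\<Sum>k\<in>K. \<Sum>i<Suc k. \<integral>u. (\<Sum>j<Suc k. (of_nat (Suc k) * S k i j) * (t k u $$ (j, i) * cnj (h u))) \<partial>\<mu>)"
    using int by (intro sum.cong refl Bochner_Integration.integral_sum Bochner_Integration.integrable_sum integrable_mult_right)
  also have "\<dots> = (\<Sum>k\<in>K. \<Sum>i<Suc k. \<Sum>j<Suc k. \<integral>u. (of_nat (Suc k) * S k i j) * (t k u $$ (j, i) * cnj (h u)) \<partial>\<mu>)"
    using int by (intro sum.cong refl Bochner_Integration.integral_sum integrable_mult_right)
  also have "\<dots> = (\<Sum>k\<in>K. of_nat (Suc k) * (\<Sum>i<Suc k. \<Sum>j<Suc k. S k i j * cnj (coef h k i j)))"
    by (simp only: integral_mult_right_zero pair sum_distrib_left mult.assoc)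
  finally show ?thesis .
qed

lemma hs_cauchy_schwarz:
  "cmod (\<Sum>i<Suc k. \<Sum>j<Suc k. S i j * cnj (T i j)) \<le> sqrt (hs2 k S) * sqrt (hs2 k T)"
proof -
  let ?I = "{..<Suc k} \<times> {..<Suc k}"
  have "(\<Sum>i<Suc k. \<Sum>j<Suc k. S i j * cnj (T i j)) = (\<Sum>x\<in>?I. S (fst x) (snd x) * cnj (T (fst x) (snd x)))"
    by (simp add: sum.cartesian_product split_beta)
  also have "cmod \<dots> \<le> (\<Sum>x\<in>?I. \<bar>cmod (S (fst x) (snd x))\<bar> * \<bar>cmod (T (fst x) (snd x))\<bar>)"
    by (rule order_trans[OF norm_sum]) (simp add: norm_mult)
  also have "\<dots> \<le> L2_set (\<lambda>x. cmod (S (fst x) (snd x))) ?I * L2_set (\<lambda>x. cmod (T (fst x) (snd x))) ?I"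
    by (rule L2_set_mult_ineq)
  also have "\<dots> = sqrt (hs2 k S) * sqrt (hs2 k T)"
    by (simp add: L2_set_def hs2_def sum.cartesian_product split_beta)
  finally show ?thesis .
qed

text \<open>The symbol acts here only through the Hilbert-Schmidt bound \<open>S\<close>, so that
  operator norms suffice. The factor \<open>Suc k\<close> of the series is shared equally between
  the energies of \<open>f\<close> and of \<open>h\<close>.\<close>

lemma trig_sum_pairing_bound:
  assumes K: "finite K" and h: "bounded_measurable \<mu> h" and s: "\<And>k. 0 \<le> s k"
    and S: "\<And>k. hs2 k (S k) \<le> (s k)\<^sup>2 * hs2 k (coef f k)"
  shows "cmod (\<integral>u. trig_sum K S u * cnj (h u) \<partial>\<mu>) \<le> (\<Sum>k\<in>K. s k * (sqrt (energy k f) * sqrt (energy k h)))"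
  unfolding trig_sum_pairing[OF K h]
proof (rule order_trans[OF norm_sum sum_mono])
  fix k
  have "cmod (of_nat (Suc k) * (\<Sum>i<Suc k. \<Sum>j<Suc k. S k i j * cnj (coef h k i j)))
     = real (Suc k) * cmod (\<Sum>i<Suc k. \<Sum>j<Suc k. S k i j * cnj (coef h k i j))"
    unfolding norm_mult norm_of_nat ..
  also have "\<dots> \<le> real (Suc k) * (sqrt (hs2 k (S k)) * sqrt (hs2 k (coef h k)))"
    by (intro mult_left_mono hs_cauchy_schwarz) auto
  also have "\<dots> \<le> real (Suc k) * (sqrt ((s k)\<^sup>2 * hs2 k (coef f k)) * sqrt (hs2 k (coef h k)))"
    by (intro mult_left_mono mult_right_mono real_sqrt_le_mono S) auto
  also have "\<dots> = s k * (sqrt (energy k f) * sqrt (energy k h))"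
    using s[of k] unfolding energy_def real_sqrt_mult real_sqrt_abs
    by (simp add: mult_ac del: of_nat_Suc)
  finally show "cmod (of_nat (Suc k) * (\<Sum>i<Suc k. \<Sum>j<Suc k. S k i j * cnj (coef h k i j)))
    \<le> s k * (sqrt (energy k f) * sqrt (energy k h))" .
qed

text \<open>With \<open>\<phi> = s powr r\<close>, \<open>1 / r = 1 / p - 1 / q\<close>, the weight \<open>s\<close> splits as
  \<open>\<phi> powr (1 / p - 1 / 2) * \<phi> powr (1 / 2 - 1 / q)\<close>: the first factor is absorbed by Paley's inequality
  for \<open>f\<close> in \<open>L\<^sup>p\<close>, the second by that for \<open>h\<close> in the dual of \<open>L\<^sup>q\<close>.\<close>

lemma energy_weighted_bound:
  assumes p: "1 < p" "p \<le> 2" and q: "2 \<le> q" and K: "finite K"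
    and s: "\<And>k. 0 \<le> s k" and W: "0 \<le> W"
    and weak: "p < q \<Longrightarrow> \<forall>x>0. (\<Sum>k\<in>{k\<in>K. x < s k}. (real (Suc k))\<^sup>2) \<le> (W / x) powr (1 / (1 / p - 1 / q))"
    and bdd: "\<And>k. s k \<le> W"
    and f: "bounded_measurable \<mu> f" and h: "bounded_measurable \<mu> h"
  shows "(\<Sum>k\<in>K. s k * (sqrt (energy k f) * sqrt (energy k h)))
    \<le> sqrt (paley_const p) * sqrt (paley_const (q / (q - 1))) * W
       * (\<integral>u. cmod (f u) powr p \<partial>\<mu>) powr (1 / p) * (\<integral>u. cmod (h u) powr (q / (q - 1)) \<partial>\<mu>) powr (1 - 1 / q)"
proof -
  define q' where "q' = q / (q - 1)"
  have q': "1 < q'" "q' \<le> 2" "1 / q' = 1 - 1 / q"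
    using q by (auto simp: q'_def field_simps)
  define Nf where "Nf = (\<integral>u. cmod (f u) powr p \<partial>\<mu>)"
  define Nh where "Nh = (\<integral>u. cmod (h u) powr q' \<partial>\<mu>)"
  have N0: "Nf \<ge> 0" "Nh \<ge> 0" by (simp_all add: Nf_def Nh_def)
  have pc: "paley_const p \<ge> 2" "paley_const q' \<ge> 2" using paley_const_ge p q' by auto
  have cs: "(\<Sum>k\<in>K. s k * (sqrt (energy k f) * sqrt (energy k h))) \<le> sqrt X * sqrt Y"
    if "\<And>k. s k = a k * b k" "\<And>k. 0 \<le> a k" "\<And>k. 0 \<le> b k"
      "(\<Sum>k\<in>K. (a k)\<^sup>2 * energy k f) \<le> X" "(\<Sum>k\<in>K. (b k)\<^sup>2 * energy k h) \<le> Y" for a b X Y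
  proof -
    have "(\<Sum>k\<in>K. s k * (sqrt (energy k f) * sqrt (energy k h)))
       = (\<Sum>k\<in>K. \<bar>a k * sqrt (energy k f)\<bar> * \<bar>b k * sqrt (energy k h)\<bar>)"
      using that(1-3) by (intro sum.cong refl) (simp add: abs_mult mult_ac)
    also have "\<dots> \<le> L2_set (\<lambda>k. a k * sqrt (energy k f)) K * L2_set (\<lambda>k. b k * sqrt (energy k h)) K"
      by (rule L2_set_mult_ineq)
    also have "\<dots> = sqrt (\<Sum>k\<in>K. (a k)\<^sup>2 * energy k f) * sqrt (\<Sum>k\<in>K. (b k)\<^sup>2 * energy k h)"
      by (simp add: L2_set_def power_mult_distrib)
    also have "\<dots> \<le> sqrt X * sqrt Y"
      using that(4,5) order_trans[OF sum_nonneg that(4)] by (intro mult_mono real_sqrt_le_mono) (auto intro!: sum_nonneg mult_nonneg_nonneg)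
    finally show ?thesis .
  qed
  have "(\<Sum>k\<in>K. s k * (sqrt (energy k f) * sqrt (energy k h)))
    \<le> sqrt (paley_const p) * sqrt (paley_const q') * W * Nf powr (1 / p) * Nh powr (1 / q')"
  proof (cases "p < q")
    case False
    \<comment> \<open>Here \<open>1 / p - 1 / q\<close> is 0 and the exponent \<open>r\<close> does
      not exist; the bound on \<open>s\<close> and Bessel's inequality for both functions take the
      place of Paley's inequality.\<close>
    hence pq': "p = 2" "q = 2" using p q by auto
    hence pq: "p = 2" "q = 2" "q' = 2" by (auto simp: q'_def)
    have "(\<Sum>k\<in>K. s k * (sqrt (energy k f) * sqrt (energy k h)))
      \<le> (\<Sum>k\<in>K. W * (\<bar>sqrt (energy k f)\<bar> * \<bar>sqrt (energy k h)\<bar>))"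
      using bdd by (intro sum_mono) (simp add: mult_right_mono)
    also have "\<dots> \<le> W * (L2_set (\<lambda>k. sqrt (energy k f)) K * L2_set (\<lambda>k. sqrt (energy k h)) K)"
      unfolding sum_distrib_left[symmetric] by (intro mult_left_mono W L2_set_mult_ineq)
    also have "\<dots> = W * (sqrt (\<Sum>k\<in>K. energy k f) * sqrt (\<Sum>k\<in>K. energy k h))"
      by (simp add: L2_set_def)
    also have "\<dots> \<le> W * (sqrt Nf * sqrt Nh)"
      using energy_bessel[OF K f] energy_bessel[OF K h] W N0 pq
      by (intro mult_left_mono mult_mono real_sqrt_le_mono) (auto simp: Nf_def Nh_def powr_numeral intro!: sum_nonneg)
    also have "\<dots> \<le> (sqrt (paley_const p) * sqrt (paley_const q')) * (W * (sqrt Nf * sqrt Nh))"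
    proof -
      have "sqrt (paley_const p) * sqrt (paley_const q') = 2" by (simp add: pq paley_const_def)
      thus ?thesis using W N0 by simp
    qed
    finally show ?thesis using pq N0 by (simp add: powr_half_sqrt mult_ac)
  next
    case True
    define r where "r = 1 / (1 / p - 1 / q)"
    have pos: "1 / p - 1 / q > 0" using True p by (simp add: field_simps)
    have r: "r > 0" using pos by (simp add: r_def)
    define \<phi> where "\<phi> = (\<lambda>k. s k powr r)"
    \<comment> \<open>The weak-type constant of \<phi>: its level set above \<open>x\<close> is the
      level set of \<open>s\<close> above \<open>x powr (1 / r)\<close>.\<close>
    define M where "M = W powr r"
    have M: "(\<Sum>k\<in>{k\<in>K. x < \<phi> k}. (real (Suc k))\<^sup>2) \<le> M / x" if x: "x > 0" for x
    proof -
      have "x < \<phi> k \<longleftrightarrow> x powr (1 / r) < s k" for k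
      proof -
        have "x < \<phi> k \<longleftrightarrow> (x powr (1 / r)) powr r < s k powr r" using x r by (simp add: \<phi>_def powr_powr)
        also have "\<dots> \<longleftrightarrow> x powr (1 / r) < s k"
          using powr_less_mono2[of r "x powr (1 / r)" "s k"] powr_mono2[of r "s k" "x powr (1 / r)"] r s[of k]
          by (smt (verit) powr_ge_zero)
        finally show ?thesis .
      qed
      hence "(\<Sum>k\<in>{k\<in>K. x < \<phi> k}. (real (Suc k))\<^sup>2) = (\<Sum>k\<in>{k\<in>K. x powr (1 / r) < s k}. (real (Suc k))\<^sup>2)"
        by simp
      also have "\<dots> \<le> (W / x powr (1 / r)) powr r"
        using weak[OF True] x by (simp add: r_def)
      also have "\<dots> = M / x"
        using x r W by (simp add: M_def powr_divide powr_powr)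
      finally show ?thesis .
    qed
    let ?a = "1 / p - 1 / 2" and ?b = "1 / q' - 1 / 2"
    have ab: "r * (?a + ?b) = 1" using pos True unfolding r_def q'(3) by simp
    have "(\<Sum>k\<in>K. s k * (sqrt (energy k f) * sqrt (energy k h)))
       \<le> sqrt (paley_const p * M powr (2 / p - 1) * Nf powr (2 / p)) * sqrt (paley_const q' * M powr (2 / q' - 1) * Nh powr (2 / q'))"
    proof (rule cs)
      fix k
      have "\<phi> k powr ?a * \<phi> k powr ?b = s k powr (r * (?a + ?b))"
        by (simp only: powr_add[symmetric] \<phi>_def powr_powr distrib_left)
      thus "s k = \<phi> k powr ?a * \<phi> k powr ?b" using s[of k] unfolding ab by simp
    next
      have sq: "(\<phi> k powr ?a)\<^sup>2 = \<phi> k powr (2 / p - 1)" "(\<phi> k powr ?b)\<^sup>2 = \<phi> k powr (2 / q' - 1)" for k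
        by (simp_all add: power2_eq_square powr_add[symmetric])
      show "(\<Sum>k\<in>K. (\<phi> k powr ?a)\<^sup>2 * energy k f) \<le> paley_const p * M powr (2 / p - 1) * Nf powr (2 / p)"
        unfolding sq Nf_def by (rule energy_paley[OF p K _ M f]) (simp_all add: \<phi>_def)
      show "(\<Sum>k\<in>K. (\<phi> k powr ?b)\<^sup>2 * energy k h) \<le> paley_const q' * M powr (2 / q' - 1) * Nh powr (2 / q')"
        unfolding sq Nh_def by (rule energy_paley[OF q'(1,2) K _ M h]) (simp_all add: \<phi>_def)
    qed auto
    also have "\<dots> = sqrt (paley_const p) * sqrt (paley_const q') * (M powr ?a * M powr ?b) * Nf powr (1 / p) * Nh powr (1 / q')"
    proof -
      have sq: "sqrt (x powr y) = x powr (y / 2)" for x y :: real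
        by (simp add: powr_half_sqrt[symmetric] powr_powr)
      show ?thesis by (simp add: real_sqrt_mult sq diff_divide_distrib mult_ac)
    qed
    also have "M powr ?a * M powr ?b = W"
    proof -
      have "M powr ?a * M powr ?b = W powr (r * (?a + ?b))" by (simp only: powr_add[symmetric] M_def powr_powr distrib_left)
      thus ?thesis using W unfolding ab by simp
    qed
    finally show ?thesis .
  qed
  thus ?thesis by (simp add: Nf_def Nh_def q'(3) q'_def[symmetric])
qed

end

section \<open>Smooth functions and trigonometric polynomials\<close>


lemma exp_mat_entry:
  "vec_nth (vec_nth (exp_mat AX s) 1) 1 = of_real (cos s)" "vec_nth (vec_nth (exp_mat AX s) 1) 2 = \<i> * of_real (sin s)"
  "vec_nth (vec_nth (exp_mat AX s) 2) 1 = \<i> * of_real (sin s)" "vec_nth (vec_nth (exp_mat AX s) 2) 2 = of_real (cos s)"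
  "vec_nth (vec_nth (exp_mat AY s) 1) 1 = of_real (cos s)" "vec_nth (vec_nth (exp_mat AY s) 1) 2 = of_real (sin s)"
  "vec_nth (vec_nth (exp_mat AY s) 2) 1 = - of_real (sin s)" "vec_nth (vec_nth (exp_mat AY s) 2) 2 = of_real (cos s)"
  "vec_nth (vec_nth (exp_mat AZ s) 1) 1 = cis s" "vec_nth (vec_nth (exp_mat AZ s) 1) 2 = 0"
  "vec_nth (vec_nth (exp_mat AZ s) 2) 1 = 0" "vec_nth (vec_nth (exp_mat AZ s) 2) 2 = cis (- s)"
  by simp_all

lemma su2_eqI:
  assumes "su2_entry u 1 1 = su2_entry v 1 1" "su2_entry u 1 2 = su2_entry v 1 2"
  shows "u = v"
proof -
  have "Rep_su2 u = Rep_su2 v"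
    using assms su2_entries[of u] su2_entries[of v]
    by (simp add: Finite_Cartesian_Product.vec_eq_iff forall_2)
  thus ?thesis by (simp add: Rep_su2_inject)
qed

lemma su2_mult_entry: "su2_entry (u * v) i j = su2_entry u i 1 * su2_entry v 1 j + su2_entry u i 2 * su2_entry v 2 j"
  by (simp add: Rep_su2_mult mat_mult_nth sum_2)

lemma su2_exp_add: "su2_exp a (s + r) = su2_exp a s * su2_exp a r"
  by (rule su2_eqI; cases a)
    (simp_all only: su2_mult_entry Rep_su2_exp exp_mat_entry cis_mult[symmetric] cos_add sin_add of_real_add of_real_mult of_real_diff,
      simp_all add: algebra_simps)

lemma su2_exp_0: "su2_exp a 0 = 1"
  by (rule su2_eqI; cases a) (simp_all only: Rep_su2_exp exp_mat_entry Rep_su2_one, simp_all add: Finite_Cartesian_Product.mat_def)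

lemma exp_mat_entry_differentiable: "(\<lambda>s. vec_nth (vec_nth (exp_mat a s) i) j) differentiable (at s0)"
proof -
  have c: "(\<lambda>s. complex_of_real (cos s)) differentiable (at s0)"
    by (rule differentiableI_vector) (auto intro!: derivative_eq_intros)
  have s: "(\<lambda>s. complex_of_real (sin s)) differentiable (at s0)"
    by (rule differentiableI_vector) (auto intro!: derivative_eq_intros)
  have e: "cis s = complex_of_real (cos s) + \<i> * complex_of_real (sin s)" for s
    by (simp add: complex_eq_iff)
  have z: "(\<lambda>s. cis s) differentiable (at s0)" unfolding e using c s by (intro differentiable_add differentiable_mult) auto
  have e': "cis (- s) = complex_of_real (cos s) + - (\<i> * complex_of_real (sin s))" for s
    by (simp add: complex_eq_iff)
  have z': "(\<lambda>s. cis (- s)) differentiable (at s0)" unfolding e' using c s by (intro differentiable_add differentiable_minus differentiable_mult) auto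
  consider "i = 1" "j = 1" | "i = 1" "j = 2" | "i = 2" "j = 1" | "i = 2" "j = 2"
    using exhaust_2 by metis
  thus ?thesis
    by cases (cases a; simp only: exp_mat_entry; intro c s z z' differentiable_minus differentiable_mult differentiable_const)+
qed

lemma su2_exp_continuous: "continuous_on S (su2_exp a)"
proof -
  have "continuous_on S (\<lambda>s. vec_nth (vec_nth (exp_mat a s) i) j)" for i j
    by (intro continuous_at_imp_continuous_on ballI differentiable_imp_continuous_within exp_mat_entry_differentiable)
  hence "continuous_on S (\<lambda>s. \<chi> i j. vec_nth (vec_nth (exp_mat a s) i) j)"
    by (intro continuous_on_vec_lambda)
  thus ?thesis unfolding continuous_on_su2_iff by (simp add: Rep_su2_exp)
qed

lemma hom_monom_coeff_differentiable:
  "(\<lambda>s. hom_monom_coeff k m i (exp_mat a s)) differentiable (at s0)"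
proof -
  have fin: "finite {(a, b) \<in> {..m} \<times> {..k - m}. a + b = i}"
    by (rule finite_subset[of _ "{..m} \<times> {..k - m}"]) auto
  show ?thesis
    unfolding hom_monom_coeff_def split_beta using fin
    by (intro differentiable_sum differentiable_mult differentiable_power exp_mat_entry_differentiable differentiable_const ballI)
      (auto simp: split_beta)
qed

lemma lderiv_combination:
  assumes f: "(\<lambda>t. f (u * su2_exp a t)) differentiable at 0" and g: "(\<lambda>t. g (u * su2_exp a t)) differentiable at 0"
  shows "lderiv a (\<lambda>u. \<alpha> * f u + \<beta> * g u) u = \<alpha> * lderiv a f u + \<beta> * lderiv a g u"
    and "(\<lambda>t. \<alpha> * f (u * su2_exp a t) + \<beta> * g (u * su2_exp a t)) differentiable at 0"
proof -
  have "((\<lambda>t. \<alpha> * f (u * su2_exp a t) + \<beta> * g (u * su2_exp a t)) has_vector_derivative \<alpha> * lderiv a f u + \<beta> * lderiv a g u) (at 0)"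
    using f g unfolding lderiv_def vector_derivative_works
    by (intro has_vector_derivative_add has_vector_derivative_mult_right)
  thus "lderiv a (\<lambda>u. \<alpha> * f u + \<beta> * g u) u = \<alpha> * lderiv a f u + \<beta> * lderiv a g u"
    "(\<lambda>t. \<alpha> * f (u * su2_exp a t) + \<beta> * g (u * su2_exp a t)) differentiable at 0"
    unfolding lderiv_def by (auto intro: vector_derivative_at differentiableI_vector)
qed

text \<open>Smoothness matters: \<open>lderiv\<close> has no meaningful value where the derivative
  fails to exist, so it is linear only on differentiable functions.\<close>

lemma lderivs_combination:
  assumes f: "smooth f" and g: "smooth g"
  shows "lderivs w (\<lambda>u. \<alpha> * f u + \<beta> * g u) = (\<lambda>u. \<alpha> * lderivs w f u + \<beta> * lderivs w g u)"
proof (induction w)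
  case (Cons a w)
  show ?case
  proof
    fix u
    have "(\<lambda>t. lderivs w f (u * su2_exp a t)) differentiable at 0" "(\<lambda>t. lderivs w g (u * su2_exp a t)) differentiable at 0"
      using f g unfolding smooth_def by blast+
    from lderiv_combination(1)[OF this] show "lderivs (a # w) (\<lambda>u. \<alpha> * f u + \<beta> * g u) u = \<alpha> * lderivs (a # w) f u + \<beta> * lderivs (a # w) g u"
      using Cons.IH by simp
  qed
qed simp

lemma smooth_combination:
  assumes f: "smooth f" and g: "smooth g"
  shows "smooth (\<lambda>u. \<alpha> * f u + \<beta> * g u)"
  unfolding smooth_def lderivs_combination[OF assms]
proof (intro allI conjI)
  fix w show "continuous_on UNIV (\<lambda>u. \<alpha> * lderivs w f u + \<beta> * lderivs w g u)"
    using f g unfolding smooth_def by (intro continuous_intros) auto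
next
  fix w a u
  have "(\<lambda>t. lderivs w f (u * su2_exp a t)) differentiable at 0" "(\<lambda>t. lderivs w g (u * su2_exp a t)) differentiable at 0"
    using f g unfolding smooth_def by blast+
  thus "(\<lambda>t. \<alpha> * lderivs w f (u * su2_exp a t) + \<beta> * lderivs w g (u * su2_exp a t)) differentiable at 0"
    by (rule lderiv_combination(2))
qed

lemma lderivs_append: "lderivs (v @ w) f = lderivs v (lderivs w f)"
  by (induction v) auto

lemma smooth_lderivs: "smooth f \<Longrightarrow> smooth (lderivs w f)"
  unfolding smooth_def lderivs_append[symmetric] by blast

lemma smooth_continuous: "smooth f \<Longrightarrow> continuous_on UNIV f"
  unfolding smooth_def by (metis lderivs.simps(1))

text \<open>\<open>smooth\<close> speaks of derivatives at parameter 0 only; the one-parameter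
  subgroup law moves the base point from \<open>u\<close> to \<open>u * su2_exp a s\<close>.\<close>

lemma smooth_has_derivative:
  assumes "smooth f"
  shows "((\<lambda>t. f (u * su2_exp a t)) has_vector_derivative lderiv a f (u * su2_exp a s)) (at s)"
proof -
  have "(\<lambda>t. f (u * su2_exp a s * su2_exp a t)) differentiable at 0"
    using assms unfolding smooth_def by (metis lderivs.simps(1))
  hence "((\<lambda>t. f (u * su2_exp a s * su2_exp a t)) has_vector_derivative lderiv a f (u * su2_exp a s)) (at (s - s))"
    unfolding lderiv_def vector_derivative_works by simp
  moreover have "((\<lambda>t. t - s) has_vector_derivative 1) (at s)"
    by (auto intro!: derivative_eq_intros)
  ultimately have "((\<lambda>t. f (u * su2_exp a s * su2_exp a t)) \<circ> (\<lambda>t. t - s) has_vector_derivative 1 *\<^sub>R lderiv a f (u * su2_exp a s)) (at s)"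
    by (intro vector_diff_chain_at)
  moreover have "f (u * su2_exp a s * su2_exp a (t - s)) = f (u * su2_exp a t)" for t
    using su2_exp_add[of a s "t - s"] by (simp add: mult.assoc)
  ultimately show ?thesis by (simp add: o_def)
qed

lemma smooth_lderiv_continuous: "smooth f \<Longrightarrow> continuous_on UNIV (lderiv a f)"
  unfolding smooth_def by (metis lderivs.simps)

text \<open>The uniformity in \<open>u\<close> is what allows left-invariant derivatives to be exchanged with an integral.\<close>

lemma smooth_uniform_derivative:
  assumes f: "smooth f" and e: "e > 0"
  obtains d where "d > 0" "\<And>u s. \<bar>s\<bar> < d \<Longrightarrow> cmod (f (u * su2_exp a s) - f u - s *\<^sub>R lderiv a f u) \<le> e * \<bar>s\<bar>"
proof -
  let ?g = "lderiv a f" and ?K = "(UNIV :: su2 set) \<times> {-1..1::real}"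
  have "continuous_on ?K (\<lambda>x. ?g (fst x * su2_exp a (snd x)))"
    by (rule continuous_on_compose2[OF smooth_lderiv_continuous[OF f] _ subset_UNIV])
      (intro continuous_intros continuous_on_compose2[OF su2_exp_continuous _ subset_UNIV])
  moreover have "compact ?K" by (intro compact_Times compact_su2) auto
  ultimately have "uniformly_continuous_on ?K (\<lambda>x. ?g (fst x * su2_exp a (snd x)))"
    by (rule compact_uniformly_continuous)
  then obtain d where d: "d > 0" "\<And>x y. x \<in> ?K \<Longrightarrow> y \<in> ?K \<Longrightarrow> dist y x < d \<Longrightarrow>
      dist (?g (fst y * su2_exp a (snd y))) (?g (fst x * su2_exp a (snd x))) < e"
    using e unfolding uniformly_continuous_on_def by blast
  have near: "cmod (?g (u * su2_exp a r) - ?g u) \<le> e" if "\<bar>r\<bar> < min d 1" for u r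
  proof -
    have "- 1 \<le> r" "r \<le> 1" using that by auto
    thus ?thesis using d(2)[of "(u, 0)" "(u, r)"] that by (auto simp: dist_Pair_Pair su2_exp_0 dist_norm)
  qed
  show ?thesis
  proof (rule that[of "min d 1"])
    show "min d 1 > 0" using d by simp
    fix u and s :: real assume s: "\<bar>s\<bar> < min d 1"
    let ?F = "\<lambda>t. f (u * su2_exp a t) - t *\<^sub>R ?g u"
    \<comment> \<open>Mean value inequality for the remainder: its derivative is the difference of
      two values of \<open>?g\<close>, which \<open>near\<close> bounds by \<open>e\<close>
      independently of \<open>u\<close>.\<close>
    have "norm (?F s - ?F 0) \<le> e * norm (s - 0)"
    proof (rule differentiable_bound[of "{-\<bar>s\<bar>..\<bar>s\<bar>}"])
      fix x assume x: "x \<in> {-\<bar>s\<bar>..\<bar>s\<bar>}"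
      have "(?F has_vector_derivative (?g (u * su2_exp a x) - 1 *\<^sub>R ?g u)) (at x within {-\<bar>s\<bar>..\<bar>s\<bar>})"
        by (intro has_vector_derivative_diff has_vector_derivative_at_within[OF smooth_has_derivative[OF f]])
          (auto intro!: derivative_eq_intros)
      thus "(?F has_derivative (\<lambda>h. h *\<^sub>R (?g (u * su2_exp a x) - 1 *\<^sub>R ?g u))) (at x within {-\<bar>s\<bar>..\<bar>s\<bar>})"
        by (simp add: has_vector_derivative_def)
      have "cmod (?g (u * su2_exp a x) - ?g u) \<le> e" using x s by (intro near) auto
      thus "onorm (\<lambda>h::real. h *\<^sub>R (?g (u * su2_exp a x) - 1 *\<^sub>R ?g u)) \<le> e"
        by (simp add: onorm_scaleR_left[OF bounded_linear_ident] onorm_id)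
    qed auto
    thus "cmod (f (u * su2_exp a s) - f u - s *\<^sub>R ?g u) \<le> e * \<bar>s\<bar>"
      by (simp add: su2_exp_0 algebra_simps)
  qed
qed

context su2_dual
begin

text \<open>Spanned by conjugated entries because these are the test functions on which
  \<open>dist_fourier\<close> evaluates a distribution.\<close>

inductive trig_poly :: "(su2 \<Rightarrow> complex) \<Rightarrow> bool" where
  trig_poly_zero: "trig_poly (\<lambda>_. 0)"
| trig_poly_coeff: "i < Suc k \<Longrightarrow> j < Suc k \<Longrightarrow> trig_poly (\<lambda>u. cnj (t k u $$ (i, j)))"
| trig_poly_combination: "trig_poly f \<Longrightarrow> trig_poly g \<Longrightarrow> trig_poly (\<lambda>u. a * f u + b * g u)"

lemma trig_poly_scale: "trig_poly f \<Longrightarrow> trig_poly (\<lambda>u. a * f u)"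
  using trig_poly_combination[of f "\<lambda>_. 0" a 0] trig_poly_zero by simp

lemma trig_poly_sum: "(\<And>x. x \<in> I \<Longrightarrow> trig_poly (f x)) \<Longrightarrow> trig_poly (\<lambda>u. \<Sum>x\<in>I. f x u)"
proof (induction I rule: infinite_finite_induct)
  case (insert x I)
  hence "trig_poly (\<lambda>u. 1 * f x u + 1 * (\<Sum>x\<in>I. f x u))"
    by (intro trig_poly_combination) auto
  with insert show ?case by simp
qed (auto intro: trig_poly_zero)

lemma t_exp_derivative:
  assumes "i < Suc k" "j < Suc k"
  shows "(\<lambda>s. t k (su2_exp a s) $$ (i, j)) differentiable (at 0)"
proof -
  obtain B C where BC: "\<forall>u. \<forall>i<Suc k. \<forall>j<Suc k.
       t k u $$ (i, j) = (\<Sum>m<Suc k. (\<Sum>l<Suc k. C i l * hom_monom_coeff k m l (Rep_su2 u)) * B m j)"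
    using t_entry_formula[of k] by (elim exE) (rule that)
  have "t k (su2_exp a s) $$ (i, j) = (\<Sum>m<Suc k. (\<Sum>l<Suc k. C i l * hom_monom_coeff k m l (exp_mat a s)) * B m j)" for s
    unfolding Rep_su2_exp[symmetric] by (rule BC[rule_format, OF assms])
  thus ?thesis
    by (simp only:) (intro differentiable_sum differentiable_mult hom_monom_coeff_differentiable differentiable_const finite_lessThan ballI)
qed

definition conj_rep_sum :: "nat \<Rightarrow> (nat \<Rightarrow> nat \<Rightarrow> complex) \<Rightarrow> su2 \<Rightarrow> complex" where
  "conj_rep_sum k c u = (\<Sum>i<Suc k. \<Sum>j<Suc k. c i j * cnj (t k u $$ (i, j)))"

text \<open>Right translation by \<open>su2_exp a s\<close> mixes only the column index, through
  \<open>t k (su2_exp a s)\<close>. Hence a left-invariant derivative merely transforms the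
  coefficients, and iterated derivatives stay in a finite-dimensional space of continuous
  functions.\<close>

lemma conj_rep_sum_deriv:
  "\<exists>c'. \<forall>u. ((\<lambda>s. conj_rep_sum k c (u * su2_exp a s)) has_vector_derivative conj_rep_sum k c' u) (at 0)"
proof -
  define D where "D = (\<lambda>m j. vector_derivative (\<lambda>s. t k (su2_exp a s) $$ (m, j)) (at 0))"
  have D: "((\<lambda>s. t k (su2_exp a s) $$ (m, j)) has_vector_derivative D m j) (at 0)" if "m \<in> {..<Suc k}" "j \<in> {..<Suc k}" for m j
    using t_exp_derivative[of m k j a] that unfolding D_def vector_derivative_works by auto
  define c' where "c' = (\<lambda>i m. \<Sum>j<Suc k. c i j * cnj (D m j))"
  have "((\<lambda>s. conj_rep_sum k c (u * su2_exp a s)) has_vector_derivative conj_rep_sum k c' u) (at 0)" for u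
  proof -
    have e: "conj_rep_sum k c (u * su2_exp a s)
      = (\<Sum>i<Suc k. \<Sum>j<Suc k. \<Sum>m<Suc k. (c i j * cnj (t k u $$ (i, m))) * cnj (t k (su2_exp a s) $$ (m, j)))" for s
      unfolding conj_rep_sum_def
    proof (intro sum.cong refl)
      fix i j assume "i \<in> {..<Suc k}" "j \<in> {..<Suc k}"
      hence "i < Suc k" "j < Suc k" by auto
      thus "c i j * cnj (t k (u * su2_exp a s) $$ (i, j)) = (\<Sum>m<Suc k. (c i j * cnj (t k u $$ (i, m))) * cnj (t k (su2_exp a s) $$ (m, j)))"
        by (simp add: t_mult_index cnj_sum sum_distrib_left mult.assoc)
    qed
    have "((\<lambda>s. conj_rep_sum k c (u * su2_exp a s)) has_vector_derivative
       (\<Sum>i<Suc k. \<Sum>j<Suc k. \<Sum>m<Suc k. (c i j * cnj (t k u $$ (i, m))) * cnj (D m j))) (at 0)"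
      unfolding e using D
      by (intro has_vector_derivative_sum has_vector_derivative_mult_right has_vector_derivative_cnj)
    also have "(\<Sum>i<Suc k. \<Sum>j<Suc k. \<Sum>m<Suc k. (c i j * cnj (t k u $$ (i, m))) * cnj (D m j)) = conj_rep_sum k c' u"
    proof -
      have "(\<Sum>i<Suc k. \<Sum>j<Suc k. \<Sum>m<Suc k. (c i j * cnj (t k u $$ (i, m))) * cnj (D m j))
        = (\<Sum>i<Suc k. \<Sum>m<Suc k. \<Sum>j<Suc k. (c i j * cnj (t k u $$ (i, m))) * cnj (D m j))"
        by (rule sum.cong[OF refl], rule sum.swap)
      also have "\<dots> = conj_rep_sum k c' u"
        unfolding conj_rep_sum_def c'_def sum_distrib_right
        by (intro sum.cong refl) (simp only: mult_ac)
      finally show ?thesis .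
    qed
    finally show ?thesis .
  qed
  thus ?thesis by blast
qed

lemma conj_rep_sum_lderivs: "\<exists>c'. lderivs w (conj_rep_sum k c) = conj_rep_sum k c'"
proof (induction w)
  case (Cons a w)
  then obtain c1 where c1: "lderivs w (conj_rep_sum k c) = conj_rep_sum k c1" by blast
  obtain c2 where "\<And>u. ((\<lambda>s. conj_rep_sum k c1 (u * su2_exp a s)) has_vector_derivative conj_rep_sum k c2 u) (at 0)"
    using conj_rep_sum_deriv[of k c1 a] by blast
  hence "lderivs (a # w) (conj_rep_sum k c) = conj_rep_sum k c2"
    by (intro ext) (simp add: c1 lderiv_def vector_derivative_at)
  thus ?case by blast
qed auto

lemma conj_rep_sum_smooth: "smooth (conj_rep_sum k c)"
  unfolding smooth_def
proof (intro allI conjI)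
  fix w
  obtain c' where c': "lderivs w (conj_rep_sum k c) = conj_rep_sum k c'" using conj_rep_sum_lderivs by blast
  show "continuous_on UNIV (lderivs w (conj_rep_sum k c))"
    unfolding c' conj_rep_sum_def by (intro continuous_intros t_continuous) auto
  fix a u
  show "(\<lambda>s. lderivs w (conj_rep_sum k c) (u * su2_exp a s)) differentiable at 0"
    unfolding c' using conj_rep_sum_deriv[of k c' a] by (meson differentiableI_vector)
qed

lemma trig_poly_smooth: "trig_poly f \<Longrightarrow> smooth f"
proof (induction rule: trig_poly.induct)
  case trig_poly_zero
  have "conj_rep_sum 0 (\<lambda>_ _. 0) = (\<lambda>_. 0)" by (rule ext) (simp add: conj_rep_sum_def)
  with conj_rep_sum_smooth[of 0 "\<lambda>_ _. 0"] show ?case by simp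
next
  case (trig_poly_coeff i k j)
  define c :: "nat \<Rightarrow> nat \<Rightarrow> complex" where "c = (\<lambda>a b. if a = i \<and> b = j then 1 else 0)"
  have "conj_rep_sum k c = (\<lambda>u. cnj (t k u $$ (i, j)))"
  proof
    fix u
    have "(\<Sum>b<Suc k. c a b * cnj (t k u $$ (a, b))) = (if a = i then cnj (t k u $$ (i, j)) else 0)" for a
      using trig_poly_coeff by (cases "a = i") (simp_all add: c_def if_distrib[of "\<lambda>x. x * _"] cong: if_cong)
    thus "conj_rep_sum k c u = cnj (t k u $$ (i, j))"
      using trig_poly_coeff by (simp add: conj_rep_sum_def)
  qed
  with conj_rep_sum_smooth[of k c] show ?case by simp
qed (rule smooth_combination)

end

section \<open>Density of trigonometric polynomials\<close>

definition su2_of :: "complex \<Rightarrow> complex \<Rightarrow> su2" where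
  "su2_of a b = Abs_su2 (vector [vector [a, b], vector [- cnj b, cnj a]])"

lemma su2_of_entry:
  assumes "(cmod a)\<^sup>2 + (cmod b)\<^sup>2 = 1"
  shows "su2_entry (su2_of a b) 1 1 = a" "su2_entry (su2_of a b) 1 2 = b"
    "su2_entry (su2_of a b) 2 1 = - cnj b" "su2_entry (su2_of a b) 2 2 = cnj a"
proof -
  have "a * cnj a + b * cnj b = complex_of_real ((cmod a)\<^sup>2 + (cmod b)\<^sup>2)"
    by (simp only: of_real_add complex_norm_square)
  hence 1: "a * cnj a + b * cnj b = 1" using assms by simp
  have "vector [vector [a, b], vector [- cnj b, cnj a]] \<in> SU2"
    using 1 unfolding SU2_def mem_Collect_eq Finite_Cartesian_Product.vec_eq_iff forall_2 mat_mult_nth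
    by (simp add: sum_2 cadjoint_def Finite_Cartesian_Product.mat_def Determinants.det_2 mult.commute add.commute)
  thus "su2_entry (su2_of a b) 1 1 = a" "su2_entry (su2_of a b) 1 2 = b"
    "su2_entry (su2_of a b) 2 1 = - cnj b" "su2_entry (su2_of a b) 2 2 = cnj a"
    unfolding su2_of_def by (simp_all add: Abs_su2_inverse)
qed

text \<open>The spectral theorem by hand. The trace is \<open>2 * Re a\<close>, so the unimodular
  \<open>l\<close> with \<open>Re l = Re a\<close> solves the characteristic equation, and
  \<open>(cnj b, a - l)\<close> is a row eigenvector for it, nonzero because \<open>b\<close> is.
  Normalized, it becomes the first row of \<open>g\<close>.\<close>

lemma su2_diagonalize: "\<exists>g d. u = inverse g * d * g \<and> su2_entry d 1 2 = 0 \<and> su2_entry d 2 1 = 0"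
proof (cases "su2_entry u 1 2 = 0")
  case True
  thus ?thesis using su2_entries(2)[of u]
    by (intro exI[of _ 1] exI[of _ u]) (simp add: su2_left_inverse[of 1, simplified])
next
  case False
  define a b where "a = su2_entry u 1 1" and "b = su2_entry u 1 2"
  have ab: "(cmod a)\<^sup>2 + (cmod b)\<^sup>2 = 1" using su2_entries(3)[of u] by (simp add: a_def b_def)
  have "(cmod a)\<^sup>2 \<le> 1" using ab zero_le_power2[of "cmod b"] by linarith
  moreover have "(Re a)\<^sup>2 \<le> (cmod a)\<^sup>2" by (simp add: cmod_power2)
  ultimately have x: "(Re a)\<^sup>2 \<le> 1" by linarith
  define l where "l = Complex (Re a) (sqrt (1 - (Re a)\<^sup>2))"
  have l1: "(cmod l)\<^sup>2 + (cmod 0)\<^sup>2 = 1" using x by (simp add: l_def cmod_power2)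
  have Rel: "Re l = Re a" "(Im l)\<^sup>2 = 1 - (Re a)\<^sup>2" using x by (auto simp: l_def)
  have l2: "l * l + 1 = 2 * complex_of_real (Re a) * l"
    using Rel by (simp add: complex_eq_iff power2_eq_square algebra_simps)
  have aa: "a * cnj a + b * cnj b = 1"
  proof -
    have "a * cnj a + b * cnj b = complex_of_real ((cmod a)\<^sup>2 + (cmod b)\<^sup>2)"
      by (simp only: of_real_add complex_norm_square)
    thus ?thesis using ab by simp
  qed
  have aca: "a + cnj a = 2 * complex_of_real (Re a)" by (simp add: complex_eq_iff)
  define w where "w = a - l"
  have wb: "cnj b * b + w * cnj a = l * w"
  proof -
    have "cnj b * b + w * cnj a = 1 - l * cnj a" using aa by (simp add: w_def algebra_simps)
    also have "\<dots> = (l * l + 1) - l * (a + cnj a) + l * a - l * l" by (simp add: algebra_simps)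
    also have "\<dots> = l * w" unfolding aca l2 by (simp add: w_def algebra_simps)
    finally show ?thesis .
  qed
  define n where "n = sqrt ((cmod b)\<^sup>2 + (cmod w)\<^sup>2)"
  have npos: "(cmod b)\<^sup>2 + (cmod w)\<^sup>2 > 0" using False by (simp add: b_def add_pos_nonneg)
  have n: "n > 0" "n\<^sup>2 = (cmod b)\<^sup>2 + (cmod w)\<^sup>2" using npos by (auto simp: n_def)
  define g where "g = su2_of (cnj b / of_real n) (w / of_real n)"
  define d where "d = su2_of l 0"
  have gn: "(cmod (cnj b / of_real n))\<^sup>2 + (cmod (w / of_real n))\<^sup>2 = 1"
  proof -
    have "(cmod (cnj b / of_real n))\<^sup>2 + (cmod (w / of_real n))\<^sup>2 = ((cmod b)\<^sup>2 + (cmod w)\<^sup>2) / n\<^sup>2"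
      using n(1) by (simp add: norm_divide power_divide add_divide_distrib)
    thus ?thesis unfolding n(2)[symmetric] using n(1) by simp
  qed
  note ge = su2_of_entry[OF gn, folded g_def] and de = su2_of_entry[OF l1, folded d_def]
  have u2: "su2_entry u 2 1 = - cnj b" "su2_entry u 2 2 = cnj a"
    using su2_entries[of u] by (simp_all add: a_def b_def)
  have "g * u = d * g"
  proof (rule su2_eqI)
    show "su2_entry (g * u) 1 1 = su2_entry (d * g) 1 1"
      unfolding su2_mult_entry ge de u2 a_def[symmetric] using n by (simp add: field_simps w_def)
    have "cnj b / of_real n * b + w / of_real n * cnj a = (cnj b * b + w * cnj a) / of_real n"
      by (simp add: add_divide_distrib)
    thus "su2_entry (g * u) 1 2 = su2_entry (d * g) 1 2"
      unfolding su2_mult_entry ge de u2 b_def[symmetric] wb by simp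
  qed
  hence "inverse g * (g * u) = inverse g * (d * g)" by simp
  hence "u = inverse g * d * g" by (simp add: su2_inverse_mult_cancel mult.assoc)
  thus ?thesis using de by (intro exI[of _ g] exI[of _ d]) simp
qed

text \<open>This is \<open>(2 + tr u) / 4\<close>, since the diagonal entries are conjugate.\<close>

definition peak :: "su2 \<Rightarrow> real" where
  "peak u = (1 + Re (su2_entry u 1 1)) / 2"

lemma peak_continuous [continuous_intros]: "continuous_on S f \<Longrightarrow> continuous_on S (\<lambda>x. peak (f x))"
  unfolding peak_def by (intro continuous_intros) auto

lemma peak_inverse: "peak (inverse u) = peak u"
  by (simp add: peak_def Rep_su2_inverse_group cadjoint_def)

text \<open>The peak function depends only on the distance from the identity and decreases with it,
  which is why its powers concentrate there.\<close>

lemma dist_one_peak: "(dist u 1)\<^sup>2 = 8 * (1 - peak u)"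
proof -
  define a b where "a = su2_entry u 1 1" and "b = su2_entry u 1 2"
  have ab: "(cmod a)\<^sup>2 + (cmod b)\<^sup>2 = 1" using su2_entries(3)[of u] by (simp add: a_def b_def)
  have "(dist u 1)\<^sup>2 = (norm (Rep_su2 u - Finite_Cartesian_Product.mat 1))\<^sup>2"
    by (simp add: dist_su2_def Rep_su2_one dist_norm)
  also have "\<dots> = (cmod (a - 1))\<^sup>2 + (cmod b)\<^sup>2 + (cmod (- cnj b))\<^sup>2 + (cmod (cnj a - 1))\<^sup>2"
    unfolding norm_matrix2 using su2_entries(1,2)[of u]
    by (simp add: Finite_Cartesian_Product.mat_def a_def b_def)
  also have "(cmod (a - 1))\<^sup>2 = (cmod a)\<^sup>2 - 2 * Re a + 1"
    unfolding cmod_power2 by (simp add: power2_eq_square algebra_simps)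
  also have "(cmod (cnj a - 1))\<^sup>2 = (cmod a)\<^sup>2 - 2 * Re a + 1"
    unfolding cmod_power2 by (simp add: power2_eq_square algebra_simps)
  finally show ?thesis using ab by (simp add: peak_def a_def field_simps)
qed

lemma peak_nonneg: "0 \<le> peak u"
proof -
  have "(cmod (su2_entry u 1 1))\<^sup>2 \<le> 1"
    using su2_entries(3)[of u] zero_le_power2[of "cmod (su2_entry u 1 2)"] by linarith
  hence "(cmod (su2_entry u 1 1))\<^sup>2 \<le> 1\<^sup>2" by simp
  hence "cmod (su2_entry u 1 1) \<le> 1" by (rule power2_le_imp_le) simp
  hence "- 1 \<le> Re (su2_entry u 1 1)" using abs_Re_le_cmod[of "su2_entry u 1 1"] by linarith
  thus ?thesis by (simp add: peak_def)
qed

text \<open>Were the ball a null set, all preimages of it under left translations would be null, and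
  by compactness finitely many of them cover the group.\<close>

lemma haar_ball_pos:
  assumes haar: "normalized_haar \<mu>" and e: "e > 0"
  shows "measure \<mu> (ball 1 e) > 0"
proof (rule ccontr)
  interpret prob_space \<mu> using haar_prob[OF haar] .
  assume "\<not> measure \<mu> (ball 1 e) > 0"
  hence "measure \<mu> (ball 1 e) = 0" using measure_nonneg[of \<mu> "ball 1 e"] by linarith
  hence z: "emeasure \<mu> (ball 1 e) = 0" by (simp add: emeasure_eq_measure)
  define U where "U = (\<lambda>g::su2. (\<lambda>u. g * u) -` ball 1 e)"
  have opn: "open (U g)" for g unfolding U_def
    by (rule open_vimage[OF open_ball]) (intro continuous_intros)
  have Uz: "emeasure \<mu> (U g) = 0" for g
  proof -
    have "(\<lambda>u. g * u) \<in> \<mu> \<rightarrow>\<^sub>M borel"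
      unfolding haar_measurable[OF haar] by (intro borel_measurable_continuous_onI continuous_intros)
    hence "emeasure (distr \<mu> borel (\<lambda>u. g * u)) (ball 1 e) = emeasure \<mu> (U g)"
      by (subst emeasure_distr) (auto simp: U_def haar_space[OF haar])
    moreover have "distr \<mu> borel (\<lambda>u. g * u) = \<mu>" using haar unfolding normalized_haar_def by blast
    ultimately show ?thesis using z by simp
  qed
  have "u \<in> U (inverse u)" for u using e by (simp add: U_def su2_left_inverse)
  hence cover: "UNIV \<subseteq> (\<Union>g\<in>UNIV. U g)" by blast
  obtain F where F: "finite F" "UNIV \<subseteq> (\<Union>g\<in>F. U g)"
    using compactE_image[OF compact_su2, of UNIV U] opn cover by metis
  have "emeasure \<mu> (space \<mu>) \<le> emeasure \<mu> (\<Union>g\<in>F. U g)"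
    using F opn haar by (intro emeasure_mono) (auto intro!: sets.finite_UN simp: haar_sets)
  also have "\<dots> \<le> (\<Sum>g\<in>F. emeasure \<mu> (U g))"
    using F opn haar by (intro emeasure_subadditive_finite) (auto simp: haar_sets)
  also have "\<dots> = 0" using Uz by simp
  finally show False using emeasure_space_1 by simp
qed

lemma finite_su2_words: "finite {w :: su2_axis list. length w \<le> m}"
proof -
  have "finite (UNIV :: su2_axis set)"
    by (rule finite_subset[of _ "{AX, AY, AZ}"]) (auto intro: su2_axis.exhaust)
  thus ?thesis using finite_lists_length_le[of "UNIV :: su2_axis set" m] by simp
qed

context su2_dual
begin

section \<open>Smoothing with normalized powers of the peak function\<close>

definition peak_mass :: "nat \<Rightarrow> real" where
  "peak_mass n = (\<integral>v. peak v ^ n \<partial>\<mu>)"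

lemma peak_power_integrable: "integrable \<mu> (\<lambda>v. peak v ^ n)"
proof -
  have "bounded_measurable \<mu> (\<lambda>v. complex_of_real (peak v ^ n))"
    by (intro cont_bm continuous_intros)
  from bounded_measurable_integrable[OF haar_prob' this] show ?thesis
    by (simp only: complex_of_real_integrable_eq)
qed

lemma peak_mass_lower:
  assumes r: "0 < r" "r \<le> 1"
  shows "(1 - r\<^sup>2 / 8) ^ n * measure \<mu> (ball 1 r) \<le> peak_mass n"
proof -
  interpret prob_space \<mu> using haar_prob' .
  have r8: "0 \<le> 1 - r\<^sup>2 / 8" using r power_le_one[of r 2] by simp
  have bs: "ball 1 r \<in> sets \<mu>" using haar_sets[OF haar] by simp
  have "(1 - r\<^sup>2 / 8) ^ n * measure \<mu> (ball 1 r) = (\<integral>v. (1 - r\<^sup>2 / 8) ^ n * indicator (ball 1 r) v \<partial>\<mu>)"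
    using bs by simp
  also have "\<dots> \<le> peak_mass n"
    unfolding peak_mass_def
  proof (rule integral_mono[OF _ peak_power_integrable])
    show "integrable \<mu> (\<lambda>v. (1 - r\<^sup>2 / 8) ^ n * indicator (ball 1 r) v)"
      using bs by (intro integrable_mult_right integrable_real_indicator) (auto simp: emeasure_eq_measure)
    fix v
    show "(1 - r\<^sup>2 / 8) ^ n * indicator (ball 1 r) v \<le> peak v ^ n"
    proof (cases "v \<in> ball 1 r")
      case True
      hence "(dist v 1)\<^sup>2 \<le> r\<^sup>2" by (intro power_mono) (auto simp: dist_commute)
      hence "1 - r\<^sup>2 / 8 \<le> peak v" using dist_one_peak[of v] by simp
      thus ?thesis using True r8 by (simp add: power_mono)
    qed (simp add: peak_nonneg)
  qed
  finally show ?thesis .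
qed

lemma peak_mass_pos: "peak_mass n > 0"
proof -
  have "0 < (1 - 1\<^sup>2 / 8 :: real) ^ n * measure \<mu> (ball 1 1)"
    using haar_ball_pos[OF haar, of 1] by simp
  also have "\<dots> \<le> peak_mass n" by (rule peak_mass_lower) auto
  finally show ?thesis .
qed

text \<open>Off the ball of radius \<open>d\<close> the peak is at most \<rho>, while on a smaller
  ball of positive mass \<open>c\<close> it is at least the larger number \<open>\<rho>'\<close>.
  The ratio \<open>(\<rho> / \<rho>') ^ n\<close> eventually beats the fixed constant
  \<open>c\<close>.\<close>

lemma peak_concentration:
  assumes d: "d > 0" and \<eta>: "\<eta> > 0"
  shows "\<exists>N. \<forall>n\<ge>N. \<forall>v. d \<le> dist v 1 \<longrightarrow> peak v ^ n \<le> \<eta> * peak_mass n"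
proof -
  \<comment> \<open>Half of \<open>d\<close> separates the two bounds strictly; the cap 1 keeps
    \<open>1 - r\<^sup>2 / 8\<close> positive.\<close>
  define r where "r = min (d / 2) 1"
  have r: "0 < r" "r \<le> 1" "r \<le> d / 2" using d by (auto simp: r_def)
  \<comment> \<open>For large \<open>d\<close> the value \<open>1 - d\<^sup>2 / 8\<close> is
    negative, and powers would no longer be monotone.\<close>
  define \<rho> where "\<rho> = max 0 (1 - d\<^sup>2 / 8)"
  define \<rho>' where "\<rho>' = 1 - r\<^sup>2 / 8"
  have "r\<^sup>2 \<le> (d / 2)\<^sup>2" using r by (intro power_mono) auto
  hence "4 * r\<^sup>2 \<le> d\<^sup>2" by (simp add: power_divide)
  moreover have "0 < d\<^sup>2" using d by simp
  ultimately have "r\<^sup>2 < d\<^sup>2" by linarith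
  moreover have "r\<^sup>2 \<le> 1" using r by (simp add: power_le_one)
  ultimately have \<rho>: "0 \<le> \<rho>" "\<rho> < \<rho>'" "\<rho>' > 0" by (auto simp: \<rho>_def \<rho>'_def)
  define c where "c = measure \<mu> (ball 1 r)"
  have c: "c > 0" using haar_ball_pos[OF haar r(1)] by (simp add: c_def)
  have "(\<lambda>n. (\<rho> / \<rho>') ^ n) \<longlonglongrightarrow> 0" using \<rho> by (intro LIMSEQ_realpow_zero) auto
  hence "eventually (\<lambda>n. (\<rho> / \<rho>') ^ n < \<eta> * c) sequentially"
    using \<eta> c by (intro order_tendstoD(2)[of _ 0]) auto
  then obtain N where N: "\<And>n. n \<ge> N \<Longrightarrow> (\<rho> / \<rho>') ^ n < \<eta> * c" by (auto simp: eventually_sequentially)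
  show ?thesis
  proof (intro exI[of _ N] allI impI)
    fix n and v :: su2 assume n: "n \<ge> N" and v: "d \<le> dist v 1"
    have "d\<^sup>2 \<le> (dist v 1)\<^sup>2" using v d by (intro power_mono) auto
    hence "peak v \<le> \<rho>" using dist_one_peak[of v] by (simp add: \<rho>_def)
    hence "peak v ^ n \<le> \<rho> ^ n" using peak_nonneg by (intro power_mono)
    also have "\<dots> = (\<rho> / \<rho>') ^ n * \<rho>' ^ n" using \<rho> by (simp add: power_divide)
    also have "\<dots> \<le> \<eta> * c * \<rho>' ^ n" using N[OF n] \<rho> by (intro mult_right_mono) auto
    also have "\<dots> = \<eta> * (\<rho>' ^ n * c)" by simp
    also have "\<dots> \<le> \<eta> * peak_mass n"
      using peak_mass_lower[OF r(1,2), of n] \<eta> by (intro mult_left_mono) (auto simp: \<rho>'_def c_def)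
    finally show "peak v ^ n \<le> \<eta> * peak_mass n" .
  qed
qed

text \<open>The average is over left translates \<open>f (v * u)\<close>: left-invariant derivatives
  act on the right of \<open>u\<close> and can therefore pass under the integral.\<close>

definition smoothing :: "nat \<Rightarrow> (su2 \<Rightarrow> complex) \<Rightarrow> su2 \<Rightarrow> complex" where
  "smoothing n f u = (\<integral>v. complex_of_real (peak v ^ n) * f (v * u) \<partial>\<mu>) / complex_of_real (peak_mass n)"

lemma translate_continuous:
  assumes "continuous_on UNIV f"
  shows "continuous_on UNIV (\<lambda>v. f (v * (u::su2)))"
  by (rule continuous_on_compose2[OF assms _ subset_UNIV]) (intro continuous_intros)

lemma smoothing_integrable:
  assumes "continuous_on UNIV f"
  shows "integrable \<mu> (\<lambda>v. complex_of_real (peak v ^ n) * f (v * u))"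
  by (intro bounded_measurable_integrable[OF haar_prob'] cont_bm continuous_intros translate_continuous assms)

lemma smoothing_combination:
  assumes "continuous_on UNIV f" "continuous_on UNIV g"
  shows "smoothing n (\<lambda>x. a * f x + b * g x) u = a * smoothing n f u + b * smoothing n g u"
proof -
  have "(\<integral>v. complex_of_real (peak v ^ n) * (a * f (v * u) + b * g (v * u)) \<partial>\<mu>)
    = (\<integral>v. a * (complex_of_real (peak v ^ n) * f (v * u)) + b * (complex_of_real (peak v ^ n) * g (v * u)) \<partial>\<mu>)"
    by (intro Bochner_Integration.integral_cong refl) (simp add: algebra_simps)
  also have "\<dots> = a * (\<integral>v. complex_of_real (peak v ^ n) * f (v * u) \<partial>\<mu>) + b * (\<integral>v. complex_of_real (peak v ^ n) * g (v * u) \<partial>\<mu>)"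
    using smoothing_integrable assms
    by (subst Bochner_Integration.integral_add) (auto intro!: integrable_mult_right simp del: of_real_power)
  finally show ?thesis by (simp add: smoothing_def add_divide_distrib)
qed

lemma smoothing_const: "smoothing n (\<lambda>_. c) u = c"
proof -
  have *: "(\<integral>v. complex_of_real (peak v ^ n) * c \<partial>\<mu>) = complex_of_real (peak_mass n) * c"
    unfolding peak_mass_def integral_complex_of_real[symmetric] by (rule integral_mult_left_zero)
  show ?thesis unfolding smoothing_def * using peak_mass_pos[of n] by simp
qed

text \<open>The hypothesis is shaped for splitting the integral: \<open>B\<close> bounds
  \<open>f\<close> near the identity and is weighted by the kernel, while \<open>C\<close> bounds
  the whole integrand far away and is only divided by the mass.\<close>

lemma smoothing_bound:
  assumes f: "continuous_on UNIV f"
    and B: "\<And>v. cmod (f (v * u)) * peak v ^ n \<le> B * peak v ^ n + C"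
  shows "cmod (smoothing n f u) \<le> B + C / peak_mass n"
proof -
  interpret prob_space \<mu> using haar_prob' .
  have "cmod (\<integral>v. complex_of_real (peak v ^ n) * f (v * u) \<partial>\<mu>) \<le> (\<integral>v. cmod (complex_of_real (peak v ^ n) * f (v * u)) \<partial>\<mu>)"
    by (rule integral_norm_bound)
  also have "\<dots> \<le> (\<integral>v. B * peak v ^ n + C \<partial>\<mu>)"
  proof (rule integral_mono)
    show "integrable \<mu> (\<lambda>v. cmod (complex_of_real (peak v ^ n) * f (v * u)))"
      using smoothing_integrable[OF f] by (rule integrable_norm)
    show "integrable \<mu> (\<lambda>v. B * peak v ^ n + C)" using peak_power_integrable by auto
    fix v show "cmod (complex_of_real (peak v ^ n) * f (v * u)) \<le> B * peak v ^ n + C"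
      using B[of v] peak_nonneg[of v] by (simp add: norm_mult norm_power mult.commute)
  qed
  also have "\<dots> = B * peak_mass n + C"
    using peak_power_integrable[of n] prob_space by (simp add: peak_mass_def)
  finally have "cmod (smoothing n f u) \<le> (B * peak_mass n + C) / peak_mass n"
    using peak_mass_pos[of n] by (simp add: smoothing_def norm_divide divide_right_mono)
  also have "\<dots> = B + C / peak_mass n" using peak_mass_pos[of n] by (simp add: add_divide_distrib)
  finally show ?thesis .
qed

lemma smoothing_approx:
  assumes f: "continuous_on UNIV f" and e: "e > 0"
  shows "\<exists>N. \<forall>n\<ge>N. \<forall>u. cmod (smoothing n f u - f u) \<le> e"
proof -
  have "continuous_on (UNIV \<times> UNIV) (\<lambda>x. f (fst x * snd x))"
    by (rule continuous_on_compose2[OF f _ subset_UNIV]) (intro continuous_intros)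
  moreover have "compact ((UNIV :: su2 set) \<times> (UNIV :: su2 set))" by (intro compact_Times compact_su2)
  ultimately have "uniformly_continuous_on (UNIV \<times> UNIV) (\<lambda>x. f (fst x * snd x))"
    by (rule compact_uniformly_continuous)
  hence "\<exists>d>0. \<forall>x\<in>UNIV \<times> UNIV. \<forall>y\<in>UNIV \<times> UNIV. dist y x < d \<longrightarrow> dist (f (fst y * snd y)) (f (fst x * snd x)) < e / 2"
    using half_gt_zero[OF e] unfolding uniformly_continuous_on_def by blast
  then obtain d where d: "d > 0" "\<And>x y. dist y x < d \<Longrightarrow> dist (f (fst y * snd y)) (f (fst x * snd x)) < e / 2"
    by auto
  have near: "cmod (f (v * u) - f u) \<le> e / 2" if "dist v 1 < d" for v u
    using d(2)[of "(v, u)" "(1, u)"] that by (simp add: dist_Pair_Pair dist_norm)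
  obtain B where B: "\<And>x. cmod (f x) \<le> B" using continuous_bounded_measurable(2)[OF haar f] by blast
  have B0: "B \<ge> 0" using B[of 1] norm_ge_zero[of "f 1"] by linarith
  \<comment> \<open>Chosen so that the far part \<open>2 * B * \<eta>\<close> is at most
    \<open>e / 2\<close>; \<open>B + 1\<close> keeps the denominator positive.\<close>
  define \<eta> where "\<eta> = e / (4 * (B + 1))"
  have \<eta>: "\<eta> > 0" using e B0 by (simp add: \<eta>_def)
  obtain N where N: "\<And>n v. n \<ge> N \<Longrightarrow> d \<le> dist v 1 \<Longrightarrow> peak v ^ n \<le> \<eta> * peak_mass n"
    using peak_concentration[OF d(1) \<eta>] by blast
  show ?thesis
  proof (intro exI[of _ N] allI impI)
    fix n u assume n: "n \<ge> N"
    let ?h = "\<lambda>x. 1 * f x + (- 1) * f u"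
    have ch: "continuous_on UNIV ?h" by (intro continuous_intros f)
    have "smoothing n ?h u = smoothing n f u - f u"
      using smoothing_combination[OF f continuous_on_const[of UNIV "f u"], of n 1 "- 1" u] by (simp add: smoothing_const)
    moreover have "cmod (smoothing n ?h u) \<le> e / 2 + (2 * B * (\<eta> * peak_mass n)) / peak_mass n"
    proof (rule smoothing_bound[OF ch])
      fix v
      have C0: "0 \<le> 2 * B * (\<eta> * peak_mass n)" using B0 \<eta> peak_mass_pos[of n] by simp
      show "cmod (?h (v * u)) * peak v ^ n \<le> e / 2 * peak v ^ n + 2 * B * (\<eta> * peak_mass n)"
      proof (cases "dist v 1 < d")
        case True
        have "cmod (?h (v * u)) * peak v ^ n \<le> e / 2 * peak v ^ n"
          using near[OF True, of u] peak_nonneg[of v] by (intro mult_right_mono) auto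
        thus ?thesis using C0 by linarith
      next
        case False
        have "cmod (?h (v * u)) \<le> 2 * B" using norm_triangle_ineq4[of "f (v * u)" "f u"] B[of "v * u"] B[of u] by simp
        hence "cmod (?h (v * u)) * peak v ^ n \<le> 2 * B * (\<eta> * peak_mass n)"
          using N[OF n, of v] False B0 peak_nonneg[of v] by (intro mult_mono) auto
        moreover have "0 \<le> e / 2 * peak v ^ n" using e peak_nonneg[of v] by simp
        ultimately show ?thesis by linarith
      qed
    qed
    moreover have "(2 * B * (\<eta> * peak_mass n)) / peak_mass n = 2 * B * \<eta>" using peak_mass_pos[of n] by simp
    moreover have "2 * B * \<eta> \<le> e / 2" using B0 e by (simp add: \<eta>_def field_simps)
    ultimately show "cmod (smoothing n f u - f u) \<le> e" by simp
  qed
qed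

text \<open>The remainder of the difference quotient of \<open>f\<close> is small uniformly over the
  group, and averaging against the normalized kernel does not enlarge a uniform bound.\<close>

lemma smoothing_lderiv:
  assumes f: "smooth f"
  shows "lderiv a (smoothing n f) u = smoothing n (lderiv a f) u"
proof -
  note cf = smooth_continuous[OF f] and cg = smooth_lderiv_continuous[OF f, of a]
  have "((\<lambda>s. smoothing n f (u * su2_exp a s)) has_vector_derivative smoothing n (lderiv a f) u) (at 0)"
    unfolding has_vector_derivative_def has_derivative_at_alt
  proof (intro conjI allI impI bounded_linear_scaleR_left)
    fix e :: real assume e: "e > 0"
    obtain d where d: "d > 0" "\<And>u s. \<bar>s\<bar> < d \<Longrightarrow> cmod (f (u * su2_exp a s) - f u - s *\<^sub>R lderiv a f u) \<le> e * \<bar>s\<bar>"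
      using smooth_uniform_derivative[OF f e] by blast
    show "\<exists>d>0. \<forall>s. norm (s - 0) < d \<longrightarrow>
      norm (smoothing n f (u * su2_exp a s) - smoothing n f (u * su2_exp a 0) - (s - 0) *\<^sub>R smoothing n (lderiv a f) u) \<le> e * norm (s - 0)"
    proof (intro exI[of _ d] conjI allI impI d(1))
      fix s :: real assume s: "norm (s - 0) < d"
      let ?f1 = "\<lambda>x. f (x * su2_exp a s)"
      let ?f2 = "\<lambda>x. 1 * ?f1 x + (- 1) * f x"
      let ?h = "\<lambda>x. 1 * ?f2 x + (- of_real s) * lderiv a f x"
      have c1: "continuous_on UNIV ?f1" by (rule translate_continuous[OF cf])
      have c2: "continuous_on UNIV ?f2" by (intro continuous_intros c1 cf)
      have ch: "continuous_on UNIV ?h" by (intro continuous_intros c1 cf cg)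
      have "smoothing n ?h u = smoothing n ?f1 u - smoothing n f u - of_real s * smoothing n (lderiv a f) u"
        unfolding smoothing_combination[OF c2 cg] smoothing_combination[OF c1 cf] by simp
      also have "smoothing n ?f1 u = smoothing n f (u * su2_exp a s)"
        by (simp add: smoothing_def mult.assoc)
      finally have eq: "smoothing n f (u * su2_exp a s) - smoothing n f (u * su2_exp a 0) - (s - 0) *\<^sub>R smoothing n (lderiv a f) u
         = smoothing n ?h u" by (simp add: su2_exp_0 scaleR_conv_of_real)
      have "cmod (smoothing n ?h u) \<le> e * \<bar>s\<bar> + 0 / peak_mass n"
      proof (rule smoothing_bound[OF ch])
        fix v
        have "cmod (?h (v * u)) \<le> e * \<bar>s\<bar>" using d(2)[of s "v * u"] s by (simp add: scaleR_conv_of_real)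
        thus "cmod (?h (v * u)) * peak v ^ n \<le> e * \<bar>s\<bar> * peak v ^ n + 0"
          using peak_nonneg[of v] by (simp add: mult_right_mono)
      qed
      thus "norm (smoothing n f (u * su2_exp a s) - smoothing n f (u * su2_exp a 0) - (s - 0) *\<^sub>R smoothing n (lderiv a f) u) \<le> e * norm (s - 0)"
        unfolding eq by simp
    qed
  qed
  from vector_derivative_at[OF this] show ?thesis by (simp only: lderiv_def[of a "smoothing n f" u])
qed

lemma smoothing_lderivs:
  assumes "smooth f"
  shows "lderivs w (smoothing n f) = smoothing n (lderivs w f)"
proof (induction w)
  case (Cons a w)
  have "lderiv a (smoothing n (lderivs w f)) = smoothing n (lderiv a (lderivs w f))"
    by (rule ext, rule smoothing_lderiv[OF smooth_lderivs[OF assms]])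
  thus ?case by (simp only: lderivs.simps Cons.IH)
qed simp

section \<open>Characters and convolution with class functions\<close>

definition conj_character :: "nat \<Rightarrow> su2 \<Rightarrow> complex" where
  "conj_character k u = (\<Sum>i<Suc k. cnj (t k u $$ (i, i)))"

lemma conj_character_monom: "conj_character k u = cnj (\<Sum>i<Suc k. monom_rep k u $$ (i, i))"
  unfolding conj_character_def cnj_sum[symmetric] t_trace ..

lemma conj_character_conjugate: "conj_character k (inverse g * d * g) = conj_character k d"
proof -
  have tr: "(\<Sum>i<Suc k. t k (u * v) $$ (i, i)) = (\<Sum>i<Suc k. t k (v * u) $$ (i, i))" for u v
  proof -
    have "(\<Sum>i<Suc k. t k (u * v) $$ (i, i)) = (\<Sum>i<Suc k. \<Sum>j<Suc k. t k u $$ (i, j) * t k v $$ (j, i))"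
      by (rule sum.cong[OF refl]) (simp add: t_mult_index)
    also have "\<dots> = (\<Sum>j<Suc k. \<Sum>i<Suc k. t k v $$ (j, i) * t k u $$ (i, j))"
      by (subst sum.swap) (simp only: mult.commute)
    also have "\<dots> = (\<Sum>i<Suc k. t k (v * u) $$ (i, i))"
      by (rule sum.cong[OF refl]) (simp add: t_mult_index)
    finally show ?thesis .
  qed
  have "(\<Sum>i<Suc k. t k (inverse g * d * g) $$ (i, i)) = (\<Sum>i<Suc k. t k (g * (inverse g * d)) $$ (i, i))"
    by (rule tr)
  thus ?thesis by (simp only: conj_character_def cnj_sum[symmetric] su2_inverse_mult_cancel)
qed

text \<open>Characters are class functions, so diagonalization reduces them to a sum over weights.
  The same pair of conjugated eigenvalues serves every \<open>k\<close>, which is what makes a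
  recurrence in \<open>k\<close> possible.\<close>

lemma conj_character_formula:
  "\<exists>\<alpha> \<beta>. \<alpha> * \<beta> = 1 \<and> (\<forall>k. conj_character k u = (\<Sum>i<Suc k. \<alpha> ^ i * \<beta> ^ (k - i)))"
proof -
  obtain g d where gd: "u = inverse g * d * g" "su2_entry d 1 2 = 0" "su2_entry d 2 1 = 0"
    using su2_diagonalize by blast
  define \<alpha> \<beta> where "\<alpha> = cnj (su2_entry d 1 1)" and "\<beta> = cnj (su2_entry d 2 2)"
  have "(cmod (su2_entry d 1 1))\<^sup>2 = 1" using su2_entries(3)[of d] gd by simp
  hence "complex_of_real ((cmod (su2_entry d 1 1))\<^sup>2) = 1" by simp
  hence "\<alpha> * \<beta> = 1" unfolding complex_norm_square using su2_entries(1)[of d] by (simp add: \<alpha>_def \<beta>_def mult.commute)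
  moreover have "conj_character k u = (\<Sum>i<Suc k. \<alpha> ^ i * \<beta> ^ (k - i))" for k
  proof -
    have "conj_character k u = conj_character k d" unfolding gd(1) by (rule conj_character_conjugate)
    also have "\<dots> = (\<Sum>i<Suc k. \<alpha> ^ i * \<beta> ^ (k - i))"
    unfolding conj_character_monom cnj_sum
    using gd(2,3) by (intro sum.cong refl) (simp add: monom_rep_diag less_Suc_eq_le \<alpha>_def \<beta>_def)
    finally show ?thesis .
  qed
  ultimately show ?thesis by blast
qed

lemma conj_character_0: "conj_character 0 u = 1"
proof -
  obtain \<alpha> \<beta> where "\<forall>k. conj_character k u = (\<Sum>i<Suc k. \<alpha> ^ i * \<beta> ^ (k - i))"
    using conj_character_formula by blast
  thus ?thesis by (simp add: sum.lessThan_Suc)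
qed

text \<open>The Clebsch-Gordan rule for tensoring with the two-dimensional representation.\<close>

lemma conj_character_recurrence:
  "conj_character 1 u * conj_character (Suc k) u = conj_character (Suc (Suc k)) u + conj_character k u"
proof -
  obtain \<alpha> \<beta> where ab: "\<alpha> * \<beta> = 1" and c: "\<And>k. conj_character k u = (\<Sum>i<Suc k. \<alpha> ^ i * \<beta> ^ (k - i))"
    using conj_character_formula by blast
  have step: "conj_character (Suc k) u = \<alpha> * conj_character k u + \<beta> ^ Suc k" for k
  proof -
    have "conj_character (Suc k) u = \<beta> ^ Suc k + (\<Sum>i<Suc k. \<alpha> ^ Suc i * \<beta> ^ (k - i))"
      unfolding c by (subst sum.lessThan_Suc_shift) simp
    thus ?thesis unfolding c by (simp add: sum_distrib_left mult.assoc)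
  qed
  have "conj_character 1 u = \<alpha> + \<beta>" unfolding c by (simp add: sum.lessThan_Suc)
  hence "conj_character 1 u * conj_character (Suc k) u
      = \<alpha> * conj_character (Suc k) u + \<beta> * (\<alpha> * conj_character k u + \<beta> ^ Suc k)"
    by (simp add: distrib_right step)
  also have "\<dots> = (\<alpha> * conj_character (Suc k) u + \<beta> ^ Suc (Suc k)) + (\<alpha> * \<beta>) * conj_character k u"
    by (simp add: algebra_simps)
  finally show ?thesis unfolding ab step[of "Suc k", symmetric] by simp
qed

lemma peak_conj_character: "complex_of_real (peak u) = (2 + conj_character 1 u) / 4"
proof -
  have h: "hom_monom (Suc 0) 0 z = vec_nth z 2" "hom_monom (Suc 0) (Suc 0) z = vec_nth z 1" for z
    by (simp_all add: hom_monom_def)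
  have at1: "{..Suc 0} = {0, Suc 0}" by auto
  have "monom_rep (Suc 0) u $$ (0, 0) = (if (0::nat) = 0 then su2_entry u 2 2 else su2_entry u 1 2)"
    by (rule monom_rep_entry[where c = "\<lambda>i. if i = 0 then su2_entry u 2 2 else su2_entry u 1 2"])
      (simp_all add: at1 h vec_mult_nth mult.commute)
  moreover have "monom_rep (Suc 0) u $$ (Suc 0, Suc 0) = (if Suc 0 = 0 then su2_entry u 2 1 else su2_entry u 1 1)"
    by (rule monom_rep_entry[where c = "\<lambda>i. if i = 0 then su2_entry u 2 1 else su2_entry u 1 1"])
      (simp_all add: at1 h vec_mult_nth mult.commute)
  ultimately have "conj_character 1 u = cnj (su2_entry u 2 2 + su2_entry u 1 1)"
    unfolding conj_character_monom by (simp add: sum.lessThan_Suc)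
  also have "\<dots> = 2 * complex_of_real (Re (su2_entry u 1 1))"
    using su2_entries(1)[of u] by (simp add: complex_eq_iff)
  finally show ?thesis by (simp add: peak_def)
qed

text \<open>A linear span suffices: the peak function is affine in \<open>conj_character 1\<close>,
  so its powers require only closure under multiplication by that one character.\<close>

inductive char_poly :: "(su2 \<Rightarrow> complex) \<Rightarrow> bool" where
  char_poly_zero: "char_poly (\<lambda>_. 0)"
| char_poly_character: "char_poly (conj_character k)"
| char_poly_combination: "char_poly f \<Longrightarrow> char_poly g \<Longrightarrow> char_poly (\<lambda>u. a * f u + b * g u)"

lemma char_poly_mult: "char_poly f \<Longrightarrow> char_poly (\<lambda>u. conj_character 1 u * f u)"
proof (induction rule: char_poly.induct)
  case char_poly_zero
  show ?case using char_poly.char_poly_zero by simp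
next
  case (char_poly_character k)
  show ?case
  proof (cases k)
    case 0
    thus ?thesis using char_poly.char_poly_character[of 1] by (simp add: conj_character_0)
  next
    case (Suc l)
    have "char_poly (\<lambda>u. 1 * conj_character (Suc (Suc l)) u + 1 * conj_character l u)"
      by (intro char_poly.intros)
    thus ?thesis unfolding Suc conj_character_recurrence by simp
  qed
next
  case (char_poly_combination f g a b)
  have "char_poly (\<lambda>u. a * (conj_character 1 u * f u) + b * (conj_character 1 u * g u))"
    by (intro char_poly.intros(3) char_poly_combination.IH)
  thus ?case by (simp add: algebra_simps)
qed

lemma char_poly_peak: "char_poly (\<lambda>u. complex_of_real (peak u ^ n))"
proof (induction n)
  case 0
  have "conj_character 0 = (\<lambda>_. 1)" using conj_character_0 by auto
  thus ?case using char_poly_character[of 0] by simp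
next
  case (Suc n)
  have "char_poly (\<lambda>u. 1 / 2 * complex_of_real (peak u ^ n) + 1 / 4 * (conj_character 1 u * complex_of_real (peak u ^ n)))"
    by (intro char_poly.intros(3) char_poly_mult Suc)
  thus ?case by (simp add: peak_conj_character field_simps)
qed

lemma char_poly_continuous: "char_poly f \<Longrightarrow> continuous_on UNIV f"
proof (induction rule: char_poly.induct)
  case (char_poly_character k)
  show ?case unfolding conj_character_def by (intro continuous_intros t_continuous) auto
qed (intro continuous_intros; assumption)+

text \<open>The matrix \<open>t k (u * inverse v)\<close> factors by the homomorphism property;
  integrating over \<open>v\<close> leaves fixed coefficients in front of the conjugated entries of
  \<open>t k u\<close>.\<close>

lemma char_poly_convolution:
  assumes "char_poly K" and \<phi>: "continuous_on UNIV \<phi>"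
  shows "trig_poly (\<lambda>u. \<integral>v. K (u * inverse v) * \<phi> v \<partial>\<mu>)"
  using assms(1)
proof (induction rule: char_poly.induct)
  case char_poly_zero
  show ?case using trig_poly_zero by simp
next
  case (char_poly_character k)
  define c where "c = (\<lambda>m i. \<integral>v. cnj (t k (inverse v) $$ (m, i)) * \<phi> v \<partial>\<mu>)"
  have "(\<integral>v. conj_character k (u * inverse v) * \<phi> v \<partial>\<mu>)
     = (\<Sum>i<Suc k. \<Sum>m<Suc k. c m i * cnj (t k u $$ (i, m)))" for u
  proof -
    have int: "integrable \<mu> (\<lambda>v. cnj (t k u $$ (i, m)) * (cnj (t k (inverse v) $$ (m, i)) * \<phi> v))"
      if "m \<in> {..<Suc k}" "i \<in> {..<Suc k}" for m i
      using that by (intro integrable_mult_right bounded_measurable_integrable[OF haar_prob'] cont_bm continuous_intros t_continuous \<phi>) auto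
    have "(\<integral>v. conj_character k (u * inverse v) * \<phi> v \<partial>\<mu>)
      = (\<integral>v. (\<Sum>i<Suc k. \<Sum>m<Suc k. cnj (t k u $$ (i, m)) * (cnj (t k (inverse v) $$ (m, i)) * \<phi> v)) \<partial>\<mu>)"
      unfolding conj_character_def sum_distrib_right
    proof (intro Bochner_Integration.integral_cong refl sum.cong)
      fix v i assume "i \<in> {..<Suc k}"
      hence i: "i < Suc k" by simp
      show "cnj (t k (u * inverse v) $$ (i, i)) * \<phi> v = (\<Sum>m<Suc k. cnj (t k u $$ (i, m)) * (cnj (t k (inverse v) $$ (m, i)) * \<phi> v))"
        unfolding t_mult_index[OF i i] cnj_sum sum_distrib_right by (intro sum.cong refl) (simp add: mult.assoc)
    qed
    also have "\<dots> = (\<Sum>i<Suc k. \<integral>v. (\<Sum>m<Suc k. cnj (t k u $$ (i, m)) * (cnj (t k (inverse v) $$ (m, i)) * \<phi> v)) \<partial>\<mu>)"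
      using int by (intro Bochner_Integration.integral_sum Bochner_Integration.integrable_sum)
    also have "\<dots> = (\<Sum>i<Suc k. \<Sum>m<Suc k. \<integral>v. cnj (t k u $$ (i, m)) * (cnj (t k (inverse v) $$ (m, i)) * \<phi> v) \<partial>\<mu>)"
      using int by (intro sum.cong refl Bochner_Integration.integral_sum)
    also have "\<dots> = (\<Sum>i<Suc k. \<Sum>m<Suc k. c m i * cnj (t k u $$ (i, m)))"
      unfolding c_def by (simp only: integral_mult_right_zero mult.commute)
    finally show ?thesis .
  qed
  moreover have "trig_poly (\<lambda>u. \<Sum>i<Suc k. \<Sum>m<Suc k. c m i * cnj (t k u $$ (i, m)))"
    by (intro trig_poly_sum trig_poly_scale trig_poly_coeff) auto
  ultimately show ?case by simp
next
  case (char_poly_combination f g a b)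
  have int: "integrable \<mu> (\<lambda>v. h (u * inverse v) * \<phi> v)" if "char_poly h" for h u
    by (intro bounded_measurable_integrable[OF haar_prob'] cont_bm continuous_intros \<phi>
        continuous_on_compose2[OF char_poly_continuous[OF that] _ subset_UNIV])
  have "(\<integral>v. (a * f (u * inverse v) + b * g (u * inverse v)) * \<phi> v \<partial>\<mu>)
    = a * (\<integral>v. f (u * inverse v) * \<phi> v \<partial>\<mu>) + b * (\<integral>v. g (u * inverse v) * \<phi> v \<partial>\<mu>)" for u
  proof -
    have "(\<integral>v. (a * f (u * inverse v) + b * g (u * inverse v)) * \<phi> v \<partial>\<mu>)
      = (\<integral>v. a * (f (u * inverse v) * \<phi> v) + b * (g (u * inverse v) * \<phi> v) \<partial>\<mu>)"
      by (intro Bochner_Integration.integral_cong refl) (simp add: algebra_simps)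
    thus ?thesis using int[OF char_poly_combination.hyps(1)] int[OF char_poly_combination.hyps(2)] by simp
  qed
  with trig_poly_combination[OF char_poly_combination.IH] show ?case by simp
qed

text \<open>Right invariance moves \<open>u\<close> from the argument of \<phi> into the kernel, and
  the symmetry of the peak under inversion turns \<open>v * inverse u\<close> into
  \<open>u * inverse v\<close>, which is the form of the convolution lemma.\<close>

lemma smoothing_trig_poly:
  assumes \<phi>: "continuous_on UNIV \<phi>"
  shows "trig_poly (smoothing n \<phi>)"
proof -
  have "smoothing n \<phi> u = 1 / complex_of_real (peak_mass n) * (\<integral>v. complex_of_real (peak (u * inverse v) ^ n) * \<phi> v \<partial>\<mu>)" for u
  proof -
    let ?F = "\<lambda>v. complex_of_real (peak (v * inverse u) ^ n) * \<phi> v"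
    have "continuous_on UNIV ?F" by (intro continuous_intros \<phi>)
    from haar_right[OF haar this, of u]
    have "(\<integral>v. complex_of_real (peak v ^ n) * \<phi> (v * u) \<partial>\<mu>) = (\<integral>v. ?F v \<partial>\<mu>)"
      by (simp add: mult.assoc su2_right_inverse)
    moreover have "peak (v * inverse u) = peak (u * inverse v)" for v
      using peak_inverse[of "v * inverse u"] by (simp add: su2_inverse_mult su2_inverse_inverse)
    ultimately show ?thesis by (simp add: smoothing_def)
  qed
  hence "smoothing n \<phi> = (\<lambda>u. 1 / complex_of_real (peak_mass n) * (\<integral>v. complex_of_real (peak (u * inverse v) ^ n) * \<phi> v \<partial>\<mu>))"
    by (rule ext)
  with trig_poly_scale[OF char_poly_convolution[OF char_poly_peak[of n] \<phi>], of "1 / complex_of_real (peak_mass n)"]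
  show ?thesis by (simp only:)
qed

text \<open>Smoothing commutes with derivatives and a seminorm involves finitely many words, so one
  \<open>n\<close> serves all of them. The difference is written with coefficients 1 and -1 to match
  the lemmas on linear combinations.\<close>

lemma trig_poly_dense:
  assumes \<phi>: "smooth \<phi>" and e: "e > 0"
  shows "\<exists>\<psi>. trig_poly \<psi> \<and> (\<forall>u. cmod (\<psi> u - \<phi> u) \<le> e) \<and> smooth_seminorm m (\<lambda>u. 1 * \<psi> u + (- 1) * \<phi> u) \<le> e"
proof -
  have "\<forall>\<^sub>F n in sequentially. \<forall>w\<in>{w. length w \<le> m}. \<forall>u. cmod (smoothing n (lderivs w \<phi>) u - lderivs w \<phi> u) \<le> e"
  proof (intro eventually_ball_finite finite_su2_words ballI)
    fix w :: "su2_axis list"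
    show "\<forall>\<^sub>F n in sequentially. \<forall>u. cmod (smoothing n (lderivs w \<phi>) u - lderivs w \<phi> u) \<le> e"
      using smoothing_approx[OF smooth_continuous[OF smooth_lderivs[OF \<phi>]] e] by (simp add: eventually_sequentially)
  qed
  then obtain n where n: "\<And>w u. length w \<le> m \<Longrightarrow> cmod (smoothing n (lderivs w \<phi>) u - lderivs w \<phi> u) \<le> e"
    using eventually_happens'[OF sequentially_bot] by blast
  note tp = smoothing_trig_poly[OF smooth_continuous[OF \<phi>], of n]
  have "smooth_seminorm m (\<lambda>u. 1 * smoothing n \<phi> u + (- 1) * \<phi> u) \<le> e"
    unfolding smooth_seminorm_def lderivs_combination[OF trig_poly_smooth[OF tp] \<phi>] smoothing_lderivs[OF \<phi>]
  proof (rule cSUP_least)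
    show "{w::su2_axis list. length w \<le> m} \<times> (UNIV :: su2 set) \<noteq> {}" by (auto intro!: exI[of _ "[]"])
  qed (use n in auto)
  with tp n[of "[]"] show ?thesis by (intro exI[of _ "smoothing n \<phi>"]) auto
qed

text \<open>Both functionals are continuous, but differently: \<open>T\<close> for a seminorm with
  derivatives, the integral against \<open>g\<close> for the supremum norm. This is why the density
  lemma supplies both estimates for the same \<psi>.\<close>

theorem represents_if_coefficients_agree:
  assumes T: "distribution T" and g: "integrable \<mu> g"
    and eq: "\<And>k i j. i < Suc k \<Longrightarrow> j < Suc k \<Longrightarrow>
      T (\<lambda>u. cnj (t k u $$ (i, j))) = (\<integral>u. g u * cnj (t k u $$ (i, j)) \<partial>\<mu>)"
  shows "represents \<mu> g T"
proof -
  have lin: "T (\<lambda>u. a * f u + b * h u) = a * T f + b * T h" if "smooth f" "smooth h" for f h a b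
    using T that unfolding distribution_def linear_functional_def by blast
  have int: "integrable \<mu> (\<lambda>u. g u * f u)" if f: "continuous_on UNIV f" for f
  proof -
    obtain B where B: "\<And>x. cmod (f x) \<le> B" using continuous_bounded_measurable(2)[OF haar f] by blast
    have "integrable \<mu> (\<lambda>u. B * cmod (g u))" using g by simp
    thus ?thesis
    proof (rule Bochner_Integration.integrable_bound)
      show "(\<lambda>u. g u * f u) \<in> borel_measurable \<mu>"
        using g continuous_bounded_measurable(1)[OF haar f] by (intro borel_measurable_times) auto
      have B0: "B \<ge> 0" using B[of 1] norm_ge_zero[of "f 1"] by linarith
      show "AE u in \<mu>. norm (g u * f u) \<le> norm (B * cmod (g u))"
        using B B0 by (intro AE_I2) (simp add: norm_mult mult.commute mult_right_mono)
    qed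
  qed
  have trig: "T \<psi> = (\<integral>u. g u * \<psi> u \<partial>\<mu>)" if "trig_poly \<psi>" for \<psi>
    using that
  proof (induction rule: trig_poly.induct)
    case trig_poly_zero
    have "smooth (\<lambda>_. 0)" using trig_poly_smooth[OF trig_poly.trig_poly_zero] .
    from lin[OF this this, of 0 0] show ?case by simp
  next
    case (trig_poly_coeff i k j)
    thus ?case by (rule eq)
  next
    case (trig_poly_combination f h a b)
    have sf: "smooth f" "smooth h" using trig_poly_combination.hyps trig_poly_smooth by auto
    have "(\<integral>u. g u * (a * f u + b * h u) \<partial>\<mu>) = (\<integral>u. a * (g u * f u) + b * (g u * h u) \<partial>\<mu>)"
      by (intro Bochner_Integration.integral_cong refl) (simp add: algebra_simps)
    also have "\<dots> = a * (\<integral>u. g u * f u \<partial>\<mu>) + b * (\<integral>u. g u * h u \<partial>\<mu>)"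
      using int[OF smooth_continuous[OF sf(1)]] int[OF smooth_continuous[OF sf(2)]] by simp
    finally show ?case using lin[OF sf] trig_poly_combination.IH by simp
  qed
  obtain m C where mC: "\<And>f. smooth f \<Longrightarrow> cmod (T f) \<le> C * smooth_seminorm m f"
    using T unfolding distribution_def continuous_functional_def by blast
  show ?thesis
    unfolding represents_def
  proof (intro allI impI)
    fix \<phi> assume \<phi>: "smooth \<phi>"
    define D where "D = \<bar>C\<bar> + (\<integral>u. cmod (g u) \<partial>\<mu>)"
    have D0: "D \<ge> 0" by (simp add: D_def)
    have le: "cmod (T \<phi> - (\<integral>u. g u * \<phi> u \<partial>\<mu>)) \<le> e" if e: "e > 0" for e
    proof -
      define e' where "e' = e / (D + 1)"
      have e': "e' > 0" using e D0 by (simp add: e'_def)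
      obtain \<psi> where \<psi>: "trig_poly \<psi>" "\<And>u. cmod (\<psi> u - \<phi> u) \<le> e'"
        "smooth_seminorm m (\<lambda>u. 1 * \<psi> u + (- 1) * \<phi> u) \<le> e'"
        using trig_poly_dense[OF \<phi> e', of m] by blast
      have s\<psi>: "smooth \<psi>" by (rule trig_poly_smooth[OF \<psi>(1)])
      have "cmod (T \<psi> - T \<phi>) = cmod (T (\<lambda>u. 1 * \<psi> u + (- 1) * \<phi> u))"
        using lin[OF s\<psi> \<phi>, of 1 "- 1"] by simp
      also have "\<dots> \<le> \<bar>C\<bar> * e'"
      proof -
        let ?s = "smooth_seminorm m (\<lambda>u. 1 * \<psi> u + (- 1) * \<phi> u)"
        have le: "cmod (T (\<lambda>u. 1 * \<psi> u + (- 1) * \<phi> u)) \<le> C * ?s"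
          by (rule mC[OF smooth_combination[OF s\<psi> \<phi>]])
        \<comment> \<open>Without boundedness the real supremum in \<open>smooth_seminorm\<close>
          would carry no information. It shows that the seminorm is nonnegative, so that
          \<open>C\<close>, whose sign is unknown, may be replaced by its absolute value.\<close>
        have bdd: "bdd_above ((\<lambda>(w, u). cmod (lderivs w (\<lambda>u. 1 * \<psi> u + (- 1) * \<phi> u) u)) ` ({w. length w \<le> m} \<times> UNIV))"
        proof -
          have "\<forall>w. \<exists>B. \<forall>u. cmod (lderivs w (\<lambda>u. 1 * \<psi> u + (- 1) * \<phi> u) u) \<le> B"
            using continuous_bounded_measurable(2)[OF haar smooth_continuous[OF smooth_lderivs[OF smooth_combination[OF s\<psi> \<phi>]]]] by blast
          from choice[OF this] obtain B where B: "\<forall>w u. cmod (lderivs w (\<lambda>u. 1 * \<psi> u + (- 1) * \<phi> u) u) \<le> B w" by blast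
          have Bs: "B w \<le> (\<Sum>w\<in>{w. length w \<le> m}. \<bar>B w\<bar>)" if "length w \<le> m" for w
            using member_le_sum[of w "{w. length w \<le> m}" "\<lambda>w. \<bar>B w\<bar>"] finite_su2_words[of m] that by force
          show ?thesis
          proof (rule bdd_aboveI2)
            fix x :: "su2_axis list \<times> su2" assume "x \<in> {w. length w \<le> m} \<times> UNIV"
            then obtain w u where x: "x = (w, u)" "length w \<le> m" by (cases x) auto
            show "(case x of (w, u) \<Rightarrow> cmod (lderivs w (\<lambda>u. 1 * \<psi> u + (- 1) * \<phi> u) u)) \<le> (\<Sum>w\<in>{w. length w \<le> m}. \<bar>B w\<bar>)"
              unfolding x(1) prod.case by (rule order_trans[OF B[rule_format] Bs[OF x(2)]])
          qed
        qed
        have "0 \<le> cmod (lderivs [] (\<lambda>u. 1 * \<psi> u + (- 1) * \<phi> u) 1)" by simp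
        also have "\<dots> \<le> ?s" unfolding smooth_seminorm_def
          by (rule order_trans[OF _ cSUP_upper[OF _ bdd, of "([], 1)"]]) simp_all
        finally have "0 \<le> ?s" .
        have "C * ?s \<le> \<bar>C\<bar> * ?s" using \<open>0 \<le> ?s\<close> by (intro mult_right_mono) auto
        also have "\<dots> \<le> \<bar>C\<bar> * e'" using \<psi>(3) by (intro mult_left_mono) auto
        finally show ?thesis using le by linarith
      qed
      finally have 1: "cmod (T \<psi> - T \<phi>) \<le> \<bar>C\<bar> * e'" .
      have "(\<integral>u. g u * \<psi> u \<partial>\<mu>) - (\<integral>u. g u * \<phi> u \<partial>\<mu>) = (\<integral>u. g u * (\<psi> u - \<phi> u) \<partial>\<mu>)"
        using int[OF smooth_continuous[OF s\<psi>]] int[OF smooth_continuous[OF \<phi>]] by (simp add: right_diff_distrib)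
      also have "cmod \<dots> \<le> (\<integral>u. cmod (g u) * e' \<partial>\<mu>)"
      proof (rule order_trans[OF integral_norm_bound integral_mono'])
        show "integrable \<mu> (\<lambda>u. cmod (g u) * e')" using g by simp
        fix u show "norm (g u * (\<psi> u - \<phi> u)) \<le> cmod (g u) * e'"
          unfolding norm_mult using \<psi>(2)[of u] by (intro mult_left_mono) auto
        show "0 \<le> cmod (g u) * e'" using e' by simp
      qed
      finally have 2: "cmod ((\<integral>u. g u * \<psi> u \<partial>\<mu>) - (\<integral>u. g u * \<phi> u \<partial>\<mu>)) \<le> (\<integral>u. cmod (g u) \<partial>\<mu>) * e'" by simp
      have "cmod (T \<phi> - (\<integral>u. g u * \<phi> u \<partial>\<mu>)) \<le> cmod (T \<psi> - T \<phi>) + cmod ((\<integral>u. g u * \<psi> u \<partial>\<mu>) - (\<integral>u. g u * \<phi> u \<partial>\<mu>))"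
        using norm_triangle_ineq4[of "(\<integral>u. g u * \<psi> u \<partial>\<mu>) - (\<integral>u. g u * \<phi> u \<partial>\<mu>)" "T \<psi> - T \<phi>"] trig[OF \<psi>(1)]
        by (simp add: algebra_simps)
      also have "\<dots> \<le> D * e'" using 1 2 by (simp add: D_def distrib_right)
      also have "\<dots> \<le> e" using D0 e by (simp add: e'_def field_simps)
      finally show ?thesis .
    qed
    have "cmod (T \<phi> - (\<integral>u. g u * \<phi> u \<partial>\<mu>)) \<le> 0"
    proof (rule field_le_epsilon)
      fix e :: real assume "0 < e"
      thus "cmod (T \<phi> - (\<integral>u. g u * \<phi> u \<partial>\<mu>)) \<le> 0 + e" using le by simp
    qed
    thus "T \<phi> = (\<integral>u. g u * \<phi> u \<partial>\<mu>)" by simp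
  qed
qed

end

section \<open>Limits bounded in the q-th mean\<close>

lemma (in prob_space) L1_le_L2:
  fixes X :: "'a \<Rightarrow> real"
  assumes "integrable M X" "integrable M (\<lambda>x. (X x)\<^sup>2)"
  shows "expectation X \<le> sqrt (expectation (\<lambda>x. (X x)\<^sup>2))"
proof -
  have "0 \<le> variance X" by simp
  also have "variance X = expectation (\<lambda>x. (X x)\<^sup>2) - (expectation X)\<^sup>2"
    by (rule variance_eq[OF assms])
  finally have "(expectation X)\<^sup>2 \<le> expectation (\<lambda>x. (X x)\<^sup>2)" by simp
  thus ?thesis by (rule real_le_rsqrt)
qed

text \<open>The bound is asked only eventually, since for the differences
  \<open>G (r j) - G m\<close> it holds only once \<open>r j\<close> has passed
  \<open>m\<close>.\<close>

lemma fatou_bound: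
  fixes F :: "nat \<Rightarrow> 'a \<Rightarrow> real"
  assumes F: "\<And>j. integrable M (F j)" "\<And>j x. 0 \<le> F j x" and f: "f \<in> borel_measurable M" "\<And>x. 0 \<le> f x"
    and conv: "AE x in M. (\<lambda>j. F j x) \<longlonglongrightarrow> f x"
    and B: "eventually (\<lambda>j. (\<integral>x. F j x \<partial>M) \<le> B) sequentially"
  shows "integrable M f" and "(\<integral>x. f x \<partial>M) \<le> B"
proof -
  have Fm: "F j \<in> borel_measurable M" for j using F(1) by (rule borel_measurable_integrable)
  obtain j0 where "(\<integral>x. F j0 x \<partial>M) \<le> B" using eventually_happens'[OF sequentially_bot B] by blast
  moreover have "0 \<le> (\<integral>x. F j0 x \<partial>M)" using F(2) by simp
  ultimately have B0: "B \<ge> 0" by linarith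
  have "(\<integral>\<^sup>+x. ennreal (f x) \<partial>M) = (\<integral>\<^sup>+x. liminf (\<lambda>j. ennreal (F j x)) \<partial>M)"
  proof (rule nn_integral_cong_AE)
    show "AE x in M. ennreal (f x) = liminf (\<lambda>j. ennreal (F j x))"
      using conv
    proof eventually_elim
      case (elim x)
      hence "(\<lambda>j. ennreal (F j x)) \<longlonglongrightarrow> ennreal (f x)" by (rule tendsto_ennrealI)
      thus ?case by (rule lim_imp_Liminf[OF sequentially_bot, symmetric])
    qed
  qed
  also have "\<dots> \<le> liminf (\<lambda>j. \<integral>\<^sup>+x. ennreal (F j x) \<partial>M)"
    using Fm by (intro nn_integral_liminf) auto
  also have "\<dots> \<le> limsup (\<lambda>j. \<integral>\<^sup>+x. ennreal (F j x) \<partial>M)"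
    by (rule Liminf_le_Limsup[OF sequentially_bot])
  also have "\<dots> \<le> ennreal B"
  proof (rule Limsup_bounded)
    show "\<forall>\<^sub>F j in sequentially. (\<integral>\<^sup>+x. ennreal (F j x) \<partial>M) \<le> ennreal B"
      using B
    proof eventually_elim
      case (elim j)
      have "(\<integral>\<^sup>+x. ennreal (F j x) \<partial>M) = ennreal (\<integral>x. F j x \<partial>M)"
        using F by (intro nn_integral_eq_integral) auto
      thus ?case using elim by (simp add: ennreal_leI)
    qed
  qed
  finally have le: "(\<integral>\<^sup>+x. ennreal (f x) \<partial>M) \<le> ennreal B" .
  show i: "integrable M f"
    using f le by (intro integrableI_nonneg) (auto intro: le_less_trans)
  have "(\<integral>\<^sup>+x. ennreal (f x) \<partial>M) = ennreal (\<integral>x. f x \<partial>M)"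
    using f i by (intro nn_integral_eq_integral) auto
  thus "(\<integral>x. f x \<partial>M) \<le> B" using le B0 by (simp add: ennreal_le_iff)
qed

text \<open>A rapidly converging subsequence has a pointwise limit almost everywhere, and Fatou's
  lemma passes the bound on q-th powers to that limit. The L1 Cauchy property then gives convergence
  of the whole sequence against bounded functions.\<close>

lemma L1_cauchy_limit:
  fixes G :: "nat \<Rightarrow> 'a \<Rightarrow> complex"
  assumes P: "prob_space \<mu>" and G: "\<And>n. bounded_measurable \<mu> (G n)"
    and cauchy: "\<And>e. e > 0 \<Longrightarrow> \<exists>N. \<forall>m\<ge>N. \<forall>n\<ge>m. (\<integral>x. cmod (G n x - G m x) \<partial>\<mu>) \<le> e"
    and q: "q > 0" and B: "\<And>n. (\<integral>x. cmod (G n x) powr q \<partial>\<mu>) \<le> B"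
  obtains g where "g \<in> borel_measurable \<mu>" "integrable \<mu> g" "integrable \<mu> (\<lambda>x. cmod (g x) powr q)"
    "(\<integral>x. cmod (g x) powr q \<partial>\<mu>) \<le> B"
    "\<And>\<phi>. bounded_measurable \<mu> \<phi> \<Longrightarrow> (\<lambda>n. \<integral>x. G n x * \<phi> x \<partial>\<mu>) \<longlonglongrightarrow> (\<integral>x. g x * \<phi> x \<partial>\<mu>)"
proof -
  interpret prob_space \<mu> by fact
  have Gm [measurable]: "G n \<in> borel_measurable \<mu>" for n
    using G unfolding bounded_measurable_def by blast
  have Gi: "integrable \<mu> (G n)" for n by (rule bounded_measurable_integrable[OF P G])
  have Di: "integrable \<mu> (\<lambda>x. cmod (G n x - G m x))" for m n using Gi by auto
  have "\<forall>j. \<exists>N. \<forall>m\<ge>N. \<forall>n\<ge>m. (\<integral>x. cmod (G n x - G m x) \<partial>\<mu>) \<le> (1 / 2) ^ j"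
    using cauchy by simp
  from choice[OF this] obtain N where
    N: "\<forall>j. \<forall>m\<ge>N j. \<forall>n\<ge>m. (\<integral>x. cmod (G n x - G m x) \<partial>\<mu>) \<le> (1 / 2) ^ j" by blast
  \<comment> \<open>\<open>Max\<close> makes the indices monotone and puts \<open>r j\<close> beyond
    \<open>N j\<close>; the summand \<open>j\<close> sends them to infinity.\<close>
  define r where "r = (\<lambda>j. j + Max (N ` {..j}))"
  have rN: "N j \<le> r j" for j unfolding r_def by (intro trans_le_add2 Max_ge) auto
  have rmono: "r j \<le> r (Suc j)" for j unfolding r_def by (intro add_mono Max_mono) auto
  have rge: "j \<le> r j" for j by (simp add: r_def)
  define D where "D = (\<lambda>j x. cmod (G (r (Suc j)) x - G (r j) x))"
  have Dle: "(\<integral>x. D j x \<partial>\<mu>) \<le> (1 / 2) ^ j" for j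
    unfolding D_def using N rN rmono by blast
  have "(\<integral>\<^sup>+x. (\<Sum>j. ennreal (D j x)) \<partial>\<mu>) = (\<Sum>j. \<integral>\<^sup>+x. ennreal (D j x) \<partial>\<mu>)"
    unfolding D_def by (rule nn_integral_suminf) measurable
  also have "\<dots> \<le> (\<Sum>j. ennreal ((1 / 2) ^ j))"
  proof (intro suminf_le summableI)
    fix j
    have "(\<integral>\<^sup>+x. ennreal (D j x) \<partial>\<mu>) = ennreal (\<integral>x. D j x \<partial>\<mu>)"
      using Di by (intro nn_integral_eq_integral) (auto simp: D_def)
    thus "(\<integral>\<^sup>+x. ennreal (D j x) \<partial>\<mu>) \<le> ennreal ((1 / 2) ^ j)" using Dle by (simp only: ennreal_leI)
  qed
  also have "\<dots> = ennreal (\<Sum>j. (1 / 2) ^ j)"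
    by (intro suminf_ennreal2) auto
  also have "\<dots> < \<infinity>" by simp
  finally have "AE x in \<mu>. (\<Sum>j. ennreal (D j x)) \<noteq> \<infinity>"
    by (intro nn_integral_noteq_infinite) (auto simp: D_def)
  hence conv: "AE x in \<mu>. convergent (\<lambda>j. G (r j) x)"
  proof eventually_elim
    case (elim x)
    have "summable (\<lambda>j. D j x)"
      using elim by (intro summable_suminf_not_top) (auto simp: D_def)
    hence "summable (\<lambda>j. G (r (Suc j)) x - G (r j) x)"
      unfolding D_def by (rule summable_norm_cancel)
    hence "convergent (\<lambda>n. \<Sum>j<n. G (r (Suc j)) x - G (r j) x)"
      by (simp add: summable_iff_convergent)
    hence "convergent (\<lambda>n. G (r n) x - G (r 0) x)"
      using sum_lessThan_telescope[of "\<lambda>j. G (r j) x"] by simp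
    from convergent_add[OF this convergent_const[of "G (r 0) x"]] show ?case by simp
  qed
  \<comment> \<open>On the null set where the sequence diverges the value of \<open>lim\<close> is
    irrelevant.\<close>
  define g where "g = (\<lambda>x. lim (\<lambda>j. G (r j) x))"
  have gm [measurable]: "g \<in> borel_measurable \<mu>" unfolding g_def by (rule borel_measurable_lim_metric) measurable
  have lim: "AE x in \<mu>. (\<lambda>j. G (r j) x) \<longlonglongrightarrow> g x"
    using conv by eventually_elim (simp add: g_def convergent_LIMSEQ_iff)
  have gq: "integrable \<mu> (\<lambda>x. cmod (g x) powr q)" "(\<integral>x. cmod (g x) powr q \<partial>\<mu>) \<le> B"
  proof -
    have c: "AE x in \<mu>. (\<lambda>j. cmod (G (r j) x) powr q) \<longlonglongrightarrow> cmod (g x) powr q"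
      using lim
    proof eventually_elim
      case (elim x)
      show ?case by (rule tendsto_powr'[OF tendsto_norm[OF elim] tendsto_const]) (use q in auto)
    qed
    note fb = fatou_bound[OF bounded_measurable_powr_integrable[OF P G less_imp_le[OF q]] _ _ _ c always_eventually[OF allI[OF B]]]
    show "integrable \<mu> (\<lambda>x. cmod (g x) powr q)" by (rule fb(1)) auto
    show "(\<integral>x. cmod (g x) powr q \<partial>\<mu>) \<le> B" by (rule fb(2)) auto
  qed
  \<comment> \<open>Fatou's lemma with \<open>m\<close> fixed and the subsequence going to infinity
    turns the Cauchy estimate into an estimate of the distance to \<open>g\<close>.\<close>
  have tail: "integrable \<mu> (\<lambda>x. cmod (g x - G m x))" "(\<integral>x. cmod (g x - G m x) \<partial>\<mu>) \<le> e"
    if m: "\<forall>n\<ge>m. (\<integral>x. cmod (G n x - G m x) \<partial>\<mu>) \<le> e" for m e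
  proof -
    have c: "AE x in \<mu>. (\<lambda>j. cmod (G (r j) x - G m x)) \<longlonglongrightarrow> cmod (g x - G m x)"
      using lim by eventually_elim (intro tendsto_norm tendsto_diff tendsto_const)
    have ev: "eventually (\<lambda>j. (\<integral>x. cmod (G (r j) x - G m x) \<partial>\<mu>) \<le> e) sequentially"
      unfolding eventually_sequentially using m rge by (intro exI[of _ m]) (meson le_trans)
    note fb = fatou_bound[OF Di _ _ _ c ev]
    show "integrable \<mu> (\<lambda>x. cmod (g x - G m x))" by (rule fb(1)) auto
    show "(\<integral>x. cmod (g x - G m x) \<partial>\<mu>) \<le> e" by (rule fb(2)) auto
  qed
  obtain m0 where m0: "\<forall>n\<ge>m0. (\<integral>x. cmod (G n x - G m0 x) \<partial>\<mu>) \<le> 1"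
    using cauchy[of 1] by auto
  have di: "integrable \<mu> (\<lambda>x. g x - G m x)" if "integrable \<mu> (\<lambda>x. cmod (g x - G m x))" for m
    using that by (subst (asm) integrable_norm_iff) auto
  have gi: "integrable \<mu> g"
    using Bochner_Integration.integrable_add[OF di[OF tail(1)[OF m0]] Gi[of m0]] by simp
  have wlim: "(\<lambda>n. \<integral>x. G n x * \<phi> x \<partial>\<mu>) \<longlonglongrightarrow> (\<integral>x. g x * \<phi> x \<partial>\<mu>)" if \<phi>: "bounded_measurable \<mu> \<phi>" for \<phi>
  proof -
    obtain E where E: "\<phi> \<in> borel_measurable \<mu>" "\<And>x. cmod (\<phi> x) \<le> E" "E > 0"
      using bounded_measurableE[OF \<phi>] by blast
    note [measurable] = E(1)
    have mi: "integrable \<mu> (\<lambda>x. h x * \<phi> x)" if h: "integrable \<mu> h" for h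
    proof (rule Bochner_Integration.integrable_bound)
      show "integrable \<mu> (\<lambda>x. E * cmod (h x))" using h by simp
      show "(\<lambda>x. h x * \<phi> x) \<in> borel_measurable \<mu>" using h by measurable
      show "AE x in \<mu>. norm (h x * \<phi> x) \<le> norm (E * cmod (h x))"
        using E by (intro AE_I2) (simp add: norm_mult mult.commute mult_right_mono abs_mult)
    qed
    show ?thesis
    proof (rule LIMSEQ_I)
      fix e :: real assume e: "e > 0"
      define e' where "e' = e / (2 * E)"
      have e': "e' > 0" using e E by (simp add: e'_def)
      obtain K where K: "\<forall>m\<ge>K. \<forall>n\<ge>m. (\<integral>x. cmod (G n x - G m x) \<partial>\<mu>) \<le> e'"
        using cauchy[OF e'] by blast
      show "\<exists>no. \<forall>n\<ge>no. norm ((\<integral>x. G n x * \<phi> x \<partial>\<mu>) - (\<integral>x. g x * \<phi> x \<partial>\<mu>)) < e"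
      proof (intro exI[of _ K] allI impI)
        fix n assume "n \<ge> K"
        hence n: "\<forall>l\<ge>n. (\<integral>x. cmod (G l x - G n x) \<partial>\<mu>) \<le> e'" using K by blast
        have "(\<integral>x. g x * \<phi> x \<partial>\<mu>) - (\<integral>x. G n x * \<phi> x \<partial>\<mu>) = (\<integral>x. (g x - G n x) * \<phi> x \<partial>\<mu>)"
          using mi[OF gi] mi[OF Gi] by (simp add: left_diff_distrib)
        also have "norm \<dots> \<le> (\<integral>x. E * cmod (g x - G n x) \<partial>\<mu>)"
        proof (rule order_trans[OF integral_norm_bound integral_mono'])
          show "integrable \<mu> (\<lambda>x. E * cmod (g x - G n x))" using tail(1)[OF n] by simp
          fix x
          show "norm ((g x - G n x) * \<phi> x) \<le> E * cmod (g x - G n x)"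
            using E(2)[of x] by (simp add: norm_mult mult.commute mult_right_mono)
          show "0 \<le> E * cmod (g x - G n x)" using E by simp
        qed
        also have "\<dots> \<le> E * e'" using tail(2)[OF n] E by simp
        also have "\<dots> < e" using e E by (simp add: e'_def)
        finally show "norm ((\<integral>x. G n x * \<phi> x \<partial>\<mu>) - (\<integral>x. g x * \<phi> x \<partial>\<mu>)) < e"
          by (simp add: norm_minus_commute)
      qed
    qed
  qed
  show ?thesis by (rule that[OF gm gi gq wlim])
qed

section \<open>The operator norm of a matrix\<close>

lemma l2_norm_eq: "v \<in> carrier_vec n \<Longrightarrow> l2_norm v = sqrt (\<Sum>i<n. (cmod (vec_index v i))\<^sup>2)"
  by (auto simp: l2_norm_def)

lemma l2_norm_nonneg: "0 \<le> l2_norm v"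
  by (simp add: l2_norm_def sum_nonneg)

lemma mat_vec_index:
  assumes "M \<in> carrier_mat n m" "v \<in> carrier_vec m" "i < n"
  shows "vec_index (M *\<^sub>v v) i = (\<Sum>j<m. M $$ (i, j) * vec_index v j)"
  using assms by (auto simp: scalar_prod_def lessThan_atLeast0 intro!: sum.cong)

text \<open>Ensures that the real supremum in \<open>mat_op_norm\<close> is a genuine one; a crude
  bound by row sums is enough.\<close>

lemma mat_op_norm_bdd:
  assumes M: "M \<in> carrier_mat n m"
  shows "bdd_above ((\<lambda>v. l2_norm (M *\<^sub>v v)) ` {v \<in> carrier_vec (dim_col M). l2_norm v \<le> 1})"
proof (rule bdd_aboveI2)
  fix v assume "v \<in> {v \<in> carrier_vec (dim_col M). l2_norm v \<le> 1}"
  hence v: "v \<in> carrier_vec m" "l2_norm v \<le> 1" using M by auto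
  have Mv: "M *\<^sub>v v \<in> carrier_vec n" using M v by simp
  have e: "cmod (vec_index v j) \<le> 1" if "j < m" for j
  proof -
    have "(cmod (vec_index v j))\<^sup>2 \<le> (\<Sum>i<m. (cmod (vec_index v i))\<^sup>2)"
      using that by (intro member_le_sum) auto
    also have "\<dots> \<le> 1" using v(2) unfolding l2_norm_eq[OF v(1)] by simp
    finally show ?thesis by (simp add: abs_square_le_1)
  qed
  have "l2_norm (M *\<^sub>v v) = sqrt (\<Sum>i<n. (cmod (\<Sum>j<m. M $$ (i, j) * vec_index v j))\<^sup>2)"
    unfolding l2_norm_eq[OF Mv] by (simp add: mat_vec_index[OF M v(1)])
  also have "\<dots> \<le> sqrt (\<Sum>i<n. (\<Sum>j<m. cmod (M $$ (i, j)))\<^sup>2)"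
  proof (intro real_sqrt_le_mono sum_mono power_mono)
    fix i
    show "cmod (\<Sum>j<m. M $$ (i, j) * vec_index v j) \<le> (\<Sum>j<m. cmod (M $$ (i, j)))"
      using e by (intro order_trans[OF norm_sum] sum_mono) (simp add: norm_mult mult_left_le)
  qed auto
  finally show "l2_norm (M *\<^sub>v v) \<le> sqrt (\<Sum>i<n. (\<Sum>j<m. cmod (M $$ (i, j)))\<^sup>2)" .
qed

lemma mat_op_norm_nonneg:
  assumes M: "M \<in> carrier_mat n m"
  shows "0 \<le> mat_op_norm M"
proof -
  have "0\<^sub>v (dim_col M) \<in> {v \<in> carrier_vec (dim_col M). l2_norm v \<le> 1}"
    by (simp add: l2_norm_def)
  from cSUP_upper[OF this mat_op_norm_bdd[OF M]] show ?thesis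
    unfolding mat_op_norm_def using l2_norm_nonneg order_trans by blast
qed

lemma l2_norm_smult: "l2_norm (c \<cdot>\<^sub>v v) = cmod c * l2_norm v"
proof -
  have "(\<Sum>i<dim_vec v. (cmod (vec_index (c \<cdot>\<^sub>v v) i))\<^sup>2) = (cmod c)\<^sup>2 * (\<Sum>i<dim_vec v. (cmod (vec_index v i))\<^sup>2)"
    unfolding sum_distrib_left by (intro sum.cong refl) (simp add: norm_mult power_mult_distrib)
  thus ?thesis by (simp add: l2_norm_def real_sqrt_mult)
qed

lemma l2_norm_mat_vec_le:
  assumes M: "M \<in> carrier_mat n m" and v: "v \<in> carrier_vec m"
  shows "l2_norm (M *\<^sub>v v) \<le> mat_op_norm M * l2_norm v"
proof (cases "l2_norm v = 0")
  case True
  have "vec_index v j = 0" if "j < m" for j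
  proof -
    have "(\<Sum>i<m. (cmod (vec_index v i))\<^sup>2) = 0" using True unfolding l2_norm_eq[OF v] by simp
    thus ?thesis using that by (subst (asm) sum_nonneg_eq_0_iff) auto
  qed
  hence "(\<Sum>j<m. M $$ (i, j) * vec_index v j) = 0" for i by (intro sum.neutral) auto
  moreover have "M *\<^sub>v v \<in> carrier_vec n" using M v by simp
  ultimately have "l2_norm (M *\<^sub>v v) = 0" by (simp add: l2_norm_eq mat_vec_index[OF M v])
  thus ?thesis using True by simp
next
  case False
  hence pos: "l2_norm v > 0" using l2_norm_nonneg[of v] by simp
  let ?c = "complex_of_real (1 / l2_norm v)"
  let ?w = "?c \<cdot>\<^sub>v v"
  have w: "?w \<in> {v \<in> carrier_vec (dim_col M). l2_norm v \<le> 1}"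
    using M v pos unfolding mem_Collect_eq l2_norm_smult by (auto simp: norm_divide)
  have "l2_norm (M *\<^sub>v ?w) \<le> mat_op_norm M"
    unfolding mat_op_norm_def by (rule cSUP_upper[OF w mat_op_norm_bdd[OF M]])
  moreover have "M *\<^sub>v ?w = ?c \<cdot>\<^sub>v (M *\<^sub>v v)" by (rule mult_mat_vec[OF M v])
  ultimately have "l2_norm (M *\<^sub>v v) / l2_norm v \<le> mat_op_norm M"
    using pos by (simp add: l2_norm_smult norm_divide)
  thus ?thesis using pos by (simp add: field_simps)
qed

text \<open>Column by column: column \<open>j\<close> of \<open>A * B\<close> is \<open>A\<close>
  applied to column \<open>j\<close> of \<open>B\<close>.\<close>

lemma mat_op_norm_hs:
  assumes A: "A \<in> carrier_mat n n" and B: "B \<in> carrier_mat n n"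
  shows "(\<Sum>i<n. \<Sum>j<n. (cmod ((A * B) $$ (i, j)))\<^sup>2) \<le> (mat_op_norm A)\<^sup>2 * (\<Sum>i<n. \<Sum>j<n. (cmod (B $$ (i, j)))\<^sup>2)"
proof -
  have col: "(\<Sum>i<n. (cmod ((A * B) $$ (i, j)))\<^sup>2) \<le> (mat_op_norm A)\<^sup>2 * (\<Sum>i<n. (cmod (B $$ (i, j)))\<^sup>2)"
    if j: "j < n" for j
  proof -
    define v where "v = Matrix.col B j"
    have v: "v \<in> carrier_vec n" using B j by (simp add: v_def)
    have Av: "A *\<^sub>v v \<in> carrier_vec n" using A v by simp
    have "(\<Sum>i<n. (cmod ((A * B) $$ (i, j)))\<^sup>2) = (l2_norm (A *\<^sub>v v))\<^sup>2"
      unfolding l2_norm_eq[OF Av] using A B j by (simp add: v_def sum_nonneg)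
    also have "\<dots> \<le> (mat_op_norm A * l2_norm v)\<^sup>2"
      by (intro power_mono l2_norm_mat_vec_le[OF A v] l2_norm_nonneg)
    also have "(l2_norm v)\<^sup>2 = (\<Sum>i<n. (cmod (B $$ (i, j)))\<^sup>2)"
      unfolding l2_norm_eq[OF v] using B j by (simp add: v_def sum_nonneg)
    hence "(mat_op_norm A * l2_norm v)\<^sup>2 = (mat_op_norm A)\<^sup>2 * (\<Sum>i<n. (cmod (B $$ (i, j)))\<^sup>2)"
      by (simp add: power_mult_distrib)
    finally show ?thesis .
  qed
  have "(\<Sum>i<n. \<Sum>j<n. (cmod ((A * B) $$ (i, j)))\<^sup>2) = (\<Sum>j<n. \<Sum>i<n. (cmod ((A * B) $$ (i, j)))\<^sup>2)"
    by (rule sum.swap)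
  also have "\<dots> \<le> (\<Sum>j<n. (mat_op_norm A)\<^sup>2 * (\<Sum>i<n. (cmod (B $$ (i, j)))\<^sup>2))"
    using col by (intro sum_mono) auto
  also have "\<dots> = (mat_op_norm A)\<^sup>2 * (\<Sum>i<n. \<Sum>j<n. (cmod (B $$ (i, j)))\<^sup>2)"
    unfolding sum_distrib_left[symmetric] by (subst sum.swap) (rule refl)
  finally show ?thesis .
qed

section \<open>The multiplier theorem\<close>


context su2_dual
begin

text \<open>Orthogonality leaves one term, whose factor \<open>1 / Suc k\<close> cancels the
  dimension in the series. The indices appear swapped because of the adjoint in the Fourier
  coefficient.\<close>

lemma trig_sum_coefficient:
  assumes K: "finite K" "k \<in> K" and ij: "i < Suc k" "j < Suc k"
  shows "(\<integral>u. trig_sum K S u * cnj (t k u $$ (i, j)) \<partial>\<mu>) = S k j i"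
proof -
  have c: "coef (\<lambda>u. t k u $$ (i, j)) l a b = (if k = l \<and> i = b \<and> j = a then 1 / of_nat (Suc k) else 0)"
    if "a < Suc l" "b < Suc l" for l a b
    unfolding coef_def by (rule schur_orthogonality[OF ij that(2,1)])
  have "(\<Sum>a<Suc l. \<Sum>b<Suc l. S l a b * cnj (coef (\<lambda>u. t k u $$ (i, j)) l a b))
      = (if l = k then S k j i / of_nat (Suc k) else 0)" for l
  proof (cases "l = k")
    case True
    have "(\<Sum>a<Suc l. \<Sum>b<Suc l. S l a b * cnj (coef (\<lambda>u. t k u $$ (i, j)) l a b))
      = (\<Sum>a<Suc k. if a = j then (\<Sum>b<Suc k. if b = i then S k j i / of_nat (Suc k) else 0) else 0)"
      unfolding True
    proof (rule sum.cong[OF refl])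
      fix a assume a: "a \<in> {..<Suc k}"
      show "(\<Sum>b<Suc k. S k a b * cnj (coef (\<lambda>u. t k u $$ (i, j)) k a b))
        = (if a = j then (\<Sum>b<Suc k. if b = i then S k j i / of_nat (Suc k) else 0) else 0)"
      proof (cases "a = j")
        case True
        have "(\<Sum>b<Suc k. S k a b * cnj (coef (\<lambda>u. t k u $$ (i, j)) k a b))
          = (\<Sum>b<Suc k. if b = i then S k j i / of_nat (Suc k) else 0)"
          using a True by (intro sum.cong refl) (simp add: c del: of_nat_Suc)
        thus ?thesis unfolding if_P[OF True] .
      next
        case False
        thus ?thesis using a by (simp add: c)
      qed
    qed
    thus ?thesis using True ij by (simp del: of_nat_Suc)
  next
    case False
    thus ?thesis by (auto simp: c intro!: sum.neutral)
  qed
  hence "(\<integral>u. trig_sum K S u * cnj (t k u $$ (i, j)) \<partial>\<mu>)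
    = (\<Sum>l\<in>K. of_nat (Suc l) * (if l = k then S k j i / of_nat (Suc k) else 0))"
    unfolding trig_sum_pairing[OF K(1) t_bm[OF ij]] by simp
  also have "\<dots> = (\<Sum>l\<in>K. if l = k then S k j i else 0)"
    by (intro sum.cong refl) (simp del: of_nat_Suc)
  finally show ?thesis using K by simp
qed

lemma multiplier_Lp_Lq:
  assumes p: "1 < p" "p \<le> 2" and q: "2 \<le> q"
    and s: "\<And>k. 0 \<le> s k" and W: "0 \<le> W"
    and weak: "\<And>K x. p < q \<Longrightarrow> finite K \<Longrightarrow> x > 0 \<Longrightarrow>
      (\<Sum>k\<in>{k\<in>K. x < s k}. (real (Suc k))\<^sup>2) \<le> (W / x) powr (1 / (1 / p - 1 / q))"
    and bdd: "\<And>k. s k \<le> W"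
    and f: "bounded_measurable \<mu> f"
    and S: "\<And>k. hs2 k (S k) \<le> (s k)\<^sup>2 * hs2 k (coef f k)"
  obtains g where "g \<in> Lp \<mu> q" "integrable \<mu> g"
    "Lp_norm \<mu> q g \<le> sqrt (paley_const p) * sqrt (paley_const (q / (q - 1))) * W * Lp_norm \<mu> p f"
    "\<And>k i j. i < Suc k \<Longrightarrow> j < Suc k \<Longrightarrow> (\<integral>u. g u * cnj (t k u $$ (i, j)) \<partial>\<mu>) = S k j i"
proof -
  interpret prob_space \<mu> by (rule haar_prob')
  define B where "B = sqrt (paley_const p) * sqrt (paley_const (q / (q - 1))) * W * Lp_norm \<mu> p f"
  have q': "1 < q / (q - 1)" "q / (q - 1) \<le> 2" using q by (auto simp: field_simps)
  have B0: "B \<ge> 0" using W paley_const_ge[OF p] paley_const_ge[OF q'] by (simp add: B_def Lp_norm_def)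
  define G where "G = (\<lambda>n. trig_sum {..n::nat} S)"
  have Gbm: "bounded_measurable \<mu> (G n)" for n unfolding G_def by (rule trig_sum_bm)
  have Gq: "(\<integral>u. cmod (G n u) powr q \<partial>\<mu>) \<le> B powr q" for n
  proof -
    have "(\<integral>u. cmod (G n u) powr q \<partial>\<mu>) powr (1 / q) \<le> B"
    proof (rule duality_bound[OF haar_prob' Gbm q B0])
      fix h assume h: "bounded_measurable \<mu> h"
      have "cmod (\<integral>u. G n u * cnj (h u) \<partial>\<mu>) \<le> (\<Sum>k\<le>n. s k * (sqrt (energy k f) * sqrt (energy k h)))"
        unfolding G_def by (rule trig_sum_pairing_bound[OF _ h s S]) simp
      also have "\<dots> \<le> sqrt (paley_const p) * sqrt (paley_const (q / (q - 1))) * W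
       * (\<integral>u. cmod (f u) powr p \<partial>\<mu>) powr (1 / p) * (\<integral>u. cmod (h u) powr (q / (q - 1)) \<partial>\<mu>) powr (1 - 1 / q)"
        by (intro energy_weighted_bound p q s W bdd f h allI impI weak finite_atMost)
      finally show "cmod (\<integral>u. G n u * cnj (h u) \<partial>\<mu>) \<le> B * (\<integral>u. cmod (h u) powr (q / (q - 1)) \<partial>\<mu>) powr (1 - 1 / q)"
        by (simp add: B_def Lp_norm_def)
    qed
    hence "((\<integral>u. cmod (G n u) powr q \<partial>\<mu>) powr (1 / q)) powr q \<le> B powr q"
      using q by (intro powr_mono2) auto
    thus ?thesis using q by (simp add: powr_powr)
  qed
  \<comment> \<open>The squared L2 norm of the part of degree \<open>k\<close>. Boundedness of
    \<open>s\<close> and Bessel's inequality for \<open>f\<close> make it summable, and this is the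
    source of the Cauchy property.\<close>
  define b where "b = (\<lambda>k. real (Suc k) * hs2 k (S k))"
  have b0: "b k \<ge> 0" for k by (simp add: b_def)
  have "summable b"
  proof (rule summableI_nonneg_bounded[OF b0])
    fix n
    have "(\<Sum>k<n. b k) \<le> (\<Sum>k<n. W\<^sup>2 * energy k f)"
    proof (rule sum_mono)
      fix k
      have "hs2 k (S k) \<le> (s k)\<^sup>2 * hs2 k (coef f k)" by (rule S)
      also have "\<dots> \<le> W\<^sup>2 * hs2 k (coef f k)" using s bdd by (intro mult_right_mono power_mono) auto
      finally have "real (Suc k) * hs2 k (S k) \<le> real (Suc k) * (W\<^sup>2 * hs2 k (coef f k))"
        by (intro mult_left_mono) auto
      thus "b k \<le> W\<^sup>2 * energy k f" by (simp only: b_def energy_def mult_ac)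
    qed
    also have "\<dots> \<le> W\<^sup>2 * (\<integral>u. (cmod (f u))\<^sup>2 \<partial>\<mu>)"
      unfolding sum_distrib_left[symmetric] by (intro mult_left_mono energy_bessel f) auto
    finally show "(\<Sum>k<n. b k) \<le> W\<^sup>2 * (\<integral>u. (cmod (f u))\<^sup>2 \<partial>\<mu>)" .
  qed
  have cauchy: "\<exists>N. \<forall>m\<ge>N. \<forall>n\<ge>m. (\<integral>u. cmod (G n u - G m u) \<partial>\<mu>) \<le> e" if e: "e > 0" for e
  proof -
    have "e\<^sup>2 > 0" using e by simp
    then obtain N where N: "\<forall>m\<ge>N. \<forall>n. norm (sum b {m..<n}) < e\<^sup>2"
      using \<open>summable b\<close> unfolding summable_Cauchy by blast
    show ?thesis
    proof (intro exI[of _ N] allI impI)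
      fix m n assume m: "m \<ge> N" and n: "n \<ge> m"
      have "{..n} = {..m} \<union> {m<..n}" "{..m} \<inter> {m<..n} = {}" using n by auto
      hence diff: "G n u - G m u = trig_sum {m<..n} S u" for u
        unfolding G_def trig_sum_def by (simp add: sum.union_disjoint del: of_nat_Suc)
      have bm: "bounded_measurable \<mu> (trig_sum {m<..n} S)" by (rule trig_sum_bm)
      have i1: "integrable \<mu> (\<lambda>u. cmod (trig_sum {m<..n} S u))"
        using bounded_measurable_integrable[OF haar_prob' bm] by simp
      have i2: "integrable \<mu> (\<lambda>u. (cmod (trig_sum {m<..n} S u))\<^sup>2)"
        using bounded_measurable_powr_integrable[OF haar_prob' bm, of 2] by (simp add: powr_numeral)
      have "(\<integral>u. cmod (G n u - G m u) \<partial>\<mu>) \<le> sqrt (\<integral>u. (cmod (trig_sum {m<..n} S u))\<^sup>2 \<partial>\<mu>)"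
        unfolding diff by (rule L1_le_L2[OF i1 i2])
      also have "\<dots> = sqrt (sum b {m<..n})" by (simp only: trig_sum_L2 finite_greaterThanAtMost b_def)
      also have "{m<..n} = {Suc m..<Suc n}" by auto
      also have "sqrt (sum b {Suc m..<Suc n}) \<le> sqrt (e\<^sup>2)"
        using N[rule_format, of "Suc m" "Suc n"] m by (intro real_sqrt_le_mono) (auto simp: abs_less_iff)
      also have "\<dots> = e" using e by simp
      finally show "(\<integral>u. cmod (G n u - G m u) \<partial>\<mu>) \<le> e" .
    qed
  qed
  have qpos: "q > 0" using q by simp
  obtain g where g: "g \<in> borel_measurable \<mu>" "integrable \<mu> g" "integrable \<mu> (\<lambda>x. cmod (g x) powr q)"
    "(\<integral>x. cmod (g x) powr q \<partial>\<mu>) \<le> B powr q"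
    "\<And>\<phi>. bounded_measurable \<mu> \<phi> \<Longrightarrow> (\<lambda>n. \<integral>x. G n x * \<phi> x \<partial>\<mu>) \<longlonglongrightarrow> (\<integral>x. g x * \<phi> x \<partial>\<mu>)"
    using L1_cauchy_limit[OF haar_prob' Gbm cauchy qpos Gq] by blast
  show ?thesis
  proof (rule that)
    show "g \<in> Lp \<mu> q" using g by (simp add: Lp_def)
    show "integrable \<mu> g" by fact
    have "Lp_norm \<mu> q g \<le> (B powr q) powr (1 / q)"
      unfolding Lp_norm_def using g(4) q by (intro powr_mono2) auto
    also have "\<dots> = B" using B0 q by (simp add: powr_powr)
    finally show "Lp_norm \<mu> q g \<le> sqrt (paley_const p) * sqrt (paley_const (q / (q - 1))) * W * Lp_norm \<mu> p f"
      by (simp add: B_def)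
    fix k i j assume ij: "i < Suc k" "j < Suc k"
    \<comment> \<open>The coefficient of a fixed degree no longer changes once
      \<open>n \<ge> k\<close>, so the weak limit must have it too.\<close>
    have "eventually (\<lambda>n. (\<integral>u. G n u * cnj (t k u $$ (i, j)) \<partial>\<mu>) = S k j i) sequentially"
      unfolding eventually_sequentially G_def
      by (intro exI[of _ k] allI impI trig_sum_coefficient ij) auto
    hence "(\<lambda>n. \<integral>u. G n u * cnj (t k u $$ (i, j)) \<partial>\<mu>) \<longlonglongrightarrow> S k j i"
      by (rule tendsto_eventually)
    with g(5)[OF bounded_measurable_cnj[OF t_bm[OF ij]]]
    show "(\<integral>u. g u * cnj (t k u $$ (i, j)) \<partial>\<mu>) = S k j i" by (rule LIMSEQ_unique)
  qed
qed

end

text \<open>For \<open>a = 0\<close> the first bound relies on the value of \<open>epowr\<close> at infinity: the power of the mass of a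
  nonempty level set is at least \<open>1\<close> in all cases.\<close>

lemma weak_type_bounds:
  fixes s :: "nat \<Rightarrow> real"
  assumes W: "0 \<le> W" and a: "0 \<le> a"
    and le: "\<And>x. x > 0 \<Longrightarrow>
      ennreal x * (\<Sum>\<^sub>\<infinity>k\<in>{k. x < s k}. ennreal ((real k + 1)\<^sup>2)) epowr a \<le> ennreal W"
  shows "s k \<le> W"
    and "a > 0 \<Longrightarrow> finite K \<Longrightarrow> x > 0 \<Longrightarrow> (\<Sum>k\<in>{k\<in>K. x < s k}. (real (Suc k))\<^sup>2) \<le> (W / x) powr (1 / a)"
proof -
  define E where "E = (\<lambda>x. \<Sum>\<^sub>\<infinity>k\<in>{k. x < s k}. ennreal ((real k + 1)\<^sup>2))"
  have E: "ennreal x * E x epowr a \<le> ennreal W" if "x > 0" for x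
    using le[OF that] by (simp add: E_def)
  have fin: "ennreal (\<Sum>k\<in>J. (real (Suc k))\<^sup>2) \<le> E x" if "finite J" "J \<subseteq> {k. x < s k}" for J x
  proof -
    have "ennreal (\<Sum>k\<in>J. (real (Suc k))\<^sup>2) = (\<Sum>k\<in>J. ennreal ((real k + 1)\<^sup>2))"
      by (simp add: add.commute)
    also have "\<dots> \<le> E x"
      unfolding E_def by (subst nonneg_infsum_complete) (use that in \<open>auto intro!: SUP_upper\<close>)
    finally show ?thesis .
  qed
  show "s k \<le> W"
  proof (rule ccontr)
    assume "\<not> s k \<le> W"
    \<comment> \<open>A level strictly between \<open>W\<close> and \<open>s k\<close>, positive
      since \<open>W \<ge> 0\<close>. Its level set contains \<open>k\<close>, so \<open>x\<close>
      itself would be at most \<open>W\<close>.\<close>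
    define x where "x = (W + s k) / 2"
    have x: "x > 0" "W < x" "x < s k" using \<open>\<not> s k \<le> W\<close> W by (auto simp: x_def)
    have "1 \<le> (real (Suc k))\<^sup>2" by simp
    hence "ennreal 1 \<le> ennreal (\<Sum>k\<in>{k}. (real (Suc k))\<^sup>2)" by (intro ennreal_leI) simp
    also have "\<dots> \<le> E x" using x by (intro fin) auto
    finally have E1: "1 \<le> E x" by simp
    have "1 \<le> E x epowr a"
    proof (cases "E x = \<infinity>")
      case False
      then obtain e where e: "E x = ennreal e" "e \<ge> 0" by (cases "E x") auto
      have "e \<ge> 1" using E1 e by simp
      hence "1 \<le> e powr a" using a by (rule ge_one_powr_ge_zero)
      thus ?thesis using e by (simp add: epowr_def)
    qed (simp add: epowr_def)
    hence "ennreal x * 1 \<le> ennreal x * E x epowr a" by (intro mult_left_mono) auto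
    also have "\<dots> \<le> ennreal W" by (rule E[OF x(1)])
    finally show False using x W by (simp add: ennreal_le_iff)
  qed
  assume a: "a > 0" and K: "finite K" and x: "x > 0"
  have "E x \<noteq> \<infinity>"
  proof
    assume "E x = \<infinity>"
    hence "ennreal x * \<infinity> \<le> ennreal W" using E[OF x] a by (simp add: epowr_def)
    thus False using x by (simp add: ennreal_mult_top top_unique)
  qed
  then obtain e where e: "E x = ennreal e" "e \<ge> 0" by (cases "E x") auto
  have "ennreal (x * e powr a) \<le> ennreal W"
    using E[OF x] e x by (simp add: epowr_def ennreal_mult)
  hence "x * e powr a \<le> W" using W by (simp add: ennreal_le_iff)
  hence "e powr a \<le> W / x" using x by (simp add: field_simps)
  hence "(e powr a) powr (1 / a) \<le> (W / x) powr (1 / a)" using a by (intro powr_mono2) auto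
  hence "e \<le> (W / x) powr (1 / a)" using a e by (simp add: powr_powr)
  moreover have "(\<Sum>k\<in>{k\<in>K. x < s k}. (real (Suc k))\<^sup>2) \<le> e"
  proof -
    have "{k\<in>K. x < s k} \<subseteq> {k. x < s k}" by blast
    from fin[OF _ this] show ?thesis using K e by (simp add: ennreal_le_iff)
  qed
  ultimately show "(\<Sum>k\<in>{k\<in>K. x < s k}. (real (Suc k))\<^sup>2) \<le> (W / x) powr (1 / a)" by linarith
qed

theorem theorem4p1:
  fixes p q :: real
  assumes "1 < p" and "p \<le> 2" and "2 \<le> q"
  shows "\<exists>C>0. \<forall>\<mu> t A \<sigma>.
    normalized_haar \<mu> \<longrightarrow> (\<forall>k. unitary_matrix_rep k (t k)) \<longrightarrow>
    left_invariant_operator A \<longrightarrow> is_symbol \<mu> t A \<sigma> \<longrightarrow>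
    Lp_Lq_norm \<mu> p q A \<le> ennreal C *
      (SUP s\<in>{0<..}. ennreal s *
        (\<Sum>\<^sub>\<infinity>k\<in>{k. s < mat_op_norm (\<sigma> k)}. ennreal ((real k + 1)\<^sup>2)) epowr (1 / p - 1 / q))"
proof -
  \<comment> \<open>One square root for \<open>f\<close> with exponent \<open>p\<close>, one for the
    test function with the dual exponent of \<open>q\<close>, as Cauchy-Schwarz delivers
    them.\<close>
  define C where "C = sqrt (paley_const p) * sqrt (paley_const (q / (q - 1)))"
  have q': "1 < q / (q - 1)" "q / (q - 1) \<le> 2" using assms by (auto simp: field_simps)
  have C: "C > 0" using paley_const_ge[OF assms(1,2)] paley_const_ge[OF q'] by (simp add: C_def)
  have a: "0 \<le> 1 / p - 1 / q" using assms by (simp add: field_simps)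
  show ?thesis
  proof (intro exI[of _ C] conjI allI impI C)
    fix \<mu> t A \<sigma>
    assume haar: "normalized_haar \<mu>" and rep: "\<forall>k. unitary_matrix_rep k (t k)"
      and A: "left_invariant_operator A" and sym: "is_symbol \<mu> t A \<sigma>"
    interpret su2_dual \<mu> t by unfold_locales (use haar rep in auto)
    let ?F = "\<lambda>s. ennreal s * (\<Sum>\<^sub>\<infinity>k\<in>{k. s < mat_op_norm (\<sigma> k)}. ennreal ((real k + 1)\<^sup>2)) epowr (1 / p - 1 / q)"
    define W' where "W' = (SUP s\<in>{0<..}. ?F s)"
    have "Lp_Lq_norm \<mu> p q A \<le> ennreal C * W'"
    proof (cases "W' = \<infinity>")
      case True
      thus ?thesis using C by (simp add: ennreal_mult_top)
    next
      case False
      then obtain W where W: "W' = ennreal W" "W \<ge> 0" by (cases W') auto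
      have le: "?F x \<le> ennreal W" if "x > 0" for x
        unfolding W(1)[symmetric] W'_def using that by (intro SUP_upper) auto
      note wb = weak_type_bounds[OF W(2) a le]
      have \<sigma>: "\<sigma> k \<in> carrier_mat (Suc k) (Suc k)" for k
        using sym unfolding is_symbol_def by blast
      have "\<exists>g\<in>Lp \<mu> q. represents \<mu> g (A f) \<and> Lp_norm \<mu> q g \<le> (C * W) * Lp_norm \<mu> p f"
        if f: "smooth f" for f
      proof -
        have fbm: "bounded_measurable \<mu> f" by (intro cont_bm smooth_continuous f)
        \<comment> \<open>The Fourier coefficients that the symbol prescribes for
          \<open>A f\<close>. A function having them is constructed first and only then identified
          with \<open>A f\<close>.\<close>
        define S where "S = (\<lambda>k i j. (\<sigma> k * fourier \<mu> t f k) $$ (i, j))"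
        have hs: "hs2 k (S k) \<le> (mat_op_norm (\<sigma> k))\<^sup>2 * hs2 k (coef f k)" for k
        proof -
          have F: "fourier \<mu> t f k \<in> carrier_mat (Suc k) (Suc k)" by (simp add: fourier_def)
          have "hs2 k (coef f k) = (\<Sum>i<Suc k. \<Sum>j<Suc k. (cmod (fourier \<mu> t f k $$ (i, j)))\<^sup>2)"
            unfolding hs2_def by (intro sum.cong refl) (simp add: fourier_index)
          thus ?thesis using mat_op_norm_hs[OF \<sigma> F] by (simp add: hs2_def S_def)
        qed
        have weak: "(\<Sum>k\<in>{k\<in>K. x < mat_op_norm (\<sigma> k)}. (real (Suc k))\<^sup>2) \<le> (W / x) powr (1 / (1 / p - 1 / q))"
          if "p < q" "finite K" "x > 0" for K x
          using that assms by (intro wb(2)) (auto simp: field_simps)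
        obtain g where g: "g \<in> Lp \<mu> q" "integrable \<mu> g"
          "Lp_norm \<mu> q g \<le> sqrt (paley_const p) * sqrt (paley_const (q / (q - 1))) * W * Lp_norm \<mu> p f"
          "\<And>k i j. i < Suc k \<Longrightarrow> j < Suc k \<Longrightarrow> (\<integral>u. g u * cnj (t k u $$ (i, j)) \<partial>\<mu>) = S k j i"
          using multiplier_Lp_Lq[OF assms mat_op_norm_nonneg[OF \<sigma>] W(2) weak wb(1) fbm hs] by blast
        have "represents \<mu> g (A f)"
        proof (rule represents_if_coefficients_agree[OF _ g(2)])
          show "distribution (A f)" using A f unfolding left_invariant_operator_def by blast
          fix k i j assume ij: "i < Suc k" "j < Suc k"
          have "dist_fourier t (A f) k = \<sigma> k * fourier \<mu> t f k"
            using sym f unfolding is_symbol_def by blast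
          hence "dist_fourier t (A f) k $$ (j, i) = S k j i" by (simp add: S_def)
          moreover have "dist_fourier t (A f) k $$ (j, i) = A f (\<lambda>u. cnj (t k u $$ (i, j)))"
            using ij by (simp add: dist_fourier_def t_adjoint_index)
          ultimately show "A f (\<lambda>u. cnj (t k u $$ (i, j))) = (\<integral>u. g u * cnj (t k u $$ (i, j)) \<partial>\<mu>)"
            using g(4)[OF ij] by simp
        qed
        with g(1,3) show ?thesis by (auto simp: C_def)
      qed
      hence "Lp_Lq_norm \<mu> p q A \<le> ennreal (C * W)"
        unfolding Lp_Lq_norm_def using C W(2) by (intro Inf_lower) auto
      also have "\<dots> = ennreal C * W'" using C W by (simp add: ennreal_mult)
      finally show ?thesis .
    qed
    thus "Lp_Lq_norm \<mu> p q A \<le> ennreal C * (SUP s\<in>{0<..}. ?F s)" by (simp only: W'_def)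
  qed
qed

end
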